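(* Let $A$ and $X$ be Banach algebras such that $X$ is an algebraic Banach $A$-module, and let $n\in\mathbb{N}$, $n\ge1$. The Banach algebra $A\bowtie X$ is $(2n)$-weakly amenable if and only if all of the following hold: (1) If $D_A:A\to A^{(2n)}$ is a derivation such that there exist a derivation $D_X:A\to X^{(2n)}$, a bounded linear operator $T_X:X\to X^{(2n)}$ and a bounded $A$-module homomorphism $T_A:X\to A^{(2n)}$ satisfying $T_A(xy)=0$, $T_X(ax)=D_A(a)x+D_X(a)x+aT_X(x)$, $T_X(xa)=xD_A(a)+xD_X(a)+T_X(x)a$ and $T_X(xy)=xT_X(y)+T_X(x)y+T_A(x)y+xT_A(y)$ for all $a\in A$ and $x,y\in X$, then $D_A$ is inner. (2) If $T_X:X\to X^{(2n)}$ is a bounded linear operator such that there exist a derivation $D_X:A\to X^{(2n)}$ and a bounded $A$-module homomorphism $T_A:X\to A^{(2n)}$ satisfying $T_A(xy)=0$, $T_X(ax)=D_X(a)x+aT_X(x)$, $T_X(xa)=xD_X(a)+T_X(x)a$ and $T_X(xy)=xT_X(y)+T_X(x)y+T_A(x)y+xT_A(y)$ for all $a\in A$ and $x,y\in X$, then there exist $F\in A^{(2n)}$ and $G\in X^{(2n)}$ such that $T_X=\delta_F+d_G$ (on $X$) and $aF=Fa$ for all $a\in A$. (3) If $D_X:A\to X^{(2n)}$ is a derivation such that $xD_X(a)=D_X(a)x=0$ in $X^{(2n)}$ for all $a\in A$ and $x\in X$, then there exist $G\in X^{(2n)}$ and $F\in A^{(2n)}$ such that $D_X=d_G$ (on $A$),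 $d_G+\delta_F=0$ (on $X$) and $aF=Fa$ for all $a\in A$. (4) If $T_A:X\to A^{(2n)}$ is a bounded $A$-module homomorphism such that $T_A(xy)=0$ for all $x,y\in X$, and there exists a bounded $A$-module homomorphism $T_X:X\to X^{(2n)}$ satisfying $T_X(xy)=xT_X(y)+T_X(x)y+T_A(x)y+xT_A(y)$ for all $x,y\in X$, then $T_A=0$. Here $\delta_F(x)=xF-Fx$ for $x\in X$.
   Context: Conventions. "Module" means two-sided module (bimodule). A derivation from a Banach algebra $B$ to a Banach $B$-module $E$ is a bounded linear map $D:B\to E$ with $D(bc)=D(b)c+bD(c)$; for $e\in E$, $d_e(b)=be-eb$ is the inner derivation implemented by $e$. $E^{(m)}$ is the $m$-th dual of $E$, $E^{(0)}=E$. The dual $E^*$ of a Banach $B$-module is a Banach $B$-module via $\langle b\varphi,e\rangle=\langle\varphi,eb\rangle$, $\langle\varphi b,e\rangle=\langle\varphi,be\rangle$; iterating gives $E^{(m)}$ a $B$-module structure. For $m\ge1$, $B$ is $m$-weakly amenable if every derivation $B\to B^{(m)}$ is inner. For Banach algebras $A,X$ with $X$ a Banach $A$-module, $X$ is an algebraic Banach $A$-module if $a(xy)=(ax)y$, $(xy)a=x(ya)$, $(xa)y=x(ay)$, $\|ax\|\le\|a\|\|x\|$, $\|xa\|\le\|a\|\|x\|$ for all $a\in A$, $x,y\in X$. Then $A\bowtie X$ is the $\ell^1$-direct sum $A\times X$ with product $(a,x)(b,y)=(ab,ay+xb+xy)$, a Banach algebra. Identify $(A\bowtie X)^{(2n)}$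 with $A^{(2n)}\times X^{(2n)}$. For $a\in A$, $x\in X$, $F\in A^{(2n)}$, $G\in X^{(2n)}$ its module operations are $(F,G)(a,x)=(Fa,Fx+Ga+Gx)$, $(a,x)(F,G)=(aF,xF+aG+xG)$, where $Fa,aF\in A^{(2n)}$ and $Fx,xF,Ga,aG,Gx,xG\in X^{(2n)}$. The products $xF,Fx\in X^{(2n)}$ are: for $n=0$ the module actions of $A$ on $X$; recursively, for $g\in X^{(2k+1)}$ let $xg,gx\in A^{(2k+1)}$ be $\langle xg,F\rangle=\langle g,Fx\rangle$, $\langle gx,F\rangle=\langle g,xF\rangle$ ($F\in A^{(2k)}$), and for $F\in A^{(2k+2)}$ let $\langle xF,g\rangle=\langle F,gx\rangle$, $\langle Fx,g\rangle=\langle F,xg\rangle$ ($g\in X^{(2k+1)}$). *)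

theory Defs
  imports "HOL-Analysis.Abstract_Metric_Spaces" "HOL-Algebra.Module"
begin

section \<open>Normed spaces, Banach algebras and Banach modules\<close>

text \<open>
  The spaces \<open>E\<^sup>(\<^sup>m\<^sup>)\<close> live on types that would have to vary with \<open>m\<close>, so all spaces are
  structures with an explicit carrier. The record \<open>module\<close> provides \<open>\<oplus>\<close>, \<open>\<zero>\<close>, \<open>\<odot>\<close> and \<open>\<otimes>\<close>. The
  product \<open>\<otimes>\<close> is meaningful only for algebras; the inherited field \<open>\<one>\<close> is never used, since algebras
  are not assumed to be unital.

  The scalars form a type of class \<^class>\<open>real_normed_field\<close>, whose norm is multiplicative; this covers
  real and complex scalars, and, by the Gelfand-Mazur theorem, nothing else up to isomorphism.
\<close>

record ('k, 'v) nspace = "('k, 'v) module" +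
  nrm :: "'v \<Rightarrow> real" ("(\<open>open_block notation=\<open>mixfix norm\<close>\<close>\<parallel>_\<parallel>\<index>)")

definition scalars :: "('k::real_normed_field, 'k) nspace" where
  "scalars = \<lparr>carrier = UNIV, monoid.mult = (*), one = 1, ring.zero = 0, add = (+),
              smult = (*), nrm = norm\<rparr>"

locale normed_space = Module.module scalars V
  for V :: "('k::real_normed_field, 'v, 'm) nspace_scheme" (structure) +
  assumes nrm_nonneg: "x \<in> carrier V \<Longrightarrow> 0 \<le> \<parallel>x\<parallel>"
    and nrm_eq_0_iff: "x \<in> carrier V \<Longrightarrow> \<parallel>x\<parallel> = 0 \<longleftrightarrow> x = \<zero>"
    and nrm_triangle: "\<lbrakk>x \<in> carrier V; y \<in> carrier V\<rbrakk> \<Longrightarrow> \<parallel>x \<oplus> y\<parallel> \<le> \<parallel>x\<parallel> + \<parallel>y\<parallel>"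
    and nrm_smult: "x \<in> carrier V \<Longrightarrow> \<parallel>c \<odot> x\<parallel> = norm c * \<parallel>x\<parallel>"

text \<open>The value outside the carrier is irrelevant, but \<^locale>\<open>Metric_space\<close> demands a total
  symmetric nonnegative function.\<close>

definition ndist :: "('k, 'v, 'm) nspace_scheme \<Rightarrow> 'v \<Rightarrow> 'v \<Rightarrow> real" where
  "ndist V x y = (if x \<in> carrier V \<and> y \<in> carrier V then \<parallel>x \<ominus>\<^bsub>V\<^esub> y\<parallel>\<^bsub>V\<^esub> else 0)"

locale banach_space = normed_space +
  assumes complete: "Metric_space.mcomplete (carrier V) (ndist V)"

locale banach_algebra = banach_space A for A (structure) +
  assumes mult_closed: "\<lbrakk>a \<in> carrier A; b \<in> carrier A\<rbrakk> \<Longrightarrow> a \<otimes> b \<in> carrier A"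
    and mult_assoc: "\<lbrakk>a \<in> carrier A; b \<in> carrier A; c \<in> carrier A\<rbrakk> \<Longrightarrow> (a \<otimes> b) \<otimes> c = a \<otimes> (b \<otimes> c)"
    and mult_l_distr: "\<lbrakk>a \<in> carrier A; b \<in> carrier A; c \<in> carrier A\<rbrakk>
      \<Longrightarrow> (a \<oplus> b) \<otimes> c = a \<otimes> c \<oplus> b \<otimes> c"
    and mult_r_distr: "\<lbrakk>a \<in> carrier A; b \<in> carrier A; c \<in> carrier A\<rbrakk>
      \<Longrightarrow> a \<otimes> (b \<oplus> c) = a \<otimes> b \<oplus> a \<otimes> c"
    and mult_smult_l: "\<lbrakk>a \<in> carrier A; b \<in> carrier A\<rbrakk> \<Longrightarrow> (k \<odot> a) \<otimes> b = k \<odot> (a \<otimes> b)"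
    and mult_smult_r: "\<lbrakk>a \<in> carrier A; b \<in> carrier A\<rbrakk> \<Longrightarrow> a \<otimes> (k \<odot> b) = k \<odot> (a \<otimes> b)"
    and nrm_mult: "\<lbrakk>a \<in> carrier A; b \<in> carrier A\<rbrakk> \<Longrightarrow> \<parallel>a \<otimes> b\<parallel> \<le> \<parallel>a\<parallel> * \<parallel>b\<parallel>"

text \<open>A space together with a left and a right action of an algebra with elements in \<open>'b\<close>.\<close>

record ('k, 'b, 'e) bimodule = "('k, 'e) nspace" +
  lact :: "'b \<Rightarrow> 'e \<Rightarrow> 'e" (infixl "\<triangleright>\<index>" 70)
  ract :: "'e \<Rightarrow> 'b \<Rightarrow> 'e" (infixl "\<triangleleft>\<index>" 70)

locale banach_module = B: banach_algebra B + E: banach_space E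
  for B :: "('k::real_normed_field, 'b, 'm) nspace_scheme" (structure)
    and E :: "('k, 'b, 'e, 'l) bimodule_scheme" +
  assumes lact_closed: "\<lbrakk>b \<in> carrier B; e \<in> carrier E\<rbrakk> \<Longrightarrow> b \<triangleright>\<^bsub>E\<^esub> e \<in> carrier E"
    and ract_closed: "\<lbrakk>b \<in> carrier B; e \<in> carrier E\<rbrakk> \<Longrightarrow> e \<triangleleft>\<^bsub>E\<^esub> b \<in> carrier E"
    and lact_add_l: "\<lbrakk>b \<in> carrier B; c \<in> carrier B; e \<in> carrier E\<rbrakk>
      \<Longrightarrow> (b \<oplus> c) \<triangleright>\<^bsub>E\<^esub> e = b \<triangleright>\<^bsub>E\<^esub> e \<oplus>\<^bsub>E\<^esub> c \<triangleright>\<^bsub>E\<^esub> e"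
    and lact_add_r: "\<lbrakk>b \<in> carrier B; e \<in> carrier E; f \<in> carrier E\<rbrakk>
      \<Longrightarrow> b \<triangleright>\<^bsub>E\<^esub> (e \<oplus>\<^bsub>E\<^esub> f) = b \<triangleright>\<^bsub>E\<^esub> e \<oplus>\<^bsub>E\<^esub> b \<triangleright>\<^bsub>E\<^esub> f"
    and ract_add_l: "\<lbrakk>b \<in> carrier B; e \<in> carrier E; f \<in> carrier E\<rbrakk>
      \<Longrightarrow> (e \<oplus>\<^bsub>E\<^esub> f) \<triangleleft>\<^bsub>E\<^esub> b = e \<triangleleft>\<^bsub>E\<^esub> b \<oplus>\<^bsub>E\<^esub> f \<triangleleft>\<^bsub>E\<^esub> b"
    and ract_add_r: "\<lbrakk>b \<in> carrier B; c \<in> carrier B; e \<in> carrier E\<rbrakk>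
      \<Longrightarrow> e \<triangleleft>\<^bsub>E\<^esub> (b \<oplus> c) = e \<triangleleft>\<^bsub>E\<^esub> b \<oplus>\<^bsub>E\<^esub> e \<triangleleft>\<^bsub>E\<^esub> c"
    and lact_smult_l: "\<lbrakk>b \<in> carrier B; e \<in> carrier E\<rbrakk> \<Longrightarrow> (k \<odot> b) \<triangleright>\<^bsub>E\<^esub> e = k \<odot>\<^bsub>E\<^esub> (b \<triangleright>\<^bsub>E\<^esub> e)"
    and lact_smult_r: "\<lbrakk>b \<in> carrier B; e \<in> carrier E\<rbrakk> \<Longrightarrow> b \<triangleright>\<^bsub>E\<^esub> (k \<odot>\<^bsub>E\<^esub> e) = k \<odot>\<^bsub>E\<^esub> (b \<triangleright>\<^bsub>E\<^esub> e)"
    and ract_smult_l: "\<lbrakk>b \<in> carrier B; e \<in> carrier E\<rbrakk> \<Longrightarrow> (k \<odot>\<^bsub>E\<^esub> e) \<triangleleft>\<^bsub>E\<^esub> b = k \<odot>\<^bsub>E\<^esub> (e \<triangleleft>\<^bsub>E\<^esub> b)"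
    and ract_smult_r: "\<lbrakk>b \<in> carrier B; e \<in> carrier E\<rbrakk> \<Longrightarrow> e \<triangleleft>\<^bsub>E\<^esub> (k \<odot> b) = k \<odot>\<^bsub>E\<^esub> (e \<triangleleft>\<^bsub>E\<^esub> b)"
    and lact_assoc: "\<lbrakk>b \<in> carrier B; c \<in> carrier B; e \<in> carrier E\<rbrakk>
      \<Longrightarrow> (b \<otimes> c) \<triangleright>\<^bsub>E\<^esub> e = b \<triangleright>\<^bsub>E\<^esub> (c \<triangleright>\<^bsub>E\<^esub> e)"
    and ract_assoc: "\<lbrakk>b \<in> carrier B; c \<in> carrier B; e \<in> carrier E\<rbrakk>
      \<Longrightarrow> e \<triangleleft>\<^bsub>E\<^esub> (b \<otimes> c) = (e \<triangleleft>\<^bsub>E\<^esub> b) \<triangleleft>\<^bsub>E\<^esub> c"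
    and act_assoc: "\<lbrakk>b \<in> carrier B; c \<in> carrier B; e \<in> carrier E\<rbrakk>
      \<Longrightarrow> (b \<triangleright>\<^bsub>E\<^esub> e) \<triangleleft>\<^bsub>E\<^esub> c = b \<triangleright>\<^bsub>E\<^esub> (e \<triangleleft>\<^bsub>E\<^esub> c)"
    and act_bounded: "\<exists>K. \<forall>b\<in>carrier B. \<forall>e\<in>carrier E.
      \<parallel>b \<triangleright>\<^bsub>E\<^esub> e\<parallel>\<^bsub>E\<^esub> \<le> K * \<parallel>b\<parallel> * \<parallel>e\<parallel>\<^bsub>E\<^esub> \<and> \<parallel>e \<triangleleft>\<^bsub>E\<^esub> b\<parallel>\<^bsub>E\<^esub> \<le> K * \<parallel>b\<parallel> * \<parallel>e\<parallel>\<^bsub>E\<^esub>"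

locale algebraic_banach_module = banach_module A X + X: banach_algebra X
  for A :: "('k::real_normed_field, 'a, 'm) nspace_scheme" (structure)
    and X :: "('k, 'a, 'x, 'l) bimodule_scheme" +
  assumes lact_mult: "\<lbrakk>a \<in> carrier A; x \<in> carrier X; y \<in> carrier X\<rbrakk>
      \<Longrightarrow> a \<triangleright>\<^bsub>X\<^esub> (x \<otimes>\<^bsub>X\<^esub> y) = (a \<triangleright>\<^bsub>X\<^esub> x) \<otimes>\<^bsub>X\<^esub> y"
    and ract_mult: "\<lbrakk>a \<in> carrier A; x \<in> carrier X; y \<in> carrier X\<rbrakk>
      \<Longrightarrow> (x \<otimes>\<^bsub>X\<^esub> y) \<triangleleft>\<^bsub>X\<^esub> a = x \<otimes>\<^bsub>X\<^esub> (y \<triangleleft>\<^bsub>X\<^esub> a)"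
    and ract_lact_mult: "\<lbrakk>a \<in> carrier A; x \<in> carrier X; y \<in> carrier X\<rbrakk>
      \<Longrightarrow> (x \<triangleleft>\<^bsub>X\<^esub> a) \<otimes>\<^bsub>X\<^esub> y = x \<otimes>\<^bsub>X\<^esub> (a \<triangleright>\<^bsub>X\<^esub> y)"
    and nrm_lact: "\<lbrakk>a \<in> carrier A; x \<in> carrier X\<rbrakk> \<Longrightarrow> \<parallel>a \<triangleright>\<^bsub>X\<^esub> x\<parallel>\<^bsub>X\<^esub> \<le> \<parallel>a\<parallel> * \<parallel>x\<parallel>\<^bsub>X\<^esub>"
    and nrm_ract: "\<lbrakk>a \<in> carrier A; x \<in> carrier X\<rbrakk> \<Longrightarrow> \<parallel>x \<triangleleft>\<^bsub>X\<^esub> a\<parallel>\<^bsub>X\<^esub> \<le> \<parallel>a\<parallel> * \<parallel>x\<parallel>\<^bsub>X\<^esub>"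

definition amalgam ::
    "('k, 'a, 'm) nspace_scheme \<Rightarrow> ('k, 'a, 'x, 'l) bimodule_scheme \<Rightarrow> ('k, 'a \<times> 'x) nspace"
    (infixl "\<bowtie>" 65) where
  "A \<bowtie> X = \<lparr>carrier = carrier A \<times> carrier X,
     monoid.mult = (\<lambda>(a, x) (b, y). (a \<otimes>\<^bsub>A\<^esub> b, a \<triangleright>\<^bsub>X\<^esub> y \<oplus>\<^bsub>X\<^esub> x \<triangleleft>\<^bsub>X\<^esub> b \<oplus>\<^bsub>X\<^esub> x \<otimes>\<^bsub>X\<^esub> y)),
     one = (\<one>\<^bsub>A\<^esub>, \<zero>\<^bsub>X\<^esub>),
     ring.zero = (\<zero>\<^bsub>A\<^esub>, \<zero>\<^bsub>X\<^esub>),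
     add = (\<lambda>(a, x) (b, y). (a \<oplus>\<^bsub>A\<^esub> b, x \<oplus>\<^bsub>X\<^esub> y)),
     smult = (\<lambda>k (a, x). (k \<odot>\<^bsub>A\<^esub> a, k \<odot>\<^bsub>X\<^esub> x)),
     nrm = (\<lambda>(a, x). \<parallel>a\<parallel>\<^bsub>A\<^esub> + \<parallel>x\<parallel>\<^bsub>X\<^esub>)\<rparr>"


section \<open>Iterated duals\<close>

text \<open>Maps are HOL functions of which only the values on the carrier matter.\<close>

definition bounded_linear_map ::
    "('k::real_normed_field, 'v, 'm) nspace_scheme \<Rightarrow> ('k, 'w, 'l) nspace_scheme \<Rightarrow> ('v \<Rightarrow> 'w) \<Rightarrow> bool"
  where
  "bounded_linear_map V W T \<longleftrightarrow>
     T \<in> carrier V \<rightarrow> carrier W \<and>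
     (\<forall>x\<in>carrier V. \<forall>y\<in>carrier V. T (x \<oplus>\<^bsub>V\<^esub> y) = T x \<oplus>\<^bsub>W\<^esub> T y) \<and>
     (\<forall>k. \<forall>x\<in>carrier V. T (k \<odot>\<^bsub>V\<^esub> x) = k \<odot>\<^bsub>W\<^esub> T x) \<and>
     (\<exists>K. \<forall>x\<in>carrier V. \<parallel>T x\<parallel>\<^bsub>W\<^esub> \<le> K * \<parallel>x\<parallel>\<^bsub>V\<^esub>)"

definition isometric_iso ::
    "('k::real_normed_field, 'v, 'm) nspace_scheme \<Rightarrow> ('k, 'w, 'l) nspace_scheme \<Rightarrow> ('v \<Rightarrow> 'w) \<Rightarrow> bool"
  where
  "isometric_iso V W T \<longleftrightarrow>
     bounded_linear_map V W T \<and> bij_betw T (carrier V) (carrier W) \<and>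
     (\<forall>x\<in>carrier V. \<parallel>T x\<parallel>\<^bsub>W\<^esub> = \<parallel>x\<parallel>\<^bsub>V\<^esub>)"

text \<open>\<open>W\<close> is the dual of \<open>V\<close>: via the pairing \<open>p\<close> its elements are exactly the bounded linear
  functionals on \<open>V\<close>, with the pointwise operations and the operator norm. So \<open>W\<close> is determined by \<open>V\<close>
  up to the names of its elements.\<close>

definition is_dual ::
    "('k::real_normed_field, 'v, 'm) nspace_scheme \<Rightarrow> ('k, 'w, 'l) nspace_scheme \<Rightarrow> ('w \<Rightarrow> 'v \<Rightarrow> 'k) \<Rightarrow> bool"
  where
  "is_dual V W p \<longleftrightarrow>
     normed_space W \<and>
     (\<forall>\<phi>\<in>carrier W. bounded_linear_map V scalars (p \<phi>)) \<and>
     (\<forall>f. bounded_linear_map V scalars f \<longrightarrow> (\<exists>!\<phi>. \<phi> \<in> carrier W \<and> (\<forall>e\<in>carrier V. p \<phi> e = f e))) \<and>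
     (\<forall>\<phi>\<in>carrier W. \<forall>\<psi>\<in>carrier W. \<forall>e\<in>carrier V. p (\<phi> \<oplus>\<^bsub>W\<^esub> \<psi>) e = p \<phi> e + p \<psi> e) \<and>
     (\<forall>k. \<forall>\<phi>\<in>carrier W. \<forall>e\<in>carrier V. p (k \<odot>\<^bsub>W\<^esub> \<phi>) e = k * p \<phi> e) \<and>
     (\<forall>\<phi>\<in>carrier W. \<parallel>\<phi>\<parallel>\<^bsub>W\<^esub> = (SUP e\<in>{e \<in> carrier V. \<parallel>e\<parallel>\<^bsub>V\<^esub> \<le> 1}. norm (p \<phi> e)))"

text \<open>A dual tower of height \<open>m\<close> realizes the iterated duals \<open>E\<^sup>(\<^sup>0\<^sup>)\<close>, \<open>\<dots>\<close>, \<open>E\<^sup>(\<^sup>m\<^sup>)\<close> as \<open>level T 0\<close>, \<open>\<dots>\<close>,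
  \<open>level T m\<close> in one type: \<open>emb T\<close> identifies \<open>E\<close> with level 0, and \<open>pairing T k \<phi> e\<close> is the value
  \<open>\<langle>\<phi>, e\<rangle>\<close> of \<open>\<phi> \<in> E\<^sup>(\<^sup>k\<^sup>+\<^sup>1\<^sup>)\<close> at \<open>e \<in> E\<^sup>(\<^sup>k\<^sup>)\<close>. No HOL type can hold the iterated duals of all orders, but
  for each given order there is one that does; see \<open>is_dual_tower_0\<close> and
  \<open>ex_dual_tower_Suc\<close> below.\<close>

record ('k, 'e, 'v) dual_tower =
  level :: "nat \<Rightarrow> ('k, 'v) nspace"
  emb :: "'e \<Rightarrow> 'v"
  pairing :: "nat \<Rightarrow> 'v \<Rightarrow> 'v \<Rightarrow> 'k"

definition is_dual_tower ::
    "('k::real_normed_field, 'e, 'm) nspace_scheme \<Rightarrow> ('k, 'e, 'v) dual_tower \<Rightarrow> nat \<Rightarrow> bool" where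
  "is_dual_tower E T m \<longleftrightarrow>
     normed_space (level T 0) \<and> isometric_iso E (level T 0) (emb T) \<and>
     (\<forall>k<m. is_dual (level T k) (level T (Suc k)) (pairing T k))"

text \<open>The element of level \<open>k + 1\<close> that is the functional \<open>f\<close> on level \<open>k\<close>.\<close>

definition functional :: "('k, 'e, 'v) dual_tower \<Rightarrow> nat \<Rightarrow> ('v \<Rightarrow> 'k) \<Rightarrow> 'v" where
  "functional T k f =
     (THE \<phi>. \<phi> \<in> carrier (level T (Suc k)) \<and> (\<forall>e\<in>carrier (level T k). pairing T k \<phi> e = f e))"

definition unemb :: "('k, 'e, 'm) nspace_scheme \<Rightarrow> ('k, 'e, 'v) dual_tower \<Rightarrow> 'v \<Rightarrow> 'e" where
  "unemb E T = inv_into (carrier E) (emb T)"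

definition with_actions ::
    "('k, 'e, 'm) nspace_scheme \<Rightarrow> ('b \<Rightarrow> 'e \<Rightarrow> 'e) \<Rightarrow> ('e \<Rightarrow> 'b \<Rightarrow> 'e) \<Rightarrow> ('k, 'b, 'e) bimodule" where
  "with_actions E l r = \<lparr>carrier = carrier E, monoid.mult = monoid.mult E, one = one E,
     ring.zero = ring.zero E, add = add E, smult = smult E, nrm = nrm E, lact = l, ract = r\<rparr>"

definition self_module :: "('k, 'b, 'm) nspace_scheme \<Rightarrow> ('k, 'b, 'b) bimodule" where
  "self_module B = with_actions B (monoid.mult B) (monoid.mult B)"

text \<open>The module \<open>E\<^sup>(\<^sup>m\<^sup>)\<close>, with the actions
  \<open>\<langle>b\<phi>, e\<rangle> = \<langle>\<phi>, eb\<rangle>\<close> and \<open>\<langle>\<phi>b, e\<rangle> = \<langle>\<phi>, be\<rangle>\<close> at each step.\<close>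

primrec iter_dual ::
    "('k, 'b, 'e, 'm) bimodule_scheme \<Rightarrow> ('k, 'e, 'v) dual_tower \<Rightarrow> nat \<Rightarrow> ('k, 'b, 'v) bimodule" where
  "iter_dual E T 0 = with_actions (level T 0)
     (\<lambda>b v. emb T (b \<triangleright>\<^bsub>E\<^esub> unemb E T v))
     (\<lambda>v b. emb T (unemb E T v \<triangleleft>\<^bsub>E\<^esub> b))"
| "iter_dual E T (Suc k) = with_actions (level T (Suc k))
     (\<lambda>b \<phi>. functional T k (\<lambda>e. pairing T k \<phi> (e \<triangleleft>\<^bsub>iter_dual E T k\<^esub> b)))
     (\<lambda>\<phi> b. functional T k (\<lambda>e. pairing T k \<phi> (b \<triangleright>\<^bsub>iter_dual E T k\<^esub> e)))"

text \<open>The products \<open>xF\<close> and \<open>Fx\<close> in \<open>X\<^sup>(\<^sup>2\<^sup>n\<^sup>)\<close> of \<open>x \<in> X\<close> and \<open>F \<in> A\<^sup>(\<^sup>2\<^sup>n\<^sup>)\<close>, where \<open>U\<close> and \<open>V\<close> are dual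
  towers of \<open>A\<close> and \<open>X\<close>. The local functions \<open>gx\<close> and \<open>xg\<close> are the products of \<open>x\<close> with
  \<open>g \<in> X\<^sup>(\<^sup>2\<^sup>k\<^sup>+\<^sup>1\<^sup>)\<close>, which lie in \<open>A\<^sup>(\<^sup>2\<^sup>k\<^sup>+\<^sup>1\<^sup>)\<close>.\<close>

primrec prod_xF ::
    "('k, 'a, 'm) nspace_scheme \<Rightarrow> ('k, 'a, 'x, 'l) bimodule_scheme \<Rightarrow>
     ('k, 'a, 'u) dual_tower \<Rightarrow> ('k, 'x, 'v) dual_tower \<Rightarrow> nat \<Rightarrow> 'x \<Rightarrow> 'u \<Rightarrow> 'v" where
  "prod_xF A X U V 0 x F = emb V (x \<triangleleft>\<^bsub>X\<^esub> unemb A U F)"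
| "prod_xF A X U V (Suc k) x F =
     (let gx = (\<lambda>g. functional U (2 * k) (\<lambda>F'. pairing V (2 * k) g (prod_xF A X U V k x F')))
      in functional V (2 * k + 1) (\<lambda>g. pairing U (2 * k + 1) F (gx g)))"

primrec prod_Fx ::
    "('k, 'a, 'm) nspace_scheme \<Rightarrow> ('k, 'a, 'x, 'l) bimodule_scheme \<Rightarrow>
     ('k, 'a, 'u) dual_tower \<Rightarrow> ('k, 'x, 'v) dual_tower \<Rightarrow> nat \<Rightarrow> 'u \<Rightarrow> 'x \<Rightarrow> 'v" where
  "prod_Fx A X U V 0 F x = emb V (unemb A U F \<triangleright>\<^bsub>X\<^esub> x)"
| "prod_Fx A X U V (Suc k) F x =
     (let xg = (\<lambda>g. functional U (2 * k) (\<lambda>F'. pairing V (2 * k) g (prod_Fx A X U V k F' x)))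
      in functional V (2 * k + 1) (\<lambda>g. pairing U (2 * k + 1) F (xg g)))"


section \<open>Derivations and weak amenability\<close>

definition derivation ::
    "('k::real_normed_field, 'b, 'm) nspace_scheme \<Rightarrow> ('k, 'b, 'e, 'l) bimodule_scheme \<Rightarrow> ('b \<Rightarrow> 'e) \<Rightarrow> bool"
  where
  "derivation B E D \<longleftrightarrow> bounded_linear_map B E D \<and>
     (\<forall>b\<in>carrier B. \<forall>c\<in>carrier B. D (b \<otimes>\<^bsub>B\<^esub> c) = D b \<triangleleft>\<^bsub>E\<^esub> c \<oplus>\<^bsub>E\<^esub> b \<triangleright>\<^bsub>E\<^esub> D c)"

definition inner_derivation :: "('k, 'b, 'e, 'l) bimodule_scheme \<Rightarrow> 'e \<Rightarrow> 'b \<Rightarrow> 'e" where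
  "inner_derivation E e b = b \<triangleright>\<^bsub>E\<^esub> e \<ominus>\<^bsub>E\<^esub> e \<triangleleft>\<^bsub>E\<^esub> b"

definition is_inner ::
    "('k, 'b, 'm) nspace_scheme \<Rightarrow> ('k, 'b, 'e, 'l) bimodule_scheme \<Rightarrow> ('b \<Rightarrow> 'e) \<Rightarrow> bool" where
  "is_inner B E D \<longleftrightarrow> (\<exists>e\<in>carrier E. \<forall>b\<in>carrier B. D b = inner_derivation E e b)"

definition weakly_amenable ::
    "nat \<Rightarrow> ('k::real_normed_field, 'b, 'm) nspace_scheme \<Rightarrow> ('k, 'b, 'w) dual_tower \<Rightarrow> bool" where
  "weakly_amenable m B W \<longleftrightarrow>
     (\<forall>D. derivation B (iter_dual (self_module B) W m) D
            \<longrightarrow> is_inner B (iter_dual (self_module B) W m) D)"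

definition bounded_module_hom ::
    "('k::real_normed_field, 'b, 'm) nspace_scheme \<Rightarrow> ('k, 'b, 'e, 'l) bimodule_scheme \<Rightarrow>
     ('k, 'b, 'f, 'n) bimodule_scheme \<Rightarrow> ('e \<Rightarrow> 'f) \<Rightarrow> bool" where
  "bounded_module_hom B E F T \<longleftrightarrow> bounded_linear_map E F T \<and>
     (\<forall>b\<in>carrier B. \<forall>e\<in>carrier E. T (b \<triangleright>\<^bsub>E\<^esub> e) = b \<triangleright>\<^bsub>F\<^esub> T e \<and> T (e \<triangleleft>\<^bsub>E\<^esub> b) = T e \<triangleleft>\<^bsub>F\<^esub> b)"


section \<open>Auxiliary facts and the existence of dual towers\<close>


lemma scalars_simps [simp]:
  "carrier scalars = UNIV" "x \<otimes>\<^bsub>scalars\<^esub> y = x * y" "\<one>\<^bsub>scalars\<^esub> = 1" "\<zero>\<^bsub>scalars\<^esub> = 0"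
  "x \<oplus>\<^bsub>scalars\<^esub> y = x + y" "x \<odot>\<^bsub>scalars\<^esub> y = x * y" "\<parallel>x\<parallel>\<^bsub>scalars\<^esub> = norm x"
  by (simp_all add: scalars_def)

lemma cring_scalars: "cring scalars"
proof (rule cringI)
  show "abelian_group scalars"
    by (rule abelian_groupI) (auto simp: add_ac intro: exI [of _ "- _"])
  show "comm_monoid scalars"
    by (rule comm_monoidI) (auto simp: mult_ac)
qed (auto simp: algebra_simps)

lemma normed_spaceI:
  fixes V :: "('k::real_normed_field, 'v, 'm) nspace_scheme" (structure)
  assumes "\<And>x y. \<lbrakk>x \<in> carrier V; y \<in> carrier V\<rbrakk> \<Longrightarrow> x \<oplus> y \<in> carrier V"
    and "\<zero> \<in> carrier V"
    and "\<And>k x. x \<in> carrier V \<Longrightarrow> k \<odot> x \<in> carrier V"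
    and "\<And>x y z. \<lbrakk>x \<in> carrier V; y \<in> carrier V; z \<in> carrier V\<rbrakk> \<Longrightarrow> (x \<oplus> y) \<oplus> z = x \<oplus> (y \<oplus> z)"
    and "\<And>x y. \<lbrakk>x \<in> carrier V; y \<in> carrier V\<rbrakk> \<Longrightarrow> x \<oplus> y = y \<oplus> x"
    and "\<And>x. x \<in> carrier V \<Longrightarrow> \<zero> \<oplus> x = x"
    and "\<And>x. x \<in> carrier V \<Longrightarrow> (-1) \<odot> x \<oplus> x = \<zero>"
    and "\<And>k l x. x \<in> carrier V \<Longrightarrow> (k + l) \<odot> x = k \<odot> x \<oplus> l \<odot> x"
    and "\<And>k x y. \<lbrakk>x \<in> carrier V; y \<in> carrier V\<rbrakk> \<Longrightarrow> k \<odot> (x \<oplus> y) = k \<odot> x \<oplus> k \<odot> y"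
    and "\<And>k l x. x \<in> carrier V \<Longrightarrow> (k * l) \<odot> x = k \<odot> (l \<odot> x)"
    and "\<And>x. x \<in> carrier V \<Longrightarrow> 1 \<odot> x = x"
    and "\<And>x. x \<in> carrier V \<Longrightarrow> 0 \<le> \<parallel>x\<parallel>"
    and "\<And>x. x \<in> carrier V \<Longrightarrow> \<parallel>x\<parallel> = 0 \<longleftrightarrow> x = \<zero>"
    and "\<And>x y. \<lbrakk>x \<in> carrier V; y \<in> carrier V\<rbrakk> \<Longrightarrow> \<parallel>x \<oplus> y\<parallel> \<le> \<parallel>x\<parallel> + \<parallel>y\<parallel>"
    and "\<And>c x. x \<in> carrier V \<Longrightarrow> \<parallel>c \<odot> x\<parallel> = norm c * \<parallel>x\<parallel>"
  shows "normed_space V"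
proof (intro normed_space.intro normed_space_axioms.intro)
  have "abelian_group V"
  proof (rule abelian_groupI)
    show "\<exists>y\<in>carrier V. y \<oplus> x = \<zero>" if "x \<in> carrier V" for x
      using assms(3,7) that by blast
  qed (fact assms(1,2,4-6))+
  then show "Module.module scalars V"
    by (rule Module.moduleI [OF cring_scalars]) (simp_all add: assms)
qed (fact assms)+

lemma normed_space_smult_0:
  assumes "normed_space V" "x \<in> carrier V" shows "0 \<odot>\<^bsub>V\<^esub> x = \<zero>\<^bsub>V\<^esub>"
proof -
  interpret normed_space V by fact
  show ?thesis using smult_l_null [OF assms(2)] by simp
qed

lemma (in normed_space) nrm_minus: assumes "x \<in> carrier V" shows "\<parallel>\<ominus> x\<parallel> = \<parallel>x\<parallel>"
proof -
  have "(-1) \<odot> x \<oplus> x = \<zero>"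
    using smult_l_distr [of "-1" 1 x] assms normed_space_smult_0 [OF normed_space_axioms assms] smult_one [of x] by simp
  then have "\<ominus> x = (-1) \<odot> x" using assms by (simp add: minus_equality)
  then show ?thesis using nrm_smult [OF assms, of "-1"] by simp
qed

lemma (in normed_space) Metric_space_ndist: "Metric_space (carrier V) (ndist V)"
proof
  fix x y z
  show "0 \<le> ndist V x y" by (simp add: ndist_def nrm_nonneg)
  show "ndist V x y = ndist V y x"
  proof (cases "x \<in> carrier V \<and> y \<in> carrier V")
    case True
    then have "x \<ominus> y = \<ominus> (y \<ominus> x)" by (simp add: a_minus_def minus_add a_comm)
    then show ?thesis using True by (simp add: ndist_def nrm_minus)
  qed (auto simp: ndist_def)
  assume x: "x \<in> carrier V" and y: "y \<in> carrier V"
  show "ndist V x y = 0 \<longleftrightarrow> x = y"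
  proof -
    have "x = y" if "x \<ominus> y = \<zero>"
      using that x y minus_equality [of x "\<ominus> y"] by (simp add: a_minus_def)
    moreover have "y \<ominus> y = \<zero>" using y by (simp add: a_minus_def r_neg)
    ultimately show ?thesis using x y by (auto simp: ndist_def nrm_eq_0_iff)
  qed
  assume z: "z \<in> carrier V"
  have "x \<ominus> z = (x \<ominus> y) \<oplus> (y \<ominus> z)"
    using x y z by (simp add: a_minus_def a_assoc) (metis a_assoc a_inv_closed l_neg l_zero)
  then show "ndist V x z \<le> ndist V x y + ndist V y z"
    using x y z nrm_triangle [of "x \<ominus> y" "y \<ominus> z"] by (simp add: ndist_def)
qed

text \<open>The concrete dual, with functionals as HOL functions vanishing outside the carrier.\<close>

definition fun_dual :: "('k::real_normed_field, 'v, 'm) nspace_scheme \<Rightarrow> ('k, 'v \<Rightarrow> 'k) nspace" where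
  "fun_dual V = \<lparr>carrier = {f. bounded_linear_map V scalars f \<and> (\<forall>x. x \<notin> carrier V \<longrightarrow> f x = 0)},
     monoid.mult = undefined, one = undefined,
     ring.zero = (\<lambda>_. 0), add = (\<lambda>f g x. f x + g x), smult = (\<lambda>k f x. k * f x),
     nrm = (\<lambda>f. SUP e\<in>{e \<in> carrier V. \<parallel>e\<parallel>\<^bsub>V\<^esub> \<le> 1}. norm (f e))\<rparr>"

context normed_space begin

lemma functional_bdd:
  assumes "bounded_linear_map V scalars f"
  shows "bdd_above ((\<lambda>e. norm (f e)) ` {e \<in> carrier V. \<parallel>e\<parallel> \<le> 1})"
proof -
  obtain K where K: "\<And>x. x \<in> carrier V \<Longrightarrow> norm (f x) \<le> K * \<parallel>x\<parallel>"
    using assms unfolding bounded_linear_map_def scalars_simps by blast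
  have "norm (f e) \<le> \<bar>K\<bar>" if "e \<in> carrier V" "\<parallel>e\<parallel> \<le> 1" for e
  proof -
    have "norm (f e) \<le> \<bar>K\<bar> * \<parallel>e\<parallel>"
      using K [OF that(1)] nrm_nonneg [OF that(1)] by (meson abs_ge_self mult_right_mono order_trans)
    also have "\<dots> \<le> \<bar>K\<bar>" using that by (simp add: mult_left_le)
    finally show ?thesis .
  qed
  then show ?thesis by (auto intro!: bdd_aboveI)
qed

lemma nrm_zero: "\<parallel>\<zero>\<parallel> = 0" by (simp add: nrm_eq_0_iff)

lemma functional_le:
  assumes f: "bounded_linear_map V scalars f" and x: "x \<in> carrier V" "\<parallel>x\<parallel> \<le> 1"
  shows "norm (f x) \<le> (SUP e\<in>{e \<in> carrier V. \<parallel>e\<parallel> \<le> 1}. norm (f e))"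
  by (rule cSUP_upper [OF _ functional_bdd [OF f]]) (use x in auto)

lemma unit_ball_ne: "{e \<in> carrier V. \<parallel>e\<parallel> \<le> 1} \<noteq> {}"
  using nrm_zero by (auto intro!: exI [of _ \<zero>])

lemma functional_eq_0:
  assumes f: "bounded_linear_map V scalars f" and x: "x \<in> carrier V"
    and 0: "(SUP e\<in>{e \<in> carrier V. \<parallel>e\<parallel> \<le> 1}. norm (f e)) = 0"
  shows "f x = 0"
proof (cases "\<parallel>x\<parallel> = 0")
  case True
  then show ?thesis using f x by (auto simp: bounded_linear_map_def)
next
  case False
  define c where "c = (of_real (1 / \<parallel>x\<parallel>) :: 'k)"
  have "\<parallel>x\<parallel> > 0" using False nrm_nonneg [OF x] by simp
  then have c: "norm c * \<parallel>x\<parallel> = 1" "c \<noteq> 0" by (simp_all add: c_def norm_divide)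
  have cx: "c \<odot> x \<in> carrier V" using x by simp
  have "norm (f (c \<odot> x)) \<le> 0"
    using functional_le [OF f cx] 0 by (simp add: nrm_smult x c)
  then have "c * f x = 0" using f x by (simp add: bounded_linear_map_def)
  then show ?thesis using c by simp
qed

lemma normed_space_fun_dual: "normed_space (fun_dual V)"
proof (rule normed_spaceI)
  fix f g assume "f \<in> carrier (fun_dual V)" "g \<in> carrier (fun_dual V)"
  then have f: "bounded_linear_map V scalars f" and g: "bounded_linear_map V scalars g"
    and fg0: "\<And>x. x \<notin> carrier V \<Longrightarrow> f x = 0" "\<And>x. x \<notin> carrier V \<Longrightarrow> g x = 0"
    by (auto simp: fun_dual_def)
  obtain K where K: "\<And>x. x \<in> carrier V \<Longrightarrow> norm (f x) \<le> K * \<parallel>x\<parallel>"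
    using f unfolding bounded_linear_map_def scalars_simps by blast
  obtain L where "\<And>x. x \<in> carrier V \<Longrightarrow> norm (g x) \<le> L * \<parallel>x\<parallel>"
    using g unfolding bounded_linear_map_def scalars_simps by blast
  with K have "norm (f x + g x) \<le> (K + L) * \<parallel>x\<parallel>" if "x \<in> carrier V" for x
    using that by (auto simp: algebra_simps intro!: norm_triangle_le add_mono)
  then have "\<exists>K. \<forall>x\<in>carrier V. norm (f x + g x) \<le> K * \<parallel>x\<parallel>" by blast
  then show "f \<oplus>\<^bsub>fun_dual V\<^esub> g \<in> carrier (fun_dual V)"
    using f g fg0 by (simp add: fun_dual_def bounded_linear_map_def distrib_left)
  show "\<parallel>f \<oplus>\<^bsub>fun_dual V\<^esub> g\<parallel>\<^bsub>fun_dual V\<^esub> \<le> \<parallel>f\<parallel>\<^bsub>fun_dual V\<^esub> + \<parallel>g\<parallel>\<^bsub>fun_dual V\<^esub>"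
    unfolding fun_dual_def
    by (auto intro!: cSUP_least norm_triangle_le add_mono functional_le f g nrm_zero)
       (use unit_ball_ne in auto)
next
  fix f assume "f \<in> carrier (fun_dual V)"
  then have f: "bounded_linear_map V scalars f" and f0: "\<And>x. x \<notin> carrier V \<Longrightarrow> f x = 0"
    by (auto simp: fun_dual_def)
  show ge: "0 \<le> \<parallel>f\<parallel>\<^bsub>fun_dual V\<^esub>"
    using order_trans [OF norm_ge_zero functional_le [OF f zero_closed]] nrm_zero
    by (simp add: fun_dual_def)
  have "f x = 0" if "\<parallel>f\<parallel>\<^bsub>fun_dual V\<^esub> = 0" for x
    using functional_eq_0 [OF f] f0 that by (cases "x \<in> carrier V") (auto simp: fun_dual_def)
  moreover have "\<parallel>\<lambda>_. 0\<parallel>\<^bsub>fun_dual V\<^esub> = 0"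
    using unit_ball_ne by (simp add: fun_dual_def)
  ultimately show "\<parallel>f\<parallel>\<^bsub>fun_dual V\<^esub> = 0 \<longleftrightarrow> f = \<zero>\<^bsub>fun_dual V\<^esub>"
    by (auto simp: fun_dual_def)
  fix k
  obtain K where K: "\<And>x. x \<in> carrier V \<Longrightarrow> norm (f x) \<le> K * \<parallel>x\<parallel>"
    using f unfolding bounded_linear_map_def scalars_simps by blast
  then have "norm (k * f x) \<le> (norm k * K) * \<parallel>x\<parallel>" if "x \<in> carrier V" for x
    using that by (auto simp: norm_mult mult.assoc intro!: mult_left_mono)
  then have "\<exists>K. \<forall>x\<in>carrier V. norm (k * f x) \<le> K * \<parallel>x\<parallel>" by blast
  then show kf: "k \<odot>\<^bsub>fun_dual V\<^esub> f \<in> carrier (fun_dual V)"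
    using f f0 by (simp add: fun_dual_def bounded_linear_map_def distrib_left mult.left_commute)
  let ?B = "{e \<in> carrier V. \<parallel>e\<parallel> \<le> 1}"
  show "\<parallel>k \<odot>\<^bsub>fun_dual V\<^esub> f\<parallel>\<^bsub>fun_dual V\<^esub> = norm k * \<parallel>f\<parallel>\<^bsub>fun_dual V\<^esub>"
  proof (rule antisym)
    show "\<parallel>k \<odot>\<^bsub>fun_dual V\<^esub> f\<parallel>\<^bsub>fun_dual V\<^esub> \<le> norm k * \<parallel>f\<parallel>\<^bsub>fun_dual V\<^esub>"
      unfolding fun_dual_def using unit_ball_ne
      by (auto simp: norm_mult intro!: cSUP_least mult_left_mono functional_le [OF f])
    have kf': "bounded_linear_map V scalars (\<lambda>x. k * f x)" using kf by (simp add: fun_dual_def)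
    show "norm k * \<parallel>f\<parallel>\<^bsub>fun_dual V\<^esub> \<le> \<parallel>k \<odot>\<^bsub>fun_dual V\<^esub> f\<parallel>\<^bsub>fun_dual V\<^esub>"
    proof (cases "k = 0")
      case True then show ?thesis using unit_ball_ne by (simp add: fun_dual_def)
    next
      case False
      have "(SUP e\<in>?B. norm (f e)) \<le> (SUP e\<in>?B. norm (k * f e)) / norm k"
        using functional_le [OF kf'] unit_ball_ne False
        by (intro cSUP_least) (auto simp: norm_mult field_simps)
      then show ?thesis using False by (simp add: fun_dual_def field_simps)
    qed
  qed
next
  show "\<zero>\<^bsub>fun_dual V\<^esub> \<in> carrier (fun_dual V)"
    by (auto simp: fun_dual_def bounded_linear_map_def intro: exI [of _ 0])
qed (simp_all add: fun_dual_def algebra_simps)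

lemma is_dual_fun_dual: "is_dual V (fun_dual V) (\<lambda>f. f)"
  unfolding is_dual_def
proof (intro conjI allI impI)
  fix f assume f: "bounded_linear_map V scalars f"
  show "\<exists>!\<phi>. \<phi> \<in> carrier (fun_dual V) \<and> (\<forall>e\<in>carrier V. \<phi> e = f e)"
    by (rule ex1I [of _ "\<lambda>x. if x \<in> carrier V then f x else 0"])
       (use f in \<open>auto simp: fun_dual_def bounded_linear_map_def fun_eq_iff\<close>)
qed (use normed_space_fun_dual in \<open>auto simp: fun_dual_def\<close>)

end

definition transport :: "('v \<Rightarrow> 'w) \<Rightarrow> ('k, 'v) nspace \<Rightarrow> ('k, 'w) nspace" where
  "transport j V = \<lparr>carrier = j ` carrier V,
     monoid.mult = undefined, one = undefined,
     ring.zero = j \<zero>\<^bsub>V\<^esub>, add = (\<lambda>x y. j (inv_into UNIV j x \<oplus>\<^bsub>V\<^esub> inv_into UNIV j y)),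
     smult = (\<lambda>k x. j (k \<odot>\<^bsub>V\<^esub> inv_into UNIV j x)), nrm = (\<lambda>x. \<parallel>inv_into UNIV j x\<parallel>\<^bsub>V\<^esub>)\<rparr>"

lemma normed_space_transport:
  assumes "normed_space V" "inj j" shows "normed_space (transport j V)"
proof -
  interpret normed_space V by fact
  have neg: "(-1) \<odot>\<^bsub>V\<^esub> x \<oplus>\<^bsub>V\<^esub> x = \<zero>\<^bsub>V\<^esub>" if "x \<in> carrier V" for x
    using smult_l_distr [of "-1" 1 x] that normed_space_smult_0 [OF assms(1) that] smult_one [of x] by simp
  then have neg': "x \<oplus>\<^bsub>V\<^esub> (-1) \<odot>\<^bsub>V\<^esub> x = \<zero>\<^bsub>V\<^esub>" if "x \<in> carrier V" for x
    using that by (simp add: a_comm)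
  show ?thesis
    using assms(2) smult_l_distr smult_assoc1 smult_one
    by (intro normed_spaceI)
       (auto simp: transport_def inj_eq neg neg' a_ac smult_r_distr nrm_nonneg nrm_eq_0_iff nrm_triangle nrm_smult)
qed

lemma is_dual_transport:
  assumes "is_dual V W p" "inj i" "inj j"
  shows "is_dual (transport i V) (transport j W) (\<lambda>\<phi> e. p (inv_into UNIV j \<phi>) (inv_into UNIV i e))"
proof -
  have lin: "bounded_linear_map (transport i V) scalars f \<longleftrightarrow> bounded_linear_map V scalars (f \<circ> i)" for f
    using assms(2) by (auto simp: bounded_linear_map_def transport_def)
  have W: "normed_space W"
    and p: "\<And>\<phi>. \<phi> \<in> carrier W \<Longrightarrow> bounded_linear_map V scalars (p \<phi>)"
    and ex1: "\<And>f. bounded_linear_map V scalars f \<Longrightarrow> \<exists>!\<phi>. \<phi> \<in> carrier W \<and> (\<forall>e\<in>carrier V. p \<phi> e = f e)"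
    and n: "\<And>\<phi>. \<phi> \<in> carrier W \<Longrightarrow> \<parallel>\<phi>\<parallel>\<^bsub>W\<^esub> = (SUP e\<in>{e \<in> carrier V. \<parallel>e\<parallel>\<^bsub>V\<^esub> \<le> 1}. norm (p \<phi> e))"
    and add: "\<And>\<phi> \<psi> e. \<lbrakk>\<phi> \<in> carrier W; \<psi> \<in> carrier W; e \<in> carrier V\<rbrakk> \<Longrightarrow> p (\<phi> \<oplus>\<^bsub>W\<^esub> \<psi>) e = p \<phi> e + p \<psi> e"
    and smult: "\<And>k \<phi> e. \<lbrakk>\<phi> \<in> carrier W; e \<in> carrier V\<rbrakk> \<Longrightarrow> p (k \<odot>\<^bsub>W\<^esub> \<phi>) e = k * p \<phi> e"
    using assms(1) unfolding is_dual_def by blast+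
  have ball: "{e \<in> carrier (transport i V). \<parallel>e\<parallel>\<^bsub>transport i V\<^esub> \<le> 1} = i ` {e \<in> carrier V. \<parallel>e\<parallel>\<^bsub>V\<^esub> \<le> 1}"
    using assms(2) by (auto simp: transport_def)
  show ?thesis
    unfolding is_dual_def
  proof (intro conjI allI impI ballI)
    show "normed_space (transport j W)" by (rule normed_space_transport) fact+
    fix f assume "bounded_linear_map (transport i V) scalars f"
    then obtain \<phi> where \<phi>: "\<phi> \<in> carrier W" "\<And>e. e \<in> carrier V \<Longrightarrow> p \<phi> e = f (i e)"
      and u: "\<And>\<psi>. \<psi> \<in> carrier W \<Longrightarrow> (\<forall>e\<in>carrier V. p \<psi> e = f (i e)) \<Longrightarrow> \<psi> = \<phi>"
      using ex1 [of "f \<circ> i"] unfolding lin by (auto simp: comp_def)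
    show "\<exists>!\<phi>. \<phi> \<in> carrier (transport j W) \<and> (\<forall>e\<in>carrier (transport i V). p (inv_into UNIV j \<phi>) (inv_into UNIV i e) = f e)"
    proof (rule ex1I [of _ "j \<phi>"])
      show "j \<phi> \<in> carrier (transport j W) \<and> (\<forall>e\<in>carrier (transport i V). p (inv_into UNIV j (j \<phi>)) (inv_into UNIV i e) = f e)"
        using \<phi> assms(2,3) by (simp add: transport_def)
      fix \<psi>
      assume "\<psi> \<in> carrier (transport j W) \<and> (\<forall>e\<in>carrier (transport i V). p (inv_into UNIV j \<psi>) (inv_into UNIV i e) = f e)"
      then obtain \<psi>' where "\<psi> = j \<psi>'" "\<psi>' \<in> carrier W" "\<forall>e\<in>carrier V. p \<psi>' e = f (i e)"
        using assms(2,3) by (auto simp: transport_def)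
      then show "\<psi> = j \<phi>" using u [of \<psi>'] by simp
    qed
  next
    fix \<phi> assume "\<phi> \<in> carrier (transport j W)"
    then obtain \<phi>' where \<phi>: "\<phi> = j \<phi>'" "\<phi>' \<in> carrier W" by (auto simp: transport_def)
    show "bounded_linear_map (transport i V) scalars (\<lambda>e. p (inv_into UNIV j \<phi>) (inv_into UNIV i e))"
      using p [OF \<phi>(2)] assms(2,3) by (simp add: lin \<phi> comp_def)
    show "\<parallel>\<phi>\<parallel>\<^bsub>transport j W\<^esub> = (SUP e\<in>{e \<in> carrier (transport i V). \<parallel>e\<parallel>\<^bsub>transport i V\<^esub> \<le> 1}.
            norm (p (inv_into UNIV j \<phi>) (inv_into UNIV i e)))"
      using n [OF \<phi>(2)] assms(2,3) unfolding ball by (simp add: image_image \<phi>) (simp add: transport_def)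
  qed (use add smult assms(2,3) in \<open>auto simp: transport_def\<close>)
qed

lemma isometric_iso_transport:
  assumes "isometric_iso E V f" "inj j"
  shows "isometric_iso E (transport j V) (j \<circ> f)"
proof -
  have bij: "bij_betw (j \<circ> f) (carrier E) (carrier (transport j V))"
    using assms by (auto simp: isometric_iso_def transport_def
        intro!: bij_betw_trans inj_on_imp_bij_betw elim: inj_on_subset)
  then have "j \<circ> f \<in> carrier E \<rightarrow> carrier (transport j V)"
    by (auto dest: bij_betw_apply)
  moreover have "\<exists>K. \<forall>x\<in>carrier E. \<parallel>x\<parallel>\<^bsub>E\<^esub> \<le> K * \<parallel>x\<parallel>\<^bsub>E\<^esub>"
    by (rule exI [of _ 1]) simp
  ultimately show ?thesis
    using bij assms by (simp add: isometric_iso_def bounded_linear_map_def) (simp add: transport_def)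
qed

lemma is_dual_tower_0:
  assumes "normed_space E"
  shows "is_dual_tower E \<lparr>level = (\<lambda>_. E), emb = (\<lambda>e. e), pairing = undefined\<rparr> 0"
  using assms by (auto simp: is_dual_tower_def isometric_iso_def bounded_linear_map_def bij_betw_def
      intro!: exI [of _ 1])

lemma ex_dual_tower_Suc:
  fixes T :: "('k::real_normed_field, 'e, 'v) dual_tower"
  assumes "is_dual_tower E T m"
  shows "\<exists>T' :: ('k, 'e, 'v + ('v \<Rightarrow> 'k)) dual_tower. is_dual_tower E T' (Suc m)"
proof -
  define T' :: "('k, 'e, 'v + ('v \<Rightarrow> 'k)) dual_tower" where
    "T' = \<lparr>level = (\<lambda>k. if k \<le> m then transport Inl (level T k) else transport Inr (fun_dual (level T m))),
           emb = Inl \<circ> emb T,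
           pairing = (\<lambda>k \<phi> e. if k < m then pairing T k (inv_into UNIV Inl \<phi>) (inv_into UNIV Inl e) else inv_into UNIV Inr \<phi> (inv_into UNIV Inl e))\<rparr>"
  have l0: "normed_space (level T 0)" "isometric_iso E (level T 0) (emb T)"
    and dual: "\<And>k. k < m \<Longrightarrow> is_dual (level T k) (level T (Suc k)) (pairing T k)"
    using assms by (auto simp: is_dual_tower_def)
  have "normed_space (level T m)"
    using l0 dual by (cases m) (auto simp: is_dual_def)
  then have top: "is_dual (level T m) (fun_dual (level T m)) (\<lambda>f. f)"
    by (rule normed_space.is_dual_fun_dual)
  have [simp]: "inj (Inl :: 'v \<Rightarrow> 'v + ('v \<Rightarrow> 'k))" "inj (Inr :: _ \<Rightarrow> 'v + ('v \<Rightarrow> 'k))"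
    by (auto intro: inj_Inl inj_Inr)
  have "is_dual (level T' k) (level T' (Suc k)) (pairing T' k)" if "k < Suc m" for k
  proof (cases "k < m")
    case True
    then show ?thesis
      using is_dual_transport [OF dual [OF True], of Inl Inl] by (simp add: T'_def)
  next
    case False
    with that have "k = m" by simp
    then show ?thesis
      using is_dual_transport [OF top, of Inl Inr] by (simp add: T'_def)
  qed
  moreover have "normed_space (level T' 0)"
    using l0 by (simp add: T'_def normed_space_transport)
  moreover have "isometric_iso E (level T' 0) (emb T')"
    using isometric_iso_transport [OF l0(2), of Inl] by (simp add: T'_def)
  ultimately show ?thesis by (auto simp: is_dual_tower_def)
qed

end

theory Submission
  imports Defs
begin

text \<open>
  The \<open>2n\<close>-th dual of the amalgam is the direct sum of \<open>A\<^sup>(\<^sup>2\<^sup>n\<^sup>)\<close> and \<open>X\<^sup>(\<^sup>2\<^sup>n\<^sup>)\<close>: projections and injections of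
  a direct sum dualize to injections and projections, and on a direct sum the two actions of an
  element \<open>(a, x)\<close> are triangular operator matrices, which become triangular of the opposite shape on
  one dual and of the original shape on the second dual, with every entry replaced by its double
  adjoint. The entry off the diagonal is the product of \<open>x\<close> with \<open>A\<^sup>(\<^sup>2\<^sup>n\<^sup>)\<close>.

  Along this decomposition a derivation of the amalgam is the same as a quadruple \<open>(D\<^sub>A, D\<^sub>X, T\<^sub>X, T\<^sub>A)\<close>
  subject to the identities in condition (1), and conditions (2) to (4) concern quadruples with zero
  entries. If all four hold, one subtracts inner derivations in turn, which kill \<open>D\<^sub>A\<close>, then \<open>T\<^sub>X\<close>, then
  \<open>D\<^sub>X\<close>, each time without reviving the entries killed before; (4) then kills \<open>T\<^sub>A\<close>.
\<close>

section \<open>Bounded linear maps and duals\<close>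

text \<open>The towers of \<open>A\<close>, \<open>X\<close> and \<open>A \<bowtie> X\<close> are
  chosen independently of each other, so (A \<bowtie> X)^(2n) is not literally a set of pairs. It is
  tied to its two summands by four bounded maps, and every statement about pairs (F, G) is read
  through them. Boundedness suffices, because being a derivation and being inner depend on the norms
  only up to equivalence.

  The inner derivation at (F, G) has the entries d_F, d_G, \<delta>_F + d_G and 0, which explains
  the form of the conditions. The sum \<delta>_F + d_G is what (2) and (3) have to produce. T_A is
  out of reach of inner derivations and must vanish by itself, as (4) demands. The clause aF = Fa in
  (2) and (3) says d_F = 0, so that D_A stays zero while T_X or D_X is removed; d_G + \<delta>_F = 0
  in (3) keeps T_X zero while D_X is removed. To remove D_A one takes G = 0, since (1) prescribes
  nothing but the existence of the other three entries.\<close>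

lemma bounded_linear_mapD:
  assumes "bounded_linear_map V W T"
  shows "x \<in> carrier V \<Longrightarrow> T x \<in> carrier W"
    and "\<lbrakk>x \<in> carrier V; y \<in> carrier V\<rbrakk> \<Longrightarrow> T (x \<oplus>\<^bsub>V\<^esub> y) = T x \<oplus>\<^bsub>W\<^esub> T y"
    and "x \<in> carrier V \<Longrightarrow> T (c \<odot>\<^bsub>V\<^esub> x) = c \<odot>\<^bsub>W\<^esub> T x"
  using assms by (auto simp: bounded_linear_map_def)

lemma bounded_linear_mapI:
  assumes "\<And>x. x \<in> carrier V \<Longrightarrow> T x \<in> carrier W"
    and "\<And>x y. \<lbrakk>x \<in> carrier V; y \<in> carrier V\<rbrakk> \<Longrightarrow> T (x \<oplus>\<^bsub>V\<^esub> y) = T x \<oplus>\<^bsub>W\<^esub> T y"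
    and "\<And>c x. x \<in> carrier V \<Longrightarrow> T (c \<odot>\<^bsub>V\<^esub> x) = c \<odot>\<^bsub>W\<^esub> T x"
    and "\<And>x. x \<in> carrier V \<Longrightarrow> \<parallel>T x\<parallel>\<^bsub>W\<^esub> \<le> K * \<parallel>x\<parallel>\<^bsub>V\<^esub>"
  shows "bounded_linear_map V W T"
  using assms unfolding bounded_linear_map_def by blast

text \<open>Maps matter on the carrier only. \<open>V\<close> must be closed under its operations
  for the linearity equations of \<open>S\<close> to be among those of \<open>T\<close>.\<close>

lemma bounded_linear_map_cong:
  assumes "\<And>x. x \<in> carrier V \<Longrightarrow> T x = S x" "normed_space V" "bounded_linear_map V W T"
  shows "bounded_linear_map V W S"
proof -
  interpret V: normed_space V by fact
  show ?thesis using assms(1,3) by (auto simp: bounded_linear_map_def Pi_iff)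
qed

text \<open>\<open>bounded_linear_map\<close> allows a negative constant. Chaining two estimates
  requires a nonnegative one, and the absolute value serves.\<close>

lemma (in normed_space) bounded_linear_map_bound:
  assumes "bounded_linear_map V W T"
  obtains K where "0 \<le> K" "\<And>x. x \<in> carrier V \<Longrightarrow> \<parallel>T x\<parallel>\<^bsub>W\<^esub> \<le> K * \<parallel>x\<parallel>"
proof -
  obtain K where K: "\<And>x. x \<in> carrier V \<Longrightarrow> \<parallel>T x\<parallel>\<^bsub>W\<^esub> \<le> K * \<parallel>x\<parallel>"
    using assms unfolding bounded_linear_map_def by blast
  have "\<parallel>T x\<parallel>\<^bsub>W\<^esub> \<le> \<bar>K\<bar> * \<parallel>x\<parallel>" if "x \<in> carrier V" for x
    using K [OF that] nrm_nonneg [OF that] by (meson abs_ge_self mult_right_mono order_trans)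
  then show ?thesis using that [of "\<bar>K\<bar>"] by simp
qed

lemma (in normed_space) smult_minus_one_add:
  assumes "x \<in> carrier V" shows "(-1) \<odot> x \<oplus> x = \<zero>"
  using smult_l_distr [of "-1" 1 x] assms normed_space_smult_0 [OF normed_space_axioms assms]
    smult_one [of x] by simp

text \<open>Subtraction is defined through the additive inverse, which linearity does not mention.
  Written as a scalar multiple it is preserved by every linear map.\<close>

lemma (in normed_space) minus_eq_smult:
  assumes "x \<in> carrier V" "y \<in> carrier V"
  shows "x \<ominus> y = x \<oplus> (-1) \<odot> y"
  using assms smult_minus_one_add [of y] by (simp add: a_minus_def minus_equality)

lemma bounded_linear_map_zero:
  assumes "normed_space V" "normed_space W" "bounded_linear_map V W T"
  shows "T \<zero>\<^bsub>V\<^esub> = \<zero>\<^bsub>W\<^esub>"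
proof -
  interpret V: normed_space V by fact
  interpret W: normed_space W by fact
  have "T (0 \<odot>\<^bsub>V\<^esub> \<zero>\<^bsub>V\<^esub>) = 0 \<odot>\<^bsub>W\<^esub> T \<zero>\<^bsub>V\<^esub>"
    by (rule bounded_linear_mapD [OF assms(3)]) simp
  then show ?thesis
    using bounded_linear_mapD(1) [OF assms(3)] by (simp add: normed_space_smult_0 assms)
qed

lemma bounded_linear_map_minus:
  assumes "normed_space V" "normed_space W" "bounded_linear_map V W T"
    and "x \<in> carrier V" "y \<in> carrier V"
  shows "T (x \<ominus>\<^bsub>V\<^esub> y) = T x \<ominus>\<^bsub>W\<^esub> T y"
proof -
  interpret V: normed_space V by fact
  interpret W: normed_space W by fact
  show ?thesis
    using assms by (simp add: V.minus_eq_smult W.minus_eq_smult bounded_linear_mapD [OF assms(3)])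
qed

lemma bounded_linear_map_compose:
  assumes "normed_space V" "normed_space W"
    and T: "bounded_linear_map V W T" and S: "bounded_linear_map W Z S"
  shows "bounded_linear_map V Z (\<lambda>x. S (T x))"
proof -
  interpret V: normed_space V by fact
  interpret W: normed_space W by fact
  obtain K where K: "0 \<le> K" "\<And>x. x \<in> carrier V \<Longrightarrow> \<parallel>T x\<parallel>\<^bsub>W\<^esub> \<le> K * \<parallel>x\<parallel>\<^bsub>V\<^esub>"
    using V.bounded_linear_map_bound [OF T] by blast
  obtain L where L: "0 \<le> L" "\<And>x. x \<in> carrier W \<Longrightarrow> \<parallel>S x\<parallel>\<^bsub>Z\<^esub> \<le> L * \<parallel>x\<parallel>\<^bsub>W\<^esub>"
    using W.bounded_linear_map_bound [OF S] by blast
  show ?thesis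
  proof (rule bounded_linear_mapI)
    fix x assume x: "x \<in> carrier V"
    have "\<parallel>S (T x)\<parallel>\<^bsub>Z\<^esub> \<le> L * \<parallel>T x\<parallel>\<^bsub>W\<^esub>" using L x bounded_linear_mapD(1) [OF T] by blast
    also have "\<dots> \<le> L * (K * \<parallel>x\<parallel>\<^bsub>V\<^esub>)" using K x L by (intro mult_left_mono) auto
    finally show "\<parallel>S (T x)\<parallel>\<^bsub>Z\<^esub> \<le> L * K * \<parallel>x\<parallel>\<^bsub>V\<^esub>" by (simp add: mult.assoc)
  qed (simp_all add: bounded_linear_mapD [OF T] bounded_linear_mapD [OF S])
qed

lemma bounded_linear_map_add:
  assumes "normed_space V" "normed_space W"
    and T: "bounded_linear_map V W T" and S: "bounded_linear_map V W S"
  shows "bounded_linear_map V W (\<lambda>x. T x \<oplus>\<^bsub>W\<^esub> S x)"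
proof -
  interpret V: normed_space V by fact
  interpret W: normed_space W by fact
  note T' = bounded_linear_mapD [OF T] and S' = bounded_linear_mapD [OF S]
  obtain K where K: "0 \<le> K" "\<And>x. x \<in> carrier V \<Longrightarrow> \<parallel>T x\<parallel>\<^bsub>W\<^esub> \<le> K * \<parallel>x\<parallel>\<^bsub>V\<^esub>"
    using V.bounded_linear_map_bound [OF T] by blast
  obtain L where L: "0 \<le> L" "\<And>x. x \<in> carrier V \<Longrightarrow> \<parallel>S x\<parallel>\<^bsub>W\<^esub> \<le> L * \<parallel>x\<parallel>\<^bsub>V\<^esub>"
    using V.bounded_linear_map_bound [OF S] by blast
  show ?thesis
  proof (rule bounded_linear_mapI)
    fix x assume x: "x \<in> carrier V"
    show "\<parallel>T x \<oplus>\<^bsub>W\<^esub> S x\<parallel>\<^bsub>W\<^esub> \<le> (K + L) * \<parallel>x\<parallel>\<^bsub>V\<^esub>"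
      using W.nrm_triangle [of "T x" "S x"] K(2) [OF x] L(2) [OF x] x
      by (simp add: T' S' distrib_right)
  qed (simp_all add: T' S' W.a_ac W.smult_r_distr)
qed

lemma bounded_linear_map_smult:
  assumes "normed_space V" "normed_space W" and T: "bounded_linear_map V W T"
  shows "bounded_linear_map V W (\<lambda>x. c \<odot>\<^bsub>W\<^esub> T x)"
proof -
  interpret V: normed_space V by fact
  interpret W: normed_space W by fact
  note T' = bounded_linear_mapD [OF T]
  obtain K where K: "0 \<le> K" "\<And>x. x \<in> carrier V \<Longrightarrow> \<parallel>T x\<parallel>\<^bsub>W\<^esub> \<le> K * \<parallel>x\<parallel>\<^bsub>V\<^esub>"
    using V.bounded_linear_map_bound [OF T] by blast
  show ?thesis
  proof (rule bounded_linear_mapI)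
    fix x assume x: "x \<in> carrier V"
    show "\<parallel>c \<odot>\<^bsub>W\<^esub> T x\<parallel>\<^bsub>W\<^esub> \<le> (norm c * K) * \<parallel>x\<parallel>\<^bsub>V\<^esub>"
      using K(2) [OF x] x by (simp add: T' W.nrm_smult mult.assoc mult_left_mono)
  next
    fix d x assume x: "x \<in> carrier V"
    show "c \<odot>\<^bsub>W\<^esub> T (d \<odot>\<^bsub>V\<^esub> x) = d \<odot>\<^bsub>W\<^esub> (c \<odot>\<^bsub>W\<^esub> T x)"
      using x W.smult_assoc1 [of c d "T x"] W.smult_assoc1 [of d c "T x"]
      by (simp add: T' mult.commute)
  qed (simp_all add: T' W.smult_r_distr)
qed

lemma bounded_linear_map_diff:
  assumes "normed_space V" "normed_space W"
    and T: "bounded_linear_map V W T" and S: "bounded_linear_map V W S"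
  shows "bounded_linear_map V W (\<lambda>x. T x \<ominus>\<^bsub>W\<^esub> S x)"
proof (rule bounded_linear_map_cong [OF _ assms(1)])
  show "bounded_linear_map V W (\<lambda>x. T x \<oplus>\<^bsub>W\<^esub> (-1) \<odot>\<^bsub>W\<^esub> S x)"
    by (intro bounded_linear_map_add bounded_linear_map_smult assms)
qed (simp add: normed_space.minus_eq_smult [OF assms(2)] bounded_linear_mapD(1) [OF T] bounded_linear_mapD(1) [OF S])

lemma bounded_linear_map_const_zero:
  assumes "normed_space V" "normed_space W"
  shows "bounded_linear_map V W (\<lambda>_. \<zero>\<^bsub>W\<^esub>)"
proof -
  interpret V: normed_space V by fact
  interpret W: normed_space W by fact
  show ?thesis by (rule bounded_linear_mapI [of _ _ _ 0]) (simp_all add: W.nrm_zero)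
qed

text \<open>The inverse of an isometric bijection is linear because the map is injective, and it is
  bounded by 1. For \<open>f = emb T\<close> it is \<open>unemb E T\<close>, so level 0 can be
  exchanged with \<open>E\<close> in both directions.\<close>

lemma isometric_iso_inverse:
  assumes E: "normed_space E" and f: "isometric_iso E F f"
  defines "g \<equiv> inv_into (carrier E) f"
  shows "bounded_linear_map F E g"
    and "x \<in> carrier E \<Longrightarrow> g (f x) = x"
    and "y \<in> carrier F \<Longrightarrow> f (g y) = y"
proof -
  interpret E: normed_space E by fact
  have bij: "bij_betw f (carrier E) (carrier F)" and lin: "bounded_linear_map E F f"
    and iso: "\<And>x. x \<in> carrier E \<Longrightarrow> \<parallel>f x\<parallel>\<^bsub>F\<^esub> = \<parallel>x\<parallel>\<^bsub>E\<^esub>"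
    using f by (auto simp: isometric_iso_def)
  note f' = bounded_linear_mapD [OF lin]
  have gf: "g (f x) = x" if "x \<in> carrier E" for x
    using bij that by (simp add: g_def bij_betw_inv_into_left)
  have fg: "f (g y) = y" if "y \<in> carrier F" for y
    using bij that by (simp add: g_def bij_betw_inv_into_right)
  have gc: "g y \<in> carrier E" if "y \<in> carrier F" for y
    using bij that unfolding g_def by (metis bij_betw_def inv_into_into)
  show "bounded_linear_map F E g"
  proof (rule bounded_linear_mapI [of _ _ _ 1])
    fix x y assume "x \<in> carrier F" "y \<in> carrier F"
    then show "g (x \<oplus>\<^bsub>F\<^esub> y) = g x \<oplus>\<^bsub>E\<^esub> g y"
      using gf [of "g x \<oplus>\<^bsub>E\<^esub> g y"] by (simp add: f' fg gc)
  next
    fix c x assume "x \<in> carrier F"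
    then show "g (c \<odot>\<^bsub>F\<^esub> x) = c \<odot>\<^bsub>E\<^esub> g x"
      using gf [of "c \<odot>\<^bsub>E\<^esub> g x"] by (simp add: f' fg gc)
    show "\<parallel>g x\<parallel>\<^bsub>E\<^esub> \<le> 1 * \<parallel>x\<parallel>\<^bsub>F\<^esub>"
      using iso [of "g x"] \<open>x \<in> carrier F\<close> by (simp add: fg gc)
  qed (fact gc)
  show "x \<in> carrier E \<Longrightarrow> g (f x) = x" "y \<in> carrier F \<Longrightarrow> f (g y) = y"
    using gf fg by auto
qed

section \<open>Equality and norm estimates in a dual\<close>

lemma is_dualD:
  assumes "is_dual V W p"
  shows "normed_space W"
    and "\<phi> \<in> carrier W \<Longrightarrow> bounded_linear_map V scalars (p \<phi>)"
    and "bounded_linear_map V scalars f \<Longrightarrow> \<exists>!\<phi>. \<phi> \<in> carrier W \<and> (\<forall>e\<in>carrier V. p \<phi> e = f e)"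
    and "\<lbrakk>\<phi> \<in> carrier W; \<psi> \<in> carrier W; e \<in> carrier V\<rbrakk> \<Longrightarrow> p (\<phi> \<oplus>\<^bsub>W\<^esub> \<psi>) e = p \<phi> e + p \<psi> e"
    and "\<lbrakk>\<phi> \<in> carrier W; e \<in> carrier V\<rbrakk> \<Longrightarrow> p (c \<odot>\<^bsub>W\<^esub> \<phi>) e = c * p \<phi> e"
    and "\<phi> \<in> carrier W \<Longrightarrow> \<parallel>\<phi>\<parallel>\<^bsub>W\<^esub> = (SUP e\<in>{e \<in> carrier V. \<parallel>e\<parallel>\<^bsub>V\<^esub> \<le> 1}. norm (p \<phi> e))"
  using assms unfolding is_dual_def by blast+

text \<open>Both elements represent the same functional, and the representing element is unique.
  Equations between elements of a dual are tested on vectors by this rule.\<close>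

lemma is_dual_ext:
  assumes "is_dual V W p" "\<phi> \<in> carrier W" "\<psi> \<in> carrier W" "\<And>e. e \<in> carrier V \<Longrightarrow> p \<phi> e = p \<psi> e"
  shows "\<phi> = \<psi>"
  using is_dualD(3) [OF assms(1) is_dualD(2) [OF assms(1,3)]] assms(2-4) by blast

lemma is_dual_zero:
  assumes "is_dual V W p" "e \<in> carrier V"
  shows "p \<zero>\<^bsub>W\<^esub> e = 0"
proof -
  interpret W: normed_space W by (rule is_dualD [OF assms(1)])
  have "p (0 \<odot>\<^bsub>W\<^esub> \<zero>\<^bsub>W\<^esub>) e = 0" using is_dualD(5) [OF assms(1) W.zero_closed assms(2), of 0] by simp
  then show ?thesis by (simp add: normed_space_smult_0 W.normed_space_axioms)
qed

text \<open>The norm of \<phi> is a supremum over the unit ball, so \<open>e\<close> is scaled into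
  the ball by the reciprocal of its norm. A vector of norm zero cannot be scaled; it equals 0 times
  itself.\<close>

lemma is_dual_pairing_le:
  fixes V :: "('k::real_normed_field, 'v, 'm) nspace_scheme"
  assumes "normed_space V" and d: "is_dual V W p" and \<phi>: "\<phi> \<in> carrier W" and e: "e \<in> carrier V"
  shows "norm (p \<phi> e) \<le> \<parallel>\<phi>\<parallel>\<^bsub>W\<^esub> * \<parallel>e\<parallel>\<^bsub>V\<^esub>"
proof -
  interpret V: normed_space V by fact
  have lin: "bounded_linear_map V scalars (p \<phi>)" by (rule is_dualD(2) [OF d \<phi>])
  show ?thesis
  proof (cases "\<parallel>e\<parallel>\<^bsub>V\<^esub> = 0")
    case True
    then have "p \<phi> e = p \<phi> (0 \<odot>\<^bsub>V\<^esub> e)"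
      using e V.nrm_eq_0_iff [OF e] normed_space_smult_0 [OF assms(1) e] by simp
    also have "\<dots> = 0" using bounded_linear_mapD(3) [OF lin e] by simp
    finally show ?thesis using True by simp
  next
    case False
    define c where "c = (of_real (1 / \<parallel>e\<parallel>\<^bsub>V\<^esub>) :: 'k)"
    have pos: "\<parallel>e\<parallel>\<^bsub>V\<^esub> > 0" using False V.nrm_nonneg [OF e] by simp
    then have c: "norm c = 1 / \<parallel>e\<parallel>\<^bsub>V\<^esub>" by (simp add: c_def norm_divide)
    have "norm (p \<phi> (c \<odot>\<^bsub>V\<^esub> e)) \<le> \<parallel>\<phi>\<parallel>\<^bsub>W\<^esub>"
      unfolding is_dualD(6) [OF d \<phi>]
      by (rule V.functional_le [OF lin]) (use e c pos in \<open>simp_all add: V.nrm_smult\<close>)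
    then show ?thesis using c pos e by (simp add: bounded_linear_mapD [OF lin] norm_mult field_simps)
  qed
qed

lemma is_dual_nrm_le:
  assumes "normed_space V" and d: "is_dual V W p" and \<phi>: "\<phi> \<in> carrier W" and "0 \<le> K"
    and K: "\<And>e. e \<in> carrier V \<Longrightarrow> norm (p \<phi> e) \<le> K * \<parallel>e\<parallel>\<^bsub>V\<^esub>"
  shows "\<parallel>\<phi>\<parallel>\<^bsub>W\<^esub> \<le> K"
proof -
  interpret V: normed_space V by fact
  have "norm (p \<phi> e) \<le> K" if "e \<in> carrier V" "\<parallel>e\<parallel>\<^bsub>V\<^esub> \<le> 1" for e
    using K [OF that(1)] mult_left_le [OF that(2) \<open>0 \<le> K\<close>] by simp
  then show ?thesis
    unfolding is_dualD(6) [OF d \<phi>] by (intro cSUP_least V.unit_ball_ne) auto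
qed

lemma functional:
  assumes "is_dual (level T k) (level T (Suc k)) (pairing T k)"
    and "bounded_linear_map (level T k) scalars f"
  shows functional_closed: "functional T k f \<in> carrier (level T (Suc k))"
    and pairing_functional: "e \<in> carrier (level T k) \<Longrightarrow> pairing T k (functional T k f) e = f e"
  using theI' [OF is_dualD(3) [OF assms]] unfolding functional_def by blast+

text \<open>The adjoint of \<open>f\<close>, running from level \<open>k + 1\<close> of
  \<open>T\<close> to level \<open>k + 1\<close> of \<open>S\<close>. It has this form so that the
  actions in \<open>iter_dual\<close> and both halves of the recursion for \<open>prod_xF\<close>
  and \<open>prod_Fx\<close> are instances of it.\<close>

definition dual_map ::
    "('k::real_normed_field, 'e, 'v) dual_tower \<Rightarrow> ('k, 'f, 'w) dual_tower \<Rightarrow> nat \<Rightarrow>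
      ('v \<Rightarrow> 'w) \<Rightarrow> 'w \<Rightarrow> 'v" where
  "dual_map S T k f \<phi> = functional S k (\<lambda>e. pairing T k \<phi> (f e))"

text \<open>Two towers occur because the products with x map duals of \<open>A\<close> to duals of
  \<open>X\<close>. The locale fixes one level with its dual and is used for all pairs out of the
  three towers.\<close>

locale two_duals =
  fixes S :: "('k::real_normed_field, 'e, 'v) dual_tower" and T :: "('k, 'f, 'w) dual_tower"
    and k :: nat
  assumes S: "normed_space (level S k)" "is_dual (level S k) (level S (Suc k)) (pairing S k)"
    and T: "normed_space (level T k)" "is_dual (level T k) (level T (Suc k)) (pairing T k)"
begin

context
  fixes f assumes f: "bounded_linear_map (level S k) (level T k) f"
begin

lemma bounded_linear_map_pairing:
  assumes "\<phi> \<in> carrier (level T (Suc k))"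
  shows "bounded_linear_map (level S k) scalars (\<lambda>e. pairing T k \<phi> (f e))"
  by (rule bounded_linear_map_compose [OF S(1) T(1) f is_dualD(2) [OF T(2) assms]])

lemma dual_map_closed:
  assumes "\<phi> \<in> carrier (level T (Suc k))" shows "dual_map S T k f \<phi> \<in> carrier (level S (Suc k))"
  unfolding dual_map_def by (rule functional_closed [OF S(2) bounded_linear_map_pairing [OF assms]])

lemma pairing_dual_map:
  assumes "\<phi> \<in> carrier (level T (Suc k))" "e \<in> carrier (level S k)"
  shows "pairing S k (dual_map S T k f \<phi>) e = pairing T k \<phi> (f e)"
  unfolding dual_map_def
  by (rule pairing_functional [OF S(2) bounded_linear_map_pairing [OF assms(1)] assms(2)])

text \<open>The constant is explicit because the bound for a dual action must be uniform in the
  acting element.\<close>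

lemma nrm_dual_map_le:
  assumes "\<phi> \<in> carrier (level T (Suc k))" "0 \<le> K"
    and K: "\<And>e. e \<in> carrier (level S k) \<Longrightarrow> \<parallel>f e\<parallel>\<^bsub>level T k\<^esub> \<le> K * \<parallel>e\<parallel>\<^bsub>level S k\<^esub>"
  shows "\<parallel>dual_map S T k f \<phi>\<parallel>\<^bsub>level S (Suc k)\<^esub> \<le> K * \<parallel>\<phi>\<parallel>\<^bsub>level T (Suc k)\<^esub>"
proof (rule is_dual_nrm_le [OF S dual_map_closed [OF assms(1)]])
  interpret T': normed_space "level T (Suc k)" by (rule is_dualD [OF T(2)])
  show "0 \<le> K * \<parallel>\<phi>\<parallel>\<^bsub>level T (Suc k)\<^esub>" using assms T'.nrm_nonneg by simp
  fix e assume e: "e \<in> carrier (level S k)"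
  have "norm (pairing T k \<phi> (f e)) \<le> \<parallel>\<phi>\<parallel>\<^bsub>level T (Suc k)\<^esub> * \<parallel>f e\<parallel>\<^bsub>level T k\<^esub>"
    by (intro is_dual_pairing_le T assms bounded_linear_mapD(1) [OF f] e)
  also have "\<dots> \<le> \<parallel>\<phi>\<parallel>\<^bsub>level T (Suc k)\<^esub> * (K * \<parallel>e\<parallel>\<^bsub>level S k\<^esub>)"
    by (intro mult_left_mono K e T'.nrm_nonneg assms)
  finally show "norm (pairing S k (dual_map S T k f \<phi>) e)
      \<le> K * \<parallel>\<phi>\<parallel>\<^bsub>level T (Suc k)\<^esub> * \<parallel>e\<parallel>\<^bsub>level S k\<^esub>"
    using pairing_dual_map [OF assms(1) e] by (simp add: mult_ac)
qed

lemma bounded_linear_map_dual_map: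
  "bounded_linear_map (level T (Suc k)) (level S (Suc k)) (dual_map S T k f)"
proof -
  interpret S: normed_space "level S k" by (rule S)
  interpret S': normed_space "level S (Suc k)" by (rule is_dualD [OF S(2)])
  interpret T': normed_space "level T (Suc k)" by (rule is_dualD [OF T(2)])
  obtain K where K: "0 \<le> K" "\<And>x. x \<in> carrier (level S k) \<Longrightarrow> \<parallel>f x\<parallel>\<^bsub>level T k\<^esub> \<le> K * \<parallel>x\<parallel>\<^bsub>level S k\<^esub>"
    using S.bounded_linear_map_bound [OF f] by blast
  show ?thesis
  proof (rule bounded_linear_mapI)
    fix \<phi> assume \<phi>: "\<phi> \<in> carrier (level T (Suc k))"
    show "\<parallel>dual_map S T k f \<phi>\<parallel>\<^bsub>level S (Suc k)\<^esub> \<le> K * \<parallel>\<phi>\<parallel>\<^bsub>level T (Suc k)\<^esub>"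
      by (rule nrm_dual_map_le [OF \<phi> K])
    show "dual_map S T k f \<phi> \<in> carrier (level S (Suc k))"
      by (rule dual_map_closed [OF \<phi>])
    show "dual_map S T k f (c \<odot>\<^bsub>level T (Suc k)\<^esub> \<phi>) = c \<odot>\<^bsub>level S (Suc k)\<^esub> dual_map S T k f \<phi>" for c
      using \<phi> bounded_linear_mapD(1) [OF f]
      by (intro is_dual_ext [OF S(2)])
        (simp_all add: dual_map_closed pairing_dual_map is_dualD(5) [OF S(2)] is_dualD(5) [OF T(2)])
    fix \<psi> assume \<psi>: "\<psi> \<in> carrier (level T (Suc k))"
    show "dual_map S T k f (\<phi> \<oplus>\<^bsub>level T (Suc k)\<^esub> \<psi>)
        = dual_map S T k f \<phi> \<oplus>\<^bsub>level S (Suc k)\<^esub> dual_map S T k f \<psi>"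
      using \<phi> \<psi> bounded_linear_mapD(1) [OF f]
      by (intro is_dual_ext [OF S(2)])
        (simp_all add: dual_map_closed pairing_dual_map is_dualD(4) [OF S(2)] is_dualD(4) [OF T(2)])
  qed
qed

end

end

section \<open>Modules and their iterated duals\<close>

lemma with_actions_simps [simp]:
  "carrier (with_actions E l r) = carrier E" "add (with_actions E l r) = add E"
  "smult (with_actions E l r) = smult E" "nrm (with_actions E l r) = nrm E"
  "ring.zero (with_actions E l r) = ring.zero E"
  "a_minus (with_actions E l r) = a_minus E"
  "lact (with_actions E l r) = l" "ract (with_actions E l r) = r"
  by (simp_all add: with_actions_def fun_eq_iff a_minus_def a_inv_def m_inv_def)

lemma bounded_linear_map_with_actions [simp]:
  "bounded_linear_map V (with_actions E l r) f \<longleftrightarrow> bounded_linear_map V E f"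
  "bounded_linear_map (with_actions E l r) W g \<longleftrightarrow> bounded_linear_map E W g"
  by (simp_all add: bounded_linear_map_def)

lemma normed_space_with_actions:
  assumes "normed_space E" shows "normed_space (with_actions E l r)"
proof -
  interpret E: normed_space E by fact
  show ?thesis
  proof (rule normed_spaceI, goal_cases)
    case (7 x)
    then show ?case by (simp add: E.smult_minus_one_add)
  qed (use E.smult_l_distr E.smult_assoc1 E.smult_one in
      \<open>simp_all add: E.a_ac E.smult_r_distr E.nrm_nonneg E.nrm_eq_0_iff E.nrm_triangle E.nrm_smult\<close>)
qed

lemma iter_dual_simps [simp]:
  "carrier (iter_dual E T k) = carrier (level T k)" "add (iter_dual E T k) = add (level T k)"
  "smult (iter_dual E T k) = smult (level T k)" "nrm (iter_dual E T k) = nrm (level T k)"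
  "ring.zero (iter_dual E T k) = ring.zero (level T k)"
  "a_minus (iter_dual E T k) = a_minus (level T k)"
  by (cases k; simp)+

lemma bounded_linear_map_iter_dual [simp]:
  "bounded_linear_map V (iter_dual E T k) f \<longleftrightarrow> bounded_linear_map V (level T k) f"
  "bounded_linear_map (iter_dual E T k) W g \<longleftrightarrow> bounded_linear_map (level T k) W g"
  by (simp_all add: bounded_linear_map_def)

lemma normed_space_iter_dual:
  "normed_space (level T k) \<Longrightarrow> normed_space (iter_dual E T k)"
  by (cases k) (simp_all add: normed_space_with_actions)

lemma is_dual_towerD:
  assumes "is_dual_tower E T m"
  shows "isometric_iso E (level T 0) (emb T)"
    and "k \<le> m \<Longrightarrow> normed_space (level T k)"
    and "k < m \<Longrightarrow> is_dual (level T k) (level T (Suc k)) (pairing T k)"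
proof -
  show "isometric_iso E (level T 0) (emb T)"
    and d: "k < m \<Longrightarrow> is_dual (level T k) (level T (Suc k)) (pairing T k)" for k
    using assms by (auto simp: is_dual_tower_def)
  show "normed_space (level T k)" if "k \<le> m"
  proof (cases k)
    case 0
    then show ?thesis using assms by (simp add: is_dual_tower_def)
  next
    case (Suc j)
    then show ?thesis using d [of j] that is_dualD(1) by auto
  qed
qed

lemma two_duals_dual_towers:
  assumes "is_dual_tower E S m" "is_dual_tower F T m" "k < m"
  shows "two_duals S T k"
  using is_dual_towerD [OF assms(1)] is_dual_towerD [OF assms(2)] assms(3)
  by (simp add: two_duals_def)

lemma (in normed_space) add_diff_add:
  assumes "t \<in> carrier V" "u \<in> carrier V" "v \<in> carrier V" "w \<in> carrier V"
  shows "(t \<oplus> u) \<ominus> (v \<oplus> w) = (t \<ominus> v) \<oplus> (u \<ominus> w)"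
  using assms by (simp add: a_minus_def a_ac minus_add)

lemma (in normed_space) diff_add_diff:
  assumes "u \<in> carrier V" "v \<in> carrier V" "w \<in> carrier V"
  shows "(v \<ominus> w) \<oplus> (u \<ominus> v) = u \<ominus> w"
  using assms by (simp add: a_minus_def a_ac r_neg1 r_neg2)

text \<open>Module axioms in a form that passes to duals: each action is a family of bounded
  operators, whose adjoints are the dual actions. The joint estimate \<open>act_bounded\<close>
  stands beside them, since an estimate uniform in the vector is what bounds the orbit maps on the
  dual.\<close>

locale normed_bimodule = B: normed_space B + E: normed_space E
  for B :: "('k::real_normed_field, 'b, 'm) nspace_scheme" (structure)
    and E :: "('k, 'b, 'e, 'l) bimodule_scheme" +
  assumes mult_closed: "\<lbrakk>b \<in> carrier B; c \<in> carrier B\<rbrakk> \<Longrightarrow> b \<otimes> c \<in> carrier B"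
    and lact_linear: "b \<in> carrier B \<Longrightarrow> bounded_linear_map E E (\<lambda>e. b \<triangleright>\<^bsub>E\<^esub> e)"
    and ract_linear: "b \<in> carrier B \<Longrightarrow> bounded_linear_map E E (\<lambda>e. e \<triangleleft>\<^bsub>E\<^esub> b)"
    and orbit_linear:
      "e \<in> carrier E \<Longrightarrow> bounded_linear_map B E (\<lambda>b. b \<triangleright>\<^bsub>E\<^esub> e)"
      "e \<in> carrier E \<Longrightarrow> bounded_linear_map B E (\<lambda>b. e \<triangleleft>\<^bsub>E\<^esub> b)"
    and lact_assoc: "\<lbrakk>b \<in> carrier B; c \<in> carrier B; e \<in> carrier E\<rbrakk>
      \<Longrightarrow> (b \<otimes> c) \<triangleright>\<^bsub>E\<^esub> e = b \<triangleright>\<^bsub>E\<^esub> (c \<triangleright>\<^bsub>E\<^esub> e)"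
    and ract_assoc: "\<lbrakk>b \<in> carrier B; c \<in> carrier B; e \<in> carrier E\<rbrakk>
      \<Longrightarrow> e \<triangleleft>\<^bsub>E\<^esub> (b \<otimes> c) = (e \<triangleleft>\<^bsub>E\<^esub> b) \<triangleleft>\<^bsub>E\<^esub> c"
    and act_assoc: "\<lbrakk>b \<in> carrier B; c \<in> carrier B; e \<in> carrier E\<rbrakk>
      \<Longrightarrow> (b \<triangleright>\<^bsub>E\<^esub> e) \<triangleleft>\<^bsub>E\<^esub> c = b \<triangleright>\<^bsub>E\<^esub> (e \<triangleleft>\<^bsub>E\<^esub> c)"
    and act_bounded: "\<exists>K\<ge>0. \<forall>b\<in>carrier B. \<forall>e\<in>carrier E.
      \<parallel>b \<triangleright>\<^bsub>E\<^esub> e\<parallel>\<^bsub>E\<^esub> \<le> K * \<parallel>b\<parallel> * \<parallel>e\<parallel>\<^bsub>E\<^esub> \<and> \<parallel>e \<triangleleft>\<^bsub>E\<^esub> b\<parallel>\<^bsub>E\<^esub> \<le> K * \<parallel>b\<parallel> * \<parallel>e\<parallel>\<^bsub>E\<^esub>"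
begin

lemma act_closed [simp]:
  assumes "b \<in> carrier B" "e \<in> carrier E"
  shows "b \<triangleright>\<^bsub>E\<^esub> e \<in> carrier E" "e \<triangleleft>\<^bsub>E\<^esub> b \<in> carrier E"
  using assms bounded_linear_mapD(1) [OF lact_linear] bounded_linear_mapD(1) [OF ract_linear] by auto

lemma act_minus:
  assumes "b \<in> carrier B" "e \<in> carrier E" "f \<in> carrier E"
  shows "b \<triangleright>\<^bsub>E\<^esub> (e \<ominus>\<^bsub>E\<^esub> f) = b \<triangleright>\<^bsub>E\<^esub> e \<ominus>\<^bsub>E\<^esub> b \<triangleright>\<^bsub>E\<^esub> f" "(e \<ominus>\<^bsub>E\<^esub> f) \<triangleleft>\<^bsub>E\<^esub> b = e \<triangleleft>\<^bsub>E\<^esub> b \<ominus>\<^bsub>E\<^esub> f \<triangleleft>\<^bsub>E\<^esub> b"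
  by (rule bounded_linear_map_minus [OF E.normed_space_axioms E.normed_space_axioms]
      lact_linear ract_linear assms)+

lemma bounded_linear_map_inner_derivation:
  "e \<in> carrier E \<Longrightarrow> bounded_linear_map B E (inner_derivation E e)"
  unfolding inner_derivation_def
  by (intro bounded_linear_map_diff orbit_linear B.normed_space_axioms E.normed_space_axioms)

lemma inner_derivation_closed:
  "\<lbrakk>e \<in> carrier E; b \<in> carrier B\<rbrakk> \<Longrightarrow> inner_derivation E e b \<in> carrier E"
  by (simp add: inner_derivation_def)

text \<open>The mixed term b e c occurs in both products with opposite signs and cancels; that it is
  the same term is \<open>act_assoc\<close>.\<close>

lemma derivation_inner_derivation:
  assumes e: "e \<in> carrier E" shows "derivation B E (inner_derivation E e)"
  unfolding derivation_def
proof (intro conjI ballI bounded_linear_map_inner_derivation e)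
  fix b c assume b: "b \<in> carrier B" and c: "c \<in> carrier B"
  have 1: "(b \<triangleright>\<^bsub>E\<^esub> e \<ominus>\<^bsub>E\<^esub> e \<triangleleft>\<^bsub>E\<^esub> b) \<triangleleft>\<^bsub>E\<^esub> c = b \<triangleright>\<^bsub>E\<^esub> (e \<triangleleft>\<^bsub>E\<^esub> c) \<ominus>\<^bsub>E\<^esub> e \<triangleleft>\<^bsub>E\<^esub> (b \<otimes> c)"
    using b c e by (simp add: act_minus act_assoc ract_assoc)
  have 2: "b \<triangleright>\<^bsub>E\<^esub> (c \<triangleright>\<^bsub>E\<^esub> e \<ominus>\<^bsub>E\<^esub> e \<triangleleft>\<^bsub>E\<^esub> c) = (b \<otimes> c) \<triangleright>\<^bsub>E\<^esub> e \<ominus>\<^bsub>E\<^esub> b \<triangleright>\<^bsub>E\<^esub> (e \<triangleleft>\<^bsub>E\<^esub> c)"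
    using b c e by (simp add: act_minus lact_assoc)
  show "inner_derivation E e (b \<otimes> c)
      = inner_derivation E e b \<triangleleft>\<^bsub>E\<^esub> c \<oplus>\<^bsub>E\<^esub> b \<triangleright>\<^bsub>E\<^esub> inner_derivation E e c"
    unfolding inner_derivation_def 1 2 using b c e by (simp add: mult_closed E.diff_add_diff)
qed

lemma derivation_diff:
  assumes D: "derivation B E D" and D': "derivation B E D'"
  shows "derivation B E (\<lambda>b. D b \<ominus>\<^bsub>E\<^esub> D' b)"
  unfolding derivation_def
proof (intro conjI ballI)
  have lin: "bounded_linear_map B E D" "bounded_linear_map B E D'"
    using D D' by (auto simp: derivation_def)
  then show "bounded_linear_map B E (\<lambda>b. D b \<ominus>\<^bsub>E\<^esub> D' b)"
    by (intro bounded_linear_map_diff B.normed_space_axioms E.normed_space_axioms)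
  note cl = bounded_linear_mapD(1) [OF lin(1)] bounded_linear_mapD(1) [OF lin(2)]
  fix b c assume b: "b \<in> carrier B" and c: "c \<in> carrier B"
  have "(D b \<ominus>\<^bsub>E\<^esub> D' b) \<triangleleft>\<^bsub>E\<^esub> c = D b \<triangleleft>\<^bsub>E\<^esub> c \<ominus>\<^bsub>E\<^esub> D' b \<triangleleft>\<^bsub>E\<^esub> c"
    "b \<triangleright>\<^bsub>E\<^esub> (D c \<ominus>\<^bsub>E\<^esub> D' c) = b \<triangleright>\<^bsub>E\<^esub> D c \<ominus>\<^bsub>E\<^esub> b \<triangleright>\<^bsub>E\<^esub> D' c"
    using b c by (simp_all add: cl act_minus)
  moreover have "D (b \<otimes> c) = D b \<triangleleft>\<^bsub>E\<^esub> c \<oplus>\<^bsub>E\<^esub> b \<triangleright>\<^bsub>E\<^esub> D c" "D' (b \<otimes> c) = D' b \<triangleleft>\<^bsub>E\<^esub> c \<oplus>\<^bsub>E\<^esub> b \<triangleright>\<^bsub>E\<^esub> D' c"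
    using D D' b c by (auto simp: derivation_def)
  ultimately show "D (b \<otimes> c) \<ominus>\<^bsub>E\<^esub> D' (b \<otimes> c)
      = (D b \<ominus>\<^bsub>E\<^esub> D' b) \<triangleleft>\<^bsub>E\<^esub> c \<oplus>\<^bsub>E\<^esub> b \<triangleright>\<^bsub>E\<^esub> (D c \<ominus>\<^bsub>E\<^esub> D' c)"
    using b c by (simp only: E.add_diff_add act_closed cl)
qed

end

text \<open>Base of the recursion \<open>iter_dual\<close>: the actions have the form that they have
  on level 0.\<close>

lemma normed_bimodule_transport:
  assumes E: "normed_bimodule B E" and L: "normed_space L" and f: "isometric_iso E L f"
  defines "g \<equiv> inv_into (carrier E) f"
  shows "normed_bimodule B (with_actions L (\<lambda>b v. f (b \<triangleright>\<^bsub>E\<^esub> g v)) (\<lambda>v b. f (g v \<triangleleft>\<^bsub>E\<^esub> b)))"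
    (is "normed_bimodule B ?L")
proof -
  interpret E: normed_bimodule B E by fact
  interpret L: normed_space L by fact
  interpret L': normed_space ?L by (rule normed_space_with_actions [OF L])
  note ng = isometric_iso_inverse [OF E.E.normed_space_axioms f, folded g_def]
  have lf: "bounded_linear_map E L f" and nf: "\<And>x. x \<in> carrier E \<Longrightarrow> \<parallel>f x\<parallel>\<^bsub>L\<^esub> = \<parallel>x\<parallel>\<^bsub>E\<^esub>"
    using f by (auto simp: isometric_iso_def)
  note cl = bounded_linear_mapD(1) [OF lf] bounded_linear_mapD(1) [OF ng(1)]
  have ng': "\<parallel>g v\<parallel>\<^bsub>E\<^esub> = \<parallel>v\<parallel>\<^bsub>L\<^esub>" if "v \<in> carrier L" for v
    using nf [of "g v"] that by (simp add: cl ng)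
  note norms = E.B.normed_space_axioms E.E.normed_space_axioms L
  show ?thesis
  proof unfold_locales
    fix b assume b: "b \<in> carrier B"
    show "bounded_linear_map ?L ?L (\<lambda>e. b \<triangleright>\<^bsub>?L\<^esub> e)" "bounded_linear_map ?L ?L (\<lambda>e. e \<triangleleft>\<^bsub>?L\<^esub> b)"
      using bounded_linear_map_compose [OF L E.E.normed_space_axioms ng(1)
          bounded_linear_map_compose [OF _ _ E.lact_linear [OF b] lf]]
        bounded_linear_map_compose [OF L E.E.normed_space_axioms ng(1)
          bounded_linear_map_compose [OF _ _ E.ract_linear [OF b] lf]]
      by (simp_all add: norms)
  next
    fix v assume v: "v \<in> carrier ?L"
    then have gv: "g v \<in> carrier E" by (simp add: cl)
    show "bounded_linear_map B ?L (\<lambda>b. b \<triangleright>\<^bsub>?L\<^esub> v)" "bounded_linear_map B ?L (\<lambda>b. v \<triangleleft>\<^bsub>?L\<^esub> b)"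
      using bounded_linear_map_compose [OF _ _ E.orbit_linear(1) [OF gv] lf]
        bounded_linear_map_compose [OF _ _ E.orbit_linear(2) [OF gv] lf]
      by (simp_all add: norms)
  next
    obtain K where K: "K \<ge> 0" "\<And>b e. \<lbrakk>b \<in> carrier B; e \<in> carrier E\<rbrakk> \<Longrightarrow>
        \<parallel>b \<triangleright>\<^bsub>E\<^esub> e\<parallel>\<^bsub>E\<^esub> \<le> K * \<parallel>b\<parallel>\<^bsub>B\<^esub> * \<parallel>e\<parallel>\<^bsub>E\<^esub> \<and> \<parallel>e \<triangleleft>\<^bsub>E\<^esub> b\<parallel>\<^bsub>E\<^esub> \<le> K * \<parallel>b\<parallel>\<^bsub>B\<^esub> * \<parallel>e\<parallel>\<^bsub>E\<^esub>"
      using E.act_bounded by blast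
    have "\<parallel>b \<triangleright>\<^bsub>?L\<^esub> v\<parallel>\<^bsub>?L\<^esub> \<le> K * \<parallel>b\<parallel>\<^bsub>B\<^esub> * \<parallel>v\<parallel>\<^bsub>?L\<^esub> \<and> \<parallel>v \<triangleleft>\<^bsub>?L\<^esub> b\<parallel>\<^bsub>?L\<^esub> \<le> K * \<parallel>b\<parallel>\<^bsub>B\<^esub> * \<parallel>v\<parallel>\<^bsub>?L\<^esub>"
      if "b \<in> carrier B" "v \<in> carrier ?L" for b v
      using that ng' [of v] K(2) [of b "g v"] by (simp add: nf cl)
    with \<open>K \<ge> 0\<close> show "\<exists>K\<ge>0. \<forall>b\<in>carrier B. \<forall>e\<in>carrier ?L.
        \<parallel>b \<triangleright>\<^bsub>?L\<^esub> e\<parallel>\<^bsub>?L\<^esub> \<le> K * \<parallel>b\<parallel>\<^bsub>B\<^esub> * \<parallel>e\<parallel>\<^bsub>?L\<^esub> \<and> \<parallel>e \<triangleleft>\<^bsub>?L\<^esub> b\<parallel>\<^bsub>?L\<^esub> \<le> K * \<parallel>b\<parallel>\<^bsub>B\<^esub> * \<parallel>e\<parallel>\<^bsub>?L\<^esub>"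
      by blast
  qed (simp_all add: cl ng E.mult_closed E.lact_assoc E.ract_assoc E.act_assoc)
qed

text \<open>Adjoints reverse composition, so the right action on \<open>E\<close> supplies the left
  action on the dual: left associativity there comes from \<open>ract_assoc\<close>, right
  associativity from \<open>lact_assoc\<close>. \<open>E\<close> has the underlying space of
  \<open>level T k\<close> without being that record; it is the level with actions added.\<close>

lemma normed_bimodule_dual:
  fixes E :: "('k::real_normed_field, 'b, 'e, 'l) bimodule_scheme"
    and T :: "('k, 'f, 'e) dual_tower"
  assumes E: "normed_bimodule B E" and T: "two_duals T T k"
    and [simp]: "carrier E = carrier (level T k)" "add E = add (level T k)"
      "smult E = smult (level T k)" "nrm E = nrm (level T k)"
  shows "normed_bimodule B (with_actions (level T (Suc k))
      (\<lambda>b. dual_map T T k (\<lambda>e. e \<triangleleft>\<^bsub>E\<^esub> b)) (\<lambda>\<phi> b. dual_map T T k (\<lambda>e. b \<triangleright>\<^bsub>E\<^esub> e) \<phi>))"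
    (is "normed_bimodule B ?L")
proof -
  interpret E: normed_bimodule B E by fact
  interpret two_duals T T k by fact
  interpret S: normed_space "level T k" by (rule S)
  interpret L: normed_space "level T (Suc k)" by (rule is_dualD [OF T(2)])
  interpret L': normed_space ?L by (rule normed_space_with_actions [OF L.normed_space_axioms])
  have [simp]:
    "bounded_linear_map E E h'' = bounded_linear_map (level T k) (level T k) h''"
    "bounded_linear_map B E f = bounded_linear_map B (level T k) f" for h'' f
    by (simp_all add: bounded_linear_map_def)
  have r: "bounded_linear_map (level T k) (level T k) (\<lambda>e. e \<triangleleft>\<^bsub>E\<^esub> b)"
    and l: "bounded_linear_map (level T k) (level T k) (\<lambda>e. b \<triangleright>\<^bsub>E\<^esub> e)" if "b \<in> carrier B" for b
    using E.ract_linear [OF that] E.lact_linear [OF that] by simp_all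
  note cl = dual_map_closed [OF r] dual_map_closed [OF l]
  note pair = pairing_dual_map [OF r] pairing_dual_map [OF l]
  note ext = is_dual_ext [OF T(2)]
  have Ecl: "e \<triangleleft>\<^bsub>E\<^esub> b \<in> carrier (level T k)" "b \<triangleright>\<^bsub>E\<^esub> e \<in> carrier (level T k)"
    if "b \<in> carrier B" "e \<in> carrier (level T k)" for b e
    using E.act_closed [of b e] that by simp_all
  note Elin = E.orbit_linear [THEN bounded_linear_mapD(2)] E.orbit_linear [THEN bounded_linear_mapD(3)]
  obtain K where K: "K \<ge> 0"
    "\<And>b e. \<lbrakk>b \<in> carrier B; e \<in> carrier (level T k)\<rbrakk> \<Longrightarrow> \<parallel>b \<triangleright>\<^bsub>E\<^esub> e\<parallel>\<^bsub>level T k\<^esub> \<le> K * \<parallel>b\<parallel>\<^bsub>B\<^esub> * \<parallel>e\<parallel>\<^bsub>level T k\<^esub>"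
    "\<And>b e. \<lbrakk>b \<in> carrier B; e \<in> carrier (level T k)\<rbrakk> \<Longrightarrow> \<parallel>e \<triangleleft>\<^bsub>E\<^esub> b\<parallel>\<^bsub>level T k\<^esub> \<le> K * \<parallel>b\<parallel>\<^bsub>B\<^esub> * \<parallel>e\<parallel>\<^bsub>level T k\<^esub>"
    using E.act_bounded by auto
  have bound:
    "\<parallel>dual_map T T k (\<lambda>e. b \<triangleright>\<^bsub>E\<^esub> e) \<phi>\<parallel>\<^bsub>level T (Suc k)\<^esub> \<le> K * \<parallel>b\<parallel>\<^bsub>B\<^esub> * \<parallel>\<phi>\<parallel>\<^bsub>level T (Suc k)\<^esub>"
    "\<parallel>dual_map T T k (\<lambda>e. e \<triangleleft>\<^bsub>E\<^esub> b) \<phi>\<parallel>\<^bsub>level T (Suc k)\<^esub> \<le> K * \<parallel>b\<parallel>\<^bsub>B\<^esub> * \<parallel>\<phi>\<parallel>\<^bsub>level T (Suc k)\<^esub>"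
    if "b \<in> carrier B" "\<phi> \<in> carrier (level T (Suc k))" for b \<phi>
    using K E.B.nrm_nonneg that by (auto intro!: nrm_dual_map_le l r)
  note T_lin = is_dualD(2) [OF T(2), THEN bounded_linear_mapD(2)]
    is_dualD(2) [OF T(2), THEN bounded_linear_mapD(3)] is_dualD(4,5) [OF T(2)]
  show ?thesis
  proof unfold_locales
    fix b assume b: "b \<in> carrier B"
    show "bounded_linear_map ?L ?L (\<lambda>e. b \<triangleright>\<^bsub>?L\<^esub> e)" "bounded_linear_map ?L ?L (\<lambda>e. e \<triangleleft>\<^bsub>?L\<^esub> b)"
      using bounded_linear_map_dual_map [OF l [OF b]] bounded_linear_map_dual_map [OF r [OF b]]
      by simp_all
  next
    fix \<phi> assume "\<phi> \<in> carrier ?L"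
    then have \<phi>: "\<phi> \<in> carrier (level T (Suc k))" by simp
    have "bounded_linear_map B (level T (Suc k)) (\<lambda>b. dual_map T T k (\<lambda>e. e \<triangleleft>\<^bsub>E\<^esub> b) \<phi>)"
      by (rule bounded_linear_mapI [of _ _ _ "K * \<parallel>\<phi>\<parallel>\<^bsub>level T (Suc k)\<^esub>"]; (rule ext)?)
        (use \<phi> bound(2) [OF _ \<phi>] in \<open>simp_all add: cl pair Elin T_lin Ecl mult_ac\<close>)
    moreover have "bounded_linear_map B (level T (Suc k)) (\<lambda>b. dual_map T T k (\<lambda>e. b \<triangleright>\<^bsub>E\<^esub> e) \<phi>)"
      by (rule bounded_linear_mapI [of _ _ _ "K * \<parallel>\<phi>\<parallel>\<^bsub>level T (Suc k)\<^esub>"]; (rule ext)?)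
        (use \<phi> bound(1) [OF _ \<phi>] in \<open>simp_all add: cl pair Elin T_lin Ecl mult_ac\<close>)
    ultimately show "bounded_linear_map B ?L (\<lambda>b. b \<triangleright>\<^bsub>?L\<^esub> \<phi>)" "bounded_linear_map B ?L (\<lambda>b. \<phi> \<triangleleft>\<^bsub>?L\<^esub> b)"
      by simp_all
    fix b c assume "b \<in> carrier B" "c \<in> carrier B"
    note bc = this
    show "b \<otimes>\<^bsub>B\<^esub> c \<triangleright>\<^bsub>?L\<^esub> \<phi> = b \<triangleright>\<^bsub>?L\<^esub> (c \<triangleright>\<^bsub>?L\<^esub> \<phi>)"
      and "\<phi> \<triangleleft>\<^bsub>?L\<^esub> (b \<otimes>\<^bsub>B\<^esub> c) = \<phi> \<triangleleft>\<^bsub>?L\<^esub> b \<triangleleft>\<^bsub>?L\<^esub> c"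
      and "b \<triangleright>\<^bsub>?L\<^esub> \<phi> \<triangleleft>\<^bsub>?L\<^esub> c = b \<triangleright>\<^bsub>?L\<^esub> (\<phi> \<triangleleft>\<^bsub>?L\<^esub> c)"
      by (rule ext; simp add: bc \<phi> cl pair Ecl E.mult_closed E.lact_assoc E.ract_assoc E.act_assoc)+
  qed (use K(1) bound E.mult_closed in simp_all, blast)
qed


lemma normed_bimodule_iter_dual:
  assumes E: "normed_bimodule B E" and T: "is_dual_tower E T m" and "k \<le> m"
  shows "normed_bimodule B (iter_dual E T k)"
  using \<open>k \<le> m\<close>
proof (induction k)
  case 0
  show ?case
    unfolding iter_dual.simps unemb_def
    by (rule normed_bimodule_transport [OF E is_dual_towerD(2) [OF T le0] is_dual_towerD(1) [OF T]])
next
  case (Suc k)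
  then have "two_duals T T k" by (intro two_duals_dual_towers [OF T T]) simp
  from normed_bimodule_dual [OF _ this, of B "iter_dual E T k"] Suc
  show ?case by (simp add: dual_map_def [abs_def])
qed

lemma iter_dual_Suc:
  "b \<triangleright>\<^bsub>iter_dual E T (Suc k)\<^esub> \<phi> = dual_map T T k (\<lambda>e. e \<triangleleft>\<^bsub>iter_dual E T k\<^esub> b) \<phi>"
  "\<phi> \<triangleleft>\<^bsub>iter_dual E T (Suc k)\<^esub> b = dual_map T T k (\<lambda>e. b \<triangleright>\<^bsub>iter_dual E T k\<^esub> e) \<phi>"
  by (simp_all add: dual_map_def)

lemma normed_bimodule_banach_module:
  assumes "banach_module B E" shows "normed_bimodule B E"
proof -
  interpret banach_module B E by fact
  obtain K where K: "\<forall>b\<in>carrier B. \<forall>e\<in>carrier E.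
      \<parallel>b \<triangleright>\<^bsub>E\<^esub> e\<parallel>\<^bsub>E\<^esub> \<le> K * \<parallel>b\<parallel>\<^bsub>B\<^esub> * \<parallel>e\<parallel>\<^bsub>E\<^esub> \<and> \<parallel>e \<triangleleft>\<^bsub>E\<^esub> b\<parallel>\<^bsub>E\<^esub> \<le> K * \<parallel>b\<parallel>\<^bsub>B\<^esub> * \<parallel>e\<parallel>\<^bsub>E\<^esub>"
    using act_bounded by blast
  have bound: "\<parallel>b \<triangleright>\<^bsub>E\<^esub> e\<parallel>\<^bsub>E\<^esub> \<le> \<bar>K\<bar> * \<parallel>b\<parallel>\<^bsub>B\<^esub> * \<parallel>e\<parallel>\<^bsub>E\<^esub>" "\<parallel>e \<triangleleft>\<^bsub>E\<^esub> b\<parallel>\<^bsub>E\<^esub> \<le> \<bar>K\<bar> * \<parallel>b\<parallel>\<^bsub>B\<^esub> * \<parallel>e\<parallel>\<^bsub>E\<^esub>"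
    if "b \<in> carrier B" "e \<in> carrier E" for b e
  proof -
    have "K * \<parallel>b\<parallel>\<^bsub>B\<^esub> * \<parallel>e\<parallel>\<^bsub>E\<^esub> \<le> \<bar>K\<bar> * \<parallel>b\<parallel>\<^bsub>B\<^esub> * \<parallel>e\<parallel>\<^bsub>E\<^esub>"
      using that by (intro mult_right_mono) (simp_all add: B.nrm_nonneg E.nrm_nonneg)
    then show "\<parallel>b \<triangleright>\<^bsub>E\<^esub> e\<parallel>\<^bsub>E\<^esub> \<le> \<bar>K\<bar> * \<parallel>b\<parallel>\<^bsub>B\<^esub> * \<parallel>e\<parallel>\<^bsub>E\<^esub>" "\<parallel>e \<triangleleft>\<^bsub>E\<^esub> b\<parallel>\<^bsub>E\<^esub> \<le> \<bar>K\<bar> * \<parallel>b\<parallel>\<^bsub>B\<^esub> * \<parallel>e\<parallel>\<^bsub>E\<^esub>"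
      using K that order_trans by blast+
  qed
  show ?thesis
  proof unfold_locales
    fix b assume b: "b \<in> carrier B"
    show "bounded_linear_map E E (\<lambda>e. b \<triangleright>\<^bsub>E\<^esub> e)"
      by (rule bounded_linear_mapI [of _ _ _ "\<bar>K\<bar> * \<parallel>b\<parallel>\<^bsub>B\<^esub>"])
        (simp_all add: b bound lact_closed lact_add_r lact_smult_r)
    show "bounded_linear_map E E (\<lambda>e. e \<triangleleft>\<^bsub>E\<^esub> b)"
      by (rule bounded_linear_mapI [of _ _ _ "\<bar>K\<bar> * \<parallel>b\<parallel>\<^bsub>B\<^esub>"])
        (simp_all add: b bound ract_closed ract_add_l ract_smult_l)
  next
    fix e assume e: "e \<in> carrier E"
    show "bounded_linear_map B E (\<lambda>b. b \<triangleright>\<^bsub>E\<^esub> e)"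
      by (rule bounded_linear_mapI [of _ _ _ "\<bar>K\<bar> * \<parallel>e\<parallel>\<^bsub>E\<^esub>"])
        (use bound(1) in \<open>simp_all add: e lact_closed lact_add_l lact_smult_l mult_ac\<close>)
    show "bounded_linear_map B E (\<lambda>b. e \<triangleleft>\<^bsub>E\<^esub> b)"
      by (rule bounded_linear_mapI [of _ _ _ "\<bar>K\<bar> * \<parallel>e\<parallel>\<^bsub>E\<^esub>"])
        (use bound(2) in \<open>simp_all add: e ract_closed ract_add_r ract_smult_r mult_ac\<close>)
  next
    show "\<exists>K\<ge>0. \<forall>b\<in>carrier B. \<forall>e\<in>carrier E.
        \<parallel>b \<triangleright>\<^bsub>E\<^esub> e\<parallel>\<^bsub>E\<^esub> \<le> K * \<parallel>b\<parallel>\<^bsub>B\<^esub> * \<parallel>e\<parallel>\<^bsub>E\<^esub> \<and> \<parallel>e \<triangleleft>\<^bsub>E\<^esub> b\<parallel>\<^bsub>E\<^esub> \<le> K * \<parallel>b\<parallel>\<^bsub>B\<^esub> * \<parallel>e\<parallel>\<^bsub>E\<^esub>"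
      using bound by (intro exI [of _ "\<bar>K\<bar>"]) simp
  qed (simp_all add: B.mult_closed lact_assoc ract_assoc act_assoc)
qed

text \<open>Stated in terms of the algebra identities and the norm inequality, so that it serves the
  amalgam, where these are verified directly, as well as \<open>A\<close> and
  \<open>X\<close>.\<close>

lemma normed_bimodule_self_module:
  assumes B: "normed_space B"
    and closed: "\<And>b c. \<lbrakk>b \<in> carrier B; c \<in> carrier B\<rbrakk> \<Longrightarrow> b \<otimes>\<^bsub>B\<^esub> c \<in> carrier B"
    and assoc: "\<And>b c d. \<lbrakk>b \<in> carrier B; c \<in> carrier B; d \<in> carrier B\<rbrakk> \<Longrightarrow> (b \<otimes>\<^bsub>B\<^esub> c) \<otimes>\<^bsub>B\<^esub> d = b \<otimes>\<^bsub>B\<^esub> (c \<otimes>\<^bsub>B\<^esub> d)"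
    and distr: "\<And>b c d. \<lbrakk>b \<in> carrier B; c \<in> carrier B; d \<in> carrier B\<rbrakk>
        \<Longrightarrow> (b \<oplus>\<^bsub>B\<^esub> c) \<otimes>\<^bsub>B\<^esub> d = b \<otimes>\<^bsub>B\<^esub> d \<oplus>\<^bsub>B\<^esub> c \<otimes>\<^bsub>B\<^esub> d"
      "\<And>b c d. \<lbrakk>b \<in> carrier B; c \<in> carrier B; d \<in> carrier B\<rbrakk>
        \<Longrightarrow> b \<otimes>\<^bsub>B\<^esub> (c \<oplus>\<^bsub>B\<^esub> d) = b \<otimes>\<^bsub>B\<^esub> c \<oplus>\<^bsub>B\<^esub> b \<otimes>\<^bsub>B\<^esub> d"
    and smult: "\<And>k b c. \<lbrakk>b \<in> carrier B; c \<in> carrier B\<rbrakk> \<Longrightarrow> (k \<odot>\<^bsub>B\<^esub> b) \<otimes>\<^bsub>B\<^esub> c = k \<odot>\<^bsub>B\<^esub> (b \<otimes>\<^bsub>B\<^esub> c)"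
      "\<And>k b c. \<lbrakk>b \<in> carrier B; c \<in> carrier B\<rbrakk> \<Longrightarrow> b \<otimes>\<^bsub>B\<^esub> (k \<odot>\<^bsub>B\<^esub> c) = k \<odot>\<^bsub>B\<^esub> (b \<otimes>\<^bsub>B\<^esub> c)"
    and nrm: "\<And>b c. \<lbrakk>b \<in> carrier B; c \<in> carrier B\<rbrakk> \<Longrightarrow> \<parallel>b \<otimes>\<^bsub>B\<^esub> c\<parallel>\<^bsub>B\<^esub> \<le> \<parallel>b\<parallel>\<^bsub>B\<^esub> * \<parallel>c\<parallel>\<^bsub>B\<^esub>"
  shows "normed_bimodule B (self_module B)"
proof -
  interpret B: normed_space B by fact
  interpret S: normed_space "self_module B"
    unfolding self_module_def by (rule normed_space_with_actions [OF B])
  have "bounded_linear_map B B (\<lambda>c. b \<otimes>\<^bsub>B\<^esub> c)" if "b \<in> carrier B" for b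
    by (rule bounded_linear_mapI [of _ _ _ "\<parallel>b\<parallel>\<^bsub>B\<^esub>"]) (simp_all add: that closed distr smult nrm)
  moreover have "bounded_linear_map B B (\<lambda>c. c \<otimes>\<^bsub>B\<^esub> b)" if "b \<in> carrier B" for b
    by (rule bounded_linear_mapI [of _ _ _ "\<parallel>b\<parallel>\<^bsub>B\<^esub>"])
      (simp_all add: that closed distr smult nrm mult.commute [of "\<parallel>b\<parallel>\<^bsub>B\<^esub>"])
  ultimately show ?thesis
  proof unfold_locales
    have "\<parallel>b \<otimes>\<^bsub>B\<^esub> c\<parallel>\<^bsub>B\<^esub> \<le> 1 * \<parallel>b\<parallel>\<^bsub>B\<^esub> * \<parallel>c\<parallel>\<^bsub>B\<^esub> \<and> \<parallel>c \<otimes>\<^bsub>B\<^esub> b\<parallel>\<^bsub>B\<^esub> \<le> 1 * \<parallel>b\<parallel>\<^bsub>B\<^esub> * \<parallel>c\<parallel>\<^bsub>B\<^esub>"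
      if "b \<in> carrier B" "c \<in> carrier B" for b c
      using nrm [OF that] nrm [OF that(2,1)] by (simp add: mult.commute [of "\<parallel>b\<parallel>\<^bsub>B\<^esub>"])
    then show "\<exists>K\<ge>0. \<forall>b\<in>carrier B. \<forall>e\<in>carrier (self_module B).
        \<parallel>b \<triangleright>\<^bsub>self_module B\<^esub> e\<parallel>\<^bsub>self_module B\<^esub> \<le> K * \<parallel>b\<parallel>\<^bsub>B\<^esub> * \<parallel>e\<parallel>\<^bsub>self_module B\<^esub> \<and>
        \<parallel>e \<triangleleft>\<^bsub>self_module B\<^esub> b\<parallel>\<^bsub>self_module B\<^esub> \<le> K * \<parallel>b\<parallel>\<^bsub>B\<^esub> * \<parallel>e\<parallel>\<^bsub>self_module B\<^esub>"
      by (intro exI [of _ 1]) (simp add: self_module_def)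
  qed (simp_all add: self_module_def closed assoc)
qed

lemma normed_bimodule_self_module_banach_algebra:
  assumes "banach_algebra B" shows "normed_bimodule B (self_module B)"
proof -
  interpret banach_algebra B by fact
  show ?thesis
    by (rule normed_bimodule_self_module [OF normed_space_axioms])
      (simp_all add: mult_closed mult_assoc mult_l_distr mult_r_distr mult_smult_l mult_smult_r nrm_mult)
qed

section \<open>The amalgam as a normed algebra\<close>

lemma amalgam_simps [simp]:
  "carrier (A \<bowtie> X) = carrier A \<times> carrier X"
  "(a, x) \<otimes>\<^bsub>A \<bowtie> X\<^esub> (b, y) = (a \<otimes>\<^bsub>A\<^esub> b, a \<triangleright>\<^bsub>X\<^esub> y \<oplus>\<^bsub>X\<^esub> x \<triangleleft>\<^bsub>X\<^esub> b \<oplus>\<^bsub>X\<^esub> x \<otimes>\<^bsub>X\<^esub> y)"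
  "\<zero>\<^bsub>A \<bowtie> X\<^esub> = (\<zero>\<^bsub>A\<^esub>, \<zero>\<^bsub>X\<^esub>)"
  "(a, x) \<oplus>\<^bsub>A \<bowtie> X\<^esub> (b, y) = (a \<oplus>\<^bsub>A\<^esub> b, x \<oplus>\<^bsub>X\<^esub> y)"
  "k \<odot>\<^bsub>A \<bowtie> X\<^esub> (a, x) = (k \<odot>\<^bsub>A\<^esub> a, k \<odot>\<^bsub>X\<^esub> x)"
  "\<parallel>(a, x)\<parallel>\<^bsub>A \<bowtie> X\<^esub> = \<parallel>a\<parallel>\<^bsub>A\<^esub> + \<parallel>x\<parallel>\<^bsub>X\<^esub>"
  by (simp_all add: amalgam_def)

lemma normed_space_amalgam:
  assumes "normed_space A" "normed_space X" shows "normed_space (A \<bowtie> X)"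
proof -
  interpret A: normed_space A by fact
  interpret X: normed_space X by fact
  note neg = A.smult_minus_one_add X.smult_minus_one_add
  show ?thesis
  \<comment> \<open>Case 7 is the additive inverse, 13 the definiteness of the norm, 14 the triangle
    inequality.\<close>
  proof (rule normed_spaceI, goal_cases)
    case (13 p)
    then show ?case
      by (auto simp: A.nrm_nonneg X.nrm_nonneg add_nonneg_eq_0_iff A.nrm_eq_0_iff X.nrm_eq_0_iff)
  next
    case (7 p)
    then show ?case by (auto simp: neg)
  next
    case (14 p q)
    then show ?case
      using A.nrm_triangle [of "fst p" "fst q"] X.nrm_triangle [of "snd p" "snd q"] by auto
  qed (use A.smult_l_distr A.smult_assoc1 A.smult_one X.smult_l_distr X.smult_assoc1 X.smult_one in
      \<open>auto simp: A.a_ac X.a_ac A.smult_r_distr X.smult_r_distr A.nrm_nonneg X.nrm_nonneg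
        A.nrm_smult X.nrm_smult distrib_left\<close>)
qed

section \<open>Duals of direct sums\<close>

text \<open>Together with the bimodule axioms, the identities of an algebraic module are the
  associativity laws for products with factors from both \<open>A\<close> and \<open>X\<close>. The
  norm is submultiplicative because both actions are contractive: the four estimates are the four
  terms of the product of two l^1 norms.\<close>

lemma normed_bimodule_amalgam:
  assumes "algebraic_banach_module A X"
  shows "normed_bimodule (A \<bowtie> X) (self_module (A \<bowtie> X))"
proof -
  interpret algebraic_banach_module A X by fact
  note cl = B.mult_closed X.mult_closed lact_closed ract_closed
  show ?thesis
  proof (rule normed_bimodule_self_module, goal_cases)
    case 1
    show ?case by (rule normed_space_amalgam) (rule B.normed_space_axioms E.normed_space_axioms)+
  next
    case (3 b c d)
    then show ?case
      by (auto simp: cl B.mult_assoc X.mult_assoc E.a_ac lact_add_r ract_add_l X.mult_l_distr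
          X.mult_r_distr lact_assoc ract_assoc act_assoc lact_mult ract_mult ract_lact_mult)
  next
    case (8 b c)
    obtain a x where b: "b = (a, x)" "a \<in> carrier A" "x \<in> carrier X" using 8 by auto
    obtain a' x' where c: "c = (a', x')" "a' \<in> carrier A" "x' \<in> carrier X" using 8 by auto
    have "\<parallel>a \<triangleright>\<^bsub>X\<^esub> x' \<oplus>\<^bsub>X\<^esub> x \<triangleleft>\<^bsub>X\<^esub> a' \<oplus>\<^bsub>X\<^esub> x \<otimes>\<^bsub>X\<^esub> x'\<parallel>\<^bsub>X\<^esub>
        \<le> \<parallel>a \<triangleright>\<^bsub>X\<^esub> x'\<parallel>\<^bsub>X\<^esub> + \<parallel>x \<triangleleft>\<^bsub>X\<^esub> a'\<parallel>\<^bsub>X\<^esub> + \<parallel>x \<otimes>\<^bsub>X\<^esub> x'\<parallel>\<^bsub>X\<^esub>"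
      using E.nrm_triangle [of "a \<triangleright>\<^bsub>X\<^esub> x' \<oplus>\<^bsub>X\<^esub> x \<triangleleft>\<^bsub>X\<^esub> a'" "x \<otimes>\<^bsub>X\<^esub> x'"]
        E.nrm_triangle [of "a \<triangleright>\<^bsub>X\<^esub> x'" "x \<triangleleft>\<^bsub>X\<^esub> a'"] b c by (simp add: cl)
    also have "\<dots> \<le> \<parallel>a\<parallel>\<^bsub>A\<^esub> * \<parallel>x'\<parallel>\<^bsub>X\<^esub> + \<parallel>x\<parallel>\<^bsub>X\<^esub> * \<parallel>a'\<parallel>\<^bsub>A\<^esub> + \<parallel>x\<parallel>\<^bsub>X\<^esub> * \<parallel>x'\<parallel>\<^bsub>X\<^esub>"
      using nrm_lact [of a x'] nrm_ract [of a' x] X.nrm_mult [of x x'] b c by (simp add: mult.commute)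
    finally show ?case
      using B.nrm_mult [of a a'] b c by (simp add: distrib_left distrib_right)
  next
    case (4 b c d)
    then show ?case
      by (auto simp: cl E.a_ac B.mult_l_distr X.mult_l_distr lact_add_l ract_add_l)
  next
    case (5 b c d)
    then show ?case
      by (auto simp: cl E.a_ac B.mult_r_distr X.mult_r_distr lact_add_r ract_add_r)
  next
    case (6 k b c)
    then show ?case
      by (auto simp: cl B.mult_smult_l X.mult_smult_l lact_smult_l ract_smult_l E.smult_r_distr)
  next
    case (7 k b c)
    then show ?case
      by (auto simp: cl B.mult_smult_r X.mult_smult_r lact_smult_r ract_smult_r E.smult_r_distr)
  qed (auto simp: cl)
qed


section \<open>Direct sums given by projections and injections\<close>

lemma dual_map_cong:
  "(\<And>e. e \<in> carrier (level S k) \<Longrightarrow> f e = g e) \<Longrightarrow> dual_map S T k f \<phi> = dual_map S T k g \<phi>"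
  by (simp add: dual_map_def functional_def)

lemma (in two_duals) dual_map_add:
  assumes f: "bounded_linear_map (level S k) (level T k) f"
    and g: "bounded_linear_map (level S k) (level T k) g"
    and \<phi>: "\<phi> \<in> carrier (level T (Suc k))"
  shows "dual_map S T k (\<lambda>e. f e \<oplus>\<^bsub>level T k\<^esub> g e) \<phi>
    = dual_map S T k f \<phi> \<oplus>\<^bsub>level S (Suc k)\<^esub> dual_map S T k g \<phi>"
proof -
  interpret S': normed_space "level S (Suc k)" by (rule is_dualD [OF S(2)])
  note fg = bounded_linear_map_add [OF S(1) T(1) f g]
  show ?thesis
    by (rule is_dual_ext [OF S(2)])
      (simp_all add: \<phi> dual_map_closed [OF fg] dual_map_closed [OF f] dual_map_closed [OF g]
        pairing_dual_map [OF fg] pairing_dual_map [OF f] pairing_dual_map [OF g]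
        bounded_linear_mapD [OF f] bounded_linear_mapD [OF g] is_dualD(4) [OF S(2)]
        is_dualD(2) [OF T(2), THEN bounded_linear_mapD(2)])
qed

lemma normed_space_scalars: "normed_space scalars"
  by (rule normed_spaceI) (simp_all add: algebra_simps norm_triangle_ineq norm_mult)

text \<open>A direct sum expressed by equations between bounded maps, since adjoints preserve such
  equations. The norm of \<open>W\<close> is tied to those of \<open>U\<close> and \<open>V\<close>
  by boundedness alone, so one need not follow the l^1 norm through its alternation with the maximum
  norm on successive duals.\<close>

locale biproduct = U: normed_space U + V: normed_space V + W: normed_space W
  for U :: "('k::real_normed_field, 'u, 'm) nspace_scheme"
    and V :: "('k, 'v, 'l) nspace_scheme"
    and W :: "('k, 'w, 'n) nspace_scheme" +
  fixes P :: "'w \<Rightarrow> 'u" and Q :: "'w \<Rightarrow> 'v" and I :: "'u \<Rightarrow> 'w" and J :: "'v \<Rightarrow> 'w"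
  assumes bounded: "bounded_linear_map W U P" "bounded_linear_map W V Q"
      "bounded_linear_map U W I" "bounded_linear_map V W J"
    and proj_inj: "u \<in> carrier U \<Longrightarrow> P (I u) = u" "u \<in> carrier U \<Longrightarrow> Q (I u) = \<zero>\<^bsub>V\<^esub>"
      "v \<in> carrier V \<Longrightarrow> P (J v) = \<zero>\<^bsub>U\<^esub>" "v \<in> carrier V \<Longrightarrow> Q (J v) = v"
    and decompose: "w \<in> carrier W \<Longrightarrow> I (P w) \<oplus>\<^bsub>W\<^esub> J (Q w) = w"
begin

lemmas P = bounded_linear_mapD [OF bounded(1)]
lemmas Q = bounded_linear_mapD [OF bounded(2)]
lemmas I = bounded_linear_mapD [OF bounded(3)]
lemmas J = bounded_linear_mapD [OF bounded(4)]

text \<open>On the first dual a triangular operator has the opposite shape; with the summands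
  exchanged it has again the shape that \<open>dual_triangular\<close> requires.\<close>

lemma swap: "biproduct V U W Q P J I"
  by unfold_locales (simp_all add: bounded proj_inj decompose P Q I J W.a_comm)

end

locale dual_biproduct = biproduct "level U k" "level V k" "level W k" P Q I J
  for U :: "('k::real_normed_field, 'e, 'u) dual_tower"
    and V :: "('k, 'f, 'v) dual_tower"
    and W :: "('k, 'g, 'w) dual_tower"
    and k P Q I J +
  assumes dual: "is_dual (level U k) (level U (Suc k)) (pairing U k)"
    "is_dual (level V k) (level V (Suc k)) (pairing V k)"
    "is_dual (level W k) (level W (Suc k)) (pairing W k)"
begin

sublocale UU: two_duals U U k using dual by unfold_locales
sublocale UV: two_duals U V k using dual by unfold_locales
sublocale UW: two_duals U W k using dual by unfold_locales
sublocale VU: two_duals V U k using dual by unfold_locales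
sublocale VV: two_duals V V k using dual by unfold_locales
sublocale VW: two_duals V W k using dual by unfold_locales
sublocale WU: two_duals W U k using dual by unfold_locales
sublocale WV: two_duals W V k using dual by unfold_locales
sublocale WW: two_duals W W k using dual by unfold_locales

sublocale U': normed_space "level U (Suc k)" by (rule is_dualD [OF dual(1)])
sublocale V': normed_space "level V (Suc k)" by (rule is_dualD [OF dual(2)])
sublocale W': normed_space "level W (Suc k)" by (rule is_dualD [OF dual(3)])

lemma dual_swap: "dual_biproduct V U W k Q P J I"
  by (intro dual_biproduct.intro swap dual_biproduct_axioms.intro dual)

lemmas dual_closed = UW.dual_map_closed [OF bounded(3)] VW.dual_map_closed [OF bounded(4)]
  WU.dual_map_closed [OF bounded(1)] WV.dual_map_closed [OF bounded(2)]

lemmas dual_pairing = UW.pairing_dual_map [OF bounded(3)] VW.pairing_dual_map [OF bounded(4)]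
  WU.pairing_dual_map [OF bounded(1)] WV.pairing_dual_map [OF bounded(2)]

lemmas pairing_add =
  is_dualD(2) [OF dual(1), THEN bounded_linear_mapD(2)] is_dualD(4) [OF dual(1)]
  is_dualD(2) [OF dual(2), THEN bounded_linear_mapD(2)] is_dualD(4) [OF dual(2)]
  is_dualD(2) [OF dual(3), THEN bounded_linear_mapD(2)] is_dualD(4) [OF dual(3)]

lemmas pairing_zero = is_dual_zero [OF dual(1)] is_dual_zero [OF dual(2)] is_dual_zero [OF dual(3)]
  bounded_linear_map_zero [OF U.normed_space_axioms normed_space_scalars is_dualD(2) [OF dual(1)], simplified]
  bounded_linear_map_zero [OF V.normed_space_axioms normed_space_scalars is_dualD(2) [OF dual(2)], simplified]
  bounded_linear_map_zero [OF W.normed_space_axioms normed_space_scalars is_dualD(2) [OF dual(3)], simplified]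

text \<open>This is \<phi> evaluated on the decomposition of \<open>w\<close>; the adjoints of
  \<open>I\<close> and \<open>J\<close> restrict \<phi> to the summands.\<close>

lemma pairing_decompose:
  assumes "\<phi> \<in> carrier (level W (Suc k))" "w \<in> carrier (level W k)"
  shows "pairing W k \<phi> w = pairing U k (dual_map U W k I \<phi>) (P w) + pairing V k (dual_map V W k J \<phi>) (Q w)"
  using decompose [OF assms(2)] pairing_add(5) [OF assms(1), of "I (P w)" "J (Q w)"] assms
  by (simp add: dual_pairing P Q I J)

text \<open>The decomposition identity of the dual is \<open>pairing_decompose\<close>; the
  relations between its projections and injections are the adjoints of the given ones, read
  backwards.\<close>

sublocale dual: biproduct "level U (Suc k)" "level V (Suc k)" "level W (Suc k)"
  "dual_map U W k I" "dual_map V W k J" "dual_map W U k P" "dual_map W V k Q"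
proof unfold_locales
  fix \<phi> assume "\<phi> \<in> carrier (level U (Suc k))"
  then show "dual_map U W k I (dual_map W U k P \<phi>) = \<phi>"
    and "dual_map V W k J (dual_map W U k P \<phi>) = \<zero>\<^bsub>level V (Suc k)\<^esub>"
    by - (rule is_dual_ext [OF dual(1)] is_dual_ext [OF dual(2)];
        simp add: dual_closed dual_pairing P Q I J proj_inj pairing_zero)+
next
  fix \<phi> assume "\<phi> \<in> carrier (level V (Suc k))"
  then show "dual_map U W k I (dual_map W V k Q \<phi>) = \<zero>\<^bsub>level U (Suc k)\<^esub>"
    and "dual_map V W k J (dual_map W V k Q \<phi>) = \<phi>"
    by - (rule is_dual_ext [OF dual(1)] is_dual_ext [OF dual(2)];
        simp add: dual_closed dual_pairing P Q I J proj_inj pairing_zero)+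
next
  fix \<phi> assume \<phi>: "\<phi> \<in> carrier (level W (Suc k))"
  show "dual_map W U k P (dual_map U W k I \<phi>) \<oplus>\<^bsub>level W (Suc k)\<^esub> dual_map W V k Q (dual_map V W k J \<phi>) = \<phi>"
    by (rule is_dual_ext [OF dual(3)])
      (simp_all add: \<phi> dual_closed dual_pairing(3,4) P Q pairing_add(6) pairing_decompose [OF \<phi>])
qed (rule UW.bounded_linear_map_dual_map VW.bounded_linear_map_dual_map
    WU.bounded_linear_map_dual_map WV.bounded_linear_map_dual_map bounded)+

text \<open>\<open>T\<close> acts on (P w, Q w) as the matrix with diagonal \<alpha>, \<beta> and
  with \<xi> below it. Testing \<phi> on \<open>T (I u)\<close> and \<open>T (J v)\<close> reads off
  the transposed matrix: \<xi> contributes only to the first, because \<open>P (J v)\<close> is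
  zero.\<close>

lemma dual_triangular:
  assumes T: "bounded_linear_map (level W k) (level W k) T"
    and \<alpha>: "bounded_linear_map (level U k) (level U k) \<alpha>"
    and \<beta>: "bounded_linear_map (level V k) (level V k) \<beta>"
    and \<xi>: "bounded_linear_map (level U k) (level V k) \<xi>"
    and PT: "\<And>w. w \<in> carrier (level W k) \<Longrightarrow> P (T w) = \<alpha> (P w)"
    and QT: "\<And>w. w \<in> carrier (level W k) \<Longrightarrow> Q (T w) = \<xi> (P w) \<oplus>\<^bsub>level V k\<^esub> \<beta> (Q w)"
    and \<phi>: "\<phi> \<in> carrier (level W (Suc k))"
  shows "dual_map U W k I (dual_map W W k T \<phi>)
      = dual_map U U k \<alpha> (dual_map U W k I \<phi>) \<oplus>\<^bsub>level U (Suc k)\<^esub> dual_map U V k \<xi> (dual_map V W k J \<phi>)"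
    and "dual_map V W k J (dual_map W W k T \<phi>) = dual_map V V k \<beta> (dual_map V W k J \<phi>)"
proof -
  note cl = bounded_linear_mapD(1) [OF T] bounded_linear_mapD(1) [OF \<alpha>]
    bounded_linear_mapD(1) [OF \<beta>] bounded_linear_mapD(1) [OF \<xi>]
  note dm = WW.dual_map_closed [OF T] UU.dual_map_closed [OF \<alpha>] VV.dual_map_closed [OF \<beta>]
    UV.dual_map_closed [OF \<xi>] WW.pairing_dual_map [OF T] UU.pairing_dual_map [OF \<alpha>]
    VV.pairing_dual_map [OF \<beta>] UV.pairing_dual_map [OF \<xi>]
  have zero: "\<alpha> \<zero>\<^bsub>level U k\<^esub> = \<zero>\<^bsub>level U k\<^esub>" "\<beta> \<zero>\<^bsub>level V k\<^esub> = \<zero>\<^bsub>level V k\<^esub>" "\<xi> \<zero>\<^bsub>level U k\<^esub> = \<zero>\<^bsub>level V k\<^esub>"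
    using \<alpha> \<beta> \<xi> U.normed_space_axioms V.normed_space_axioms by (simp_all add: bounded_linear_map_zero)
  show "dual_map U W k I (dual_map W W k T \<phi>)
      = dual_map U U k \<alpha> (dual_map U W k I \<phi>) \<oplus>\<^bsub>level U (Suc k)\<^esub> dual_map U V k \<xi> (dual_map V W k J \<phi>)"
    by (rule is_dual_ext [OF dual(1)])
      (simp_all add: \<phi> dm cl dual_closed dual_pairing(1) [OF WW.dual_map_closed [OF T \<phi>]] I J P Q PT QT zero
        proj_inj pairing_decompose [OF \<phi>]
        pairing_add)
  show "dual_map V W k J (dual_map W W k T \<phi>) = dual_map V V k \<beta> (dual_map V W k J \<phi>)"
    by (rule is_dual_ext [OF dual(2)])
      (simp_all add: \<phi> dm cl dual_closed dual_pairing(2) [OF WW.dual_map_closed [OF T \<phi>]] I J P Q PT QT zero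
        proj_inj pairing_decompose [OF \<phi>]
        pairing_zero)
qed

end

section \<open>The amalgam as a direct sum at level 0\<close>

lemma biproduct_amalgam:
  assumes "normed_space A" "normed_space X"
  shows "biproduct A X (A \<bowtie> X) fst snd (\<lambda>a. (a, \<zero>\<^bsub>X\<^esub>)) (\<lambda>x. (\<zero>\<^bsub>A\<^esub>, x))"
proof -
  interpret A: normed_space A by fact
  interpret X: normed_space X by fact
  interpret AX: normed_space "A \<bowtie> X" by (rule normed_space_amalgam [OF assms])
  show ?thesis
  proof unfold_locales
    show "bounded_linear_map (A \<bowtie> X) A fst" "bounded_linear_map (A \<bowtie> X) X snd"
      by (rule bounded_linear_mapI [of _ _ _ 1]; auto simp: A.nrm_nonneg X.nrm_nonneg)+
    show "bounded_linear_map A (A \<bowtie> X) (\<lambda>a. (a, \<zero>\<^bsub>X\<^esub>))" "bounded_linear_map X (A \<bowtie> X) (\<lambda>x. (\<zero>\<^bsub>A\<^esub>, x))"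
      by (rule bounded_linear_mapI [of _ _ _ 1]; simp add: A.nrm_zero X.nrm_zero)+
  qed auto
qed

text \<open>Serves the base of the induction over the levels, since level 0 is only isometric to the
  space itself.\<close>

lemma biproduct_isometric:
  assumes B: "biproduct U V W P Q I J"
    and N: "normed_space U'" "normed_space V'" "normed_space W'"
    and u: "isometric_iso U U' u" and v: "isometric_iso V V' v" and w: "isometric_iso W W' w"
  defines "u' \<equiv> inv_into (carrier U) u" and "v' \<equiv> inv_into (carrier V) v" and "w' \<equiv> inv_into (carrier W) w"
  shows "biproduct U' V' W' (\<lambda>z. u (P (w' z))) (\<lambda>z. v (Q (w' z))) (\<lambda>x. w (I (u' x))) (\<lambda>y. w (J (v' y)))"
proof -
  interpret biproduct U V W P Q I J by fact
  interpret U': normed_space U' by fact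
  interpret V': normed_space V' by fact
  interpret W': normed_space W' by fact
  note ns = U.normed_space_axioms V.normed_space_axioms W.normed_space_axioms
  note u' = isometric_iso_inverse [OF ns(1) u, folded u'_def]
  note v' = isometric_iso_inverse [OF ns(2) v, folded v'_def]
  note w' = isometric_iso_inverse [OF ns(3) w, folded w'_def]
  have lin: "bounded_linear_map U U' u" "bounded_linear_map V V' v" "bounded_linear_map W W' w"
    using u v w by (auto simp: isometric_iso_def)
  note cl = bounded_linear_mapD(1) [OF u'(1)] bounded_linear_mapD(1) [OF v'(1)] bounded_linear_mapD(1) [OF w'(1)]
    lin [THEN bounded_linear_mapD(1)]
  note zero = bounded_linear_map_zero [OF ns(1) N(1) lin(1)] bounded_linear_map_zero [OF ns(2) N(2) lin(2)]
  show ?thesis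
  proof unfold_locales
    show "bounded_linear_map W' U' (\<lambda>z. u (P (w' z)))"
      by (intro bounded_linear_map_compose [OF N(3) ns(3) w'(1)] bounded_linear_map_compose [OF ns(3) ns(1) bounded(1)] lin)
    show "bounded_linear_map W' V' (\<lambda>z. v (Q (w' z)))"
      by (intro bounded_linear_map_compose [OF N(3) ns(3) w'(1)] bounded_linear_map_compose [OF ns(3) ns(2) bounded(2)] lin)
    show "bounded_linear_map U' W' (\<lambda>x. w (I (u' x)))"
      by (intro bounded_linear_map_compose [OF N(1) ns(1) u'(1)] bounded_linear_map_compose [OF ns(1) ns(3) bounded(3)] lin)
    show "bounded_linear_map V' W' (\<lambda>y. w (J (v' y)))"
      by (intro bounded_linear_map_compose [OF N(2) ns(2) v'(1)] bounded_linear_map_compose [OF ns(2) ns(3) bounded(4)] lin)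
    fix z assume z: "z \<in> carrier W'"
    have "w (I (P (w' z))) \<oplus>\<^bsub>W'\<^esub> w (J (Q (w' z))) = w (I (P (w' z)) \<oplus>\<^bsub>W\<^esub> J (Q (w' z)))"
      using z by (simp add: bounded_linear_mapD(2) [OF lin(3)] cl I J P Q)
    then show "w (I (u' (u (P (w' z))))) \<oplus>\<^bsub>W'\<^esub> w (J (v' (v (Q (w' z))))) = z"
      using z by (simp add: u' v' w' cl P Q decompose)
  qed (simp_all add: u' v' w' cl P Q I J proj_inj zero)
qed

section \<open>Decomposition of the even duals of the amalgam\<close>

text \<open>\<open>dual_triangular\<close> is applied twice, the second time to the sum with its
  summands exchanged, because the first dual has put the off-diagonal entry above the
  diagonal.\<close>

lemma (in dual_biproduct) double_dual_triangular:
  assumes D: "dual_biproduct U V W (Suc k) (dual_map U W k I) (dual_map V W k J) (dual_map W U k P) (dual_map W V k Q)"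
    and T: "bounded_linear_map (level W k) (level W k) T"
    and \<alpha>: "bounded_linear_map (level U k) (level U k) \<alpha>"
    and \<beta>: "bounded_linear_map (level V k) (level V k) \<beta>"
    and \<xi>: "bounded_linear_map (level U k) (level V k) \<xi>"
    and PT: "\<And>w. w \<in> carrier (level W k) \<Longrightarrow> P (T w) = \<alpha> (P w)"
    and QT: "\<And>w. w \<in> carrier (level W k) \<Longrightarrow> Q (T w) = \<xi> (P w) \<oplus>\<^bsub>level V k\<^esub> \<beta> (Q w)"
    and \<phi>: "\<phi> \<in> carrier (level W (Suc (Suc k)))"
  defines "P' \<equiv> dual_map U W (Suc k) (dual_map W U k P)" and "Q' \<equiv> dual_map V W (Suc k) (dual_map W V k Q)"
  shows "P' (dual_map W W (Suc k) (dual_map W W k T) \<phi>) = dual_map U U (Suc k) (dual_map U U k \<alpha>) (P' \<phi>)"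
    and "Q' (dual_map W W (Suc k) (dual_map W W k T) \<phi>)
      = dual_map V U (Suc k) (dual_map U V k \<xi>) (P' \<phi>)
        \<oplus>\<^bsub>level V (Suc (Suc k))\<^esub> dual_map V V (Suc k) (dual_map V V k \<beta>) (Q' \<phi>)"
proof -
  interpret D: dual_biproduct U V W "Suc k" "dual_map U W k I" "dual_map V W k J"
    "dual_map W U k P" "dual_map W V k Q" by (rule D)
  interpret S: dual_biproduct V U W "Suc k" "dual_map V W k J" "dual_map U W k I"
    "dual_map W V k Q" "dual_map W U k P" by (rule D.dual_swap)
  note lin = WW.bounded_linear_map_dual_map [OF T] VV.bounded_linear_map_dual_map [OF \<beta>]
    UU.bounded_linear_map_dual_map [OF \<alpha>] UV.bounded_linear_map_dual_map [OF \<xi>]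
  note cl = bounded_linear_mapD(1) [OF lin(1)] bounded_linear_mapD(1) [OF lin(2)]
    bounded_linear_mapD(1) [OF lin(3)] bounded_linear_mapD(1) [OF lin(4)]
  note tri = dual_triangular [OF T \<alpha> \<beta> \<xi> PT QT]
  \<comment> \<open>The off-diagonal summand comes first, as \<open>dual_triangular\<close> expects
    it after the exchange.\<close>
  have tri1: "dual_map U W k I (dual_map W W k T w)
      = dual_map U V k \<xi> (dual_map V W k J w) \<oplus>\<^bsub>level U (Suc k)\<^esub> dual_map U U k \<alpha> (dual_map U W k I w)"
    if "w \<in> carrier (level W (Suc k))" for w
    using tri(1) [OF _ _ that] that by (simp add: U'.a_comm cl dual_closed)
  note second = S.dual_triangular [OF lin tri(2) tri1 \<phi>]
  show "P' (dual_map W W (Suc k) (dual_map W W k T) \<phi>) = dual_map U U (Suc k) (dual_map U U k \<alpha>) (P' \<phi>)"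
    unfolding P'_def by (rule second(2))
  have "P' \<phi> \<in> carrier (level U (Suc (Suc k)))" "Q' \<phi> \<in> carrier (level V (Suc (Suc k)))"
    using \<phi> by (simp_all add: P'_def Q'_def D.dual_closed)
  then show "Q' (dual_map W W (Suc k) (dual_map W W k T) \<phi>)
      = dual_map V U (Suc k) (dual_map U V k \<xi>) (P' \<phi>)
        \<oplus>\<^bsub>level V (Suc (Suc k))\<^esub> dual_map V V (Suc k) (dual_map V V k \<beta>) (Q' \<phi>)"
    using second(1) unfolding P'_def Q'_def
    by (simp add: D.V'.a_comm D.VV.dual_map_closed [OF lin(2)] D.VU.dual_map_closed [OF lin(4)])
qed

section \<open>Actions and products as double adjoints\<close>

lemma self_module_simps [simp]:
  "carrier (self_module B) = carrier B" "add (self_module B) = add B"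
  "smult (self_module B) = smult B" "nrm (self_module B) = nrm B"
  "ring.zero (self_module B) = ring.zero B" "a_minus (self_module B) = a_minus B"
  "lact (self_module B) = monoid.mult B" "ract (self_module B) = monoid.mult B"
  by (simp_all add: self_module_def)

lemma is_dual_tower_self_module [simp]:
  "is_dual_tower (self_module B) T m \<longleftrightarrow> is_dual_tower B T m"
  by (simp add: is_dual_tower_def isometric_iso_def self_module_def)

lemma unemb_self_module [simp]: "unemb (self_module B) T = unemb B T"
  by (simp add: unemb_def)

text \<open>The local function \<open>gx\<close> is the adjoint of F \<mapsto> xF, and the outer
  functional is the adjoint of \<open>gx\<close>; likewise for \<open>xg\<close>. Thus the recursion
  produces exactly the entry that \<open>double_dual_triangular\<close> puts off the
  diagonal.\<close>

lemma prod_Suc: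
  "prod_xF A X U V (Suc k) x F = dual_map V U (Suc (2 * k)) (dual_map U V (2 * k) (prod_xF A X U V k x)) F"
  "prod_Fx A X U V (Suc k) F x = dual_map V U (Suc (2 * k)) (dual_map U V (2 * k) (\<lambda>F. prod_Fx A X U V k F x)) F"
  by (simp_all add: dual_map_def [abs_def])

text \<open>A left multiplication dualizes to a right one and then to a left one again, so two
  levels up it is the double adjoint of itself.\<close>

lemma iter_dual_Suc_Suc:
  "b \<triangleright>\<^bsub>iter_dual E T (Suc (Suc k))\<^esub> \<phi> = dual_map T T (Suc k) (dual_map T T k (\<lambda>e. b \<triangleright>\<^bsub>iter_dual E T k\<^esub> e)) \<phi>"
  "\<phi> \<triangleleft>\<^bsub>iter_dual E T (Suc (Suc k))\<^esub> b = dual_map T T (Suc k) (dual_map T T k (\<lambda>e. e \<triangleleft>\<^bsub>iter_dual E T k\<^esub> b)) \<phi>"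
  unfolding iter_dual_Suc by simp_all

text \<open>Serves the diagonal entry on X^(2k), which is the sum of the actions of \<open>a\<close>
  and of \<open>x\<close>.\<close>

lemma double_dual_map_add:
  assumes D: "two_duals T T k" and D': "two_duals T T (Suc k)"
    and f: "bounded_linear_map (level T k) (level T k) f"
    and g: "bounded_linear_map (level T k) (level T k) g"
    and \<phi>: "\<phi> \<in> carrier (level T (Suc (Suc k)))"
  shows "dual_map T T (Suc k) (dual_map T T k (\<lambda>e. f e \<oplus>\<^bsub>level T k\<^esub> g e)) \<phi>
    = dual_map T T (Suc k) (dual_map T T k f) \<phi>
      \<oplus>\<^bsub>level T (Suc (Suc k))\<^esub> dual_map T T (Suc k) (dual_map T T k g) \<phi>"
proof -
  interpret D: two_duals T T k by fact
  interpret D': two_duals T T "Suc k" by fact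
  have "dual_map T T (Suc k) (dual_map T T k (\<lambda>e. f e \<oplus>\<^bsub>level T k\<^esub> g e)) \<phi>
      = dual_map T T (Suc k) (\<lambda>e. dual_map T T k f e \<oplus>\<^bsub>level T (Suc k)\<^esub> dual_map T T k g e) \<phi>"
    by (rule dual_map_cong) (rule D.dual_map_add [OF f g])
  also have "\<dots> = dual_map T T (Suc k) (dual_map T T k f) \<phi>
      \<oplus>\<^bsub>level T (Suc (Suc k))\<^esub> dual_map T T (Suc k) (dual_map T T k g) \<phi>"
    by (rule D'.dual_map_add [OF D.bounded_linear_map_dual_map [OF f] D.bounded_linear_map_dual_map [OF g] \<phi>])
  finally show ?thesis .
qed

text \<open>\<open>N\<close> and \<open>N'\<close> stand for the same dual of \<open>X\<close>, once
  as a module over \<open>A\<close> and once over \<open>X\<close>, because a bimodule record holds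
  one pair of actions. The action formulas are those for pairs (F, G), bracketed as off-diagonal
  entry plus diagonal entry.\<close>

locale amalgam_decomposition = biproduct
  where U = M and V = N and W = Z
  for M :: "('k::real_normed_field, 'a, 'u) bimodule"
    and N :: "('k, 'a, 'v) bimodule"
    and Z :: "('k, 'a \<times> 'x, 'w) bimodule" +
  fixes A :: "('k, 'a, 'm) nspace_scheme"
    and X :: "('k, 'x, 'l) nspace_scheme"
    and N' :: "('k, 'x, 'v) bimodule"
    and xF :: "'x \<Rightarrow> 'u \<Rightarrow> 'v" and Fx :: "'u \<Rightarrow> 'x \<Rightarrow> 'v"
  assumes products_linear: "x \<in> carrier X \<Longrightarrow> bounded_linear_map M N (xF x)"
      "x \<in> carrier X \<Longrightarrow> bounded_linear_map M N (\<lambda>F. Fx F x)"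
    and act_components: "\<lbrakk>a \<in> carrier A; x \<in> carrier X; w \<in> carrier Z\<rbrakk> \<Longrightarrow> P ((a, x) \<triangleright>\<^bsub>Z\<^esub> w) = a \<triangleright>\<^bsub>M\<^esub> P w"
      "\<lbrakk>a \<in> carrier A; x \<in> carrier X; w \<in> carrier Z\<rbrakk> \<Longrightarrow>
        Q ((a, x) \<triangleright>\<^bsub>Z\<^esub> w) = xF x (P w) \<oplus>\<^bsub>N\<^esub> (a \<triangleright>\<^bsub>N\<^esub> Q w \<oplus>\<^bsub>N\<^esub> x \<triangleright>\<^bsub>N'\<^esub> Q w)"
      "\<lbrakk>a \<in> carrier A; x \<in> carrier X; w \<in> carrier Z\<rbrakk> \<Longrightarrow> P (w \<triangleleft>\<^bsub>Z\<^esub> (a, x)) = P w \<triangleleft>\<^bsub>M\<^esub> a"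
      "\<lbrakk>a \<in> carrier A; x \<in> carrier X; w \<in> carrier Z\<rbrakk> \<Longrightarrow>
        Q (w \<triangleleft>\<^bsub>Z\<^esub> (a, x)) = Fx (P w) x \<oplus>\<^bsub>N\<^esub> (Q w \<triangleleft>\<^bsub>N\<^esub> a \<oplus>\<^bsub>N\<^esub> Q w \<triangleleft>\<^bsub>N'\<^esub> x)"

lemma biproduct_axioms_iter_dual [simp]:
  "biproduct_axioms (iter_dual E S k) (iter_dual F T k) (iter_dual G R k) P Q I J
    \<longleftrightarrow> biproduct_axioms (level S k) (level T k) (level R k) P Q I J"
  by (simp add: biproduct_axioms_def)

text \<open>The induction climbs two levels at a time, past the odd level with its opposite
  triangular shape. The four maps are existentially quantified because they change on the way: each
  step replaces them by their double adjoints.\<close>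

lemma ex_amalgam_decomposition:
  fixes A :: "('k::real_normed_field, 'a) nspace" and X :: "('k, 'a, 'x) bimodule"
  assumes X: "algebraic_banach_module A X"
    and U: "is_dual_tower A U m" and V: "is_dual_tower X V m" and W: "is_dual_tower (A \<bowtie> X) W m"
    and "2 * k \<le> m"
  shows "\<exists>P Q I J. amalgam_decomposition P Q I J (iter_dual (self_module A) U (2 * k)) (iter_dual X V (2 * k))
    (iter_dual (self_module (A \<bowtie> X)) W (2 * k)) A X (iter_dual (self_module X) V (2 * k))
    (prod_xF A X U V k) (prod_Fx A X U V k)"
  using \<open>2 * k \<le> m\<close>
proof (induction k)
  case 0
  interpret algebraic_banach_module A X by fact
  note A_ns = B.normed_space_axioms and X_ns = E.normed_space_axioms
  note AX_ns = normed_space_amalgam [OF A_ns X_ns]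
  note ns = is_dual_towerD(2) [OF U le0] is_dual_towerD(2) [OF V le0] is_dual_towerD(2) [OF W le0]
  note iso = is_dual_towerD(1) [OF U] is_dual_towerD(1) [OF V] is_dual_towerD(1) [OF W]
  note u = isometric_iso_inverse [OF A_ns iso(1), folded unemb_def]
  note v = isometric_iso_inverse [OF X_ns iso(2), folded unemb_def]
  note w = isometric_iso_inverse [OF AX_ns iso(3), folded unemb_def]
  have emb: "bounded_linear_map A (level U 0) (emb U)" "bounded_linear_map X (level V 0) (emb V)"
    "bounded_linear_map (A \<bowtie> X) (level W 0) (emb W)"
    using iso by (simp_all add: isometric_iso_def)
  note bip = biproduct_isometric [OF biproduct_amalgam [OF A_ns X_ns] ns iso, folded unemb_def]
  note cl = bounded_linear_mapD(1) [OF u(1)] bounded_linear_mapD(1) [OF v(1)]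
    emb [THEN bounded_linear_mapD(1)] lact_closed ract_closed B.mult_closed X.mult_closed
  interpret L: normed_bimodule A X
    by (rule normed_bimodule_banach_module [OF banach_module_axioms])
  have wcl: "fst (unemb (A \<bowtie> X) W z) \<in> carrier A" "snd (unemb (A \<bowtie> X) W z) \<in> carrier X"
    if "z \<in> carrier (level W 0)" for z
    using bounded_linear_mapD(1) [OF w(1) that] by (simp_all add: mem_Times_iff)
  have act: "(a, x) \<otimes>\<^bsub>A \<bowtie> X\<^esub> p = (a \<otimes>\<^bsub>A\<^esub> fst p, a \<triangleright>\<^bsub>X\<^esub> snd p \<oplus>\<^bsub>X\<^esub> x \<triangleleft>\<^bsub>X\<^esub> fst p \<oplus>\<^bsub>X\<^esub> x \<otimes>\<^bsub>X\<^esub> snd p)"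
    "p \<otimes>\<^bsub>A \<bowtie> X\<^esub> (a, x) = (fst p \<otimes>\<^bsub>A\<^esub> a, fst p \<triangleright>\<^bsub>X\<^esub> x \<oplus>\<^bsub>X\<^esub> snd p \<triangleleft>\<^bsub>X\<^esub> a \<oplus>\<^bsub>X\<^esub> snd p \<otimes>\<^bsub>X\<^esub> x)" for a x p
    by (cases p; simp)+
  show ?case
  proof (intro exI amalgam_decomposition.intro amalgam_decomposition_axioms.intro)
    show "biproduct (iter_dual (self_module A) U (2 * 0)) (iter_dual X V (2 * 0)) (iter_dual (self_module (A \<bowtie> X)) W (2 * 0))
      (\<lambda>z. emb U (fst (unemb (A \<bowtie> X) W z))) (\<lambda>z. emb V (snd (unemb (A \<bowtie> X) W z)))
      (\<lambda>x. emb W (unemb A U x, \<zero>\<^bsub>X\<^esub>)) (\<lambda>y. emb W (\<zero>\<^bsub>A\<^esub>, unemb X V y))"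
      using bip ns unfolding biproduct_def biproduct_axioms_iter_dual
      by (simp add: normed_space_iter_dual del: iter_dual.simps)
  next
    fix x assume x: "x \<in> carrier X"
    have "bounded_linear_map (level U 0) (level V 0) (\<lambda>F. emb V (x \<triangleleft>\<^bsub>X\<^esub> unemb A U F))"
      by (intro bounded_linear_map_compose [OF ns(1) A_ns u(1)]
          bounded_linear_map_compose [OF A_ns X_ns L.orbit_linear(2) [OF x]] emb)
    then show "bounded_linear_map (iter_dual (self_module A) U (2 * 0)) (iter_dual X V (2 * 0)) (prod_xF A X U V 0 x)"
      by (simp add: prod_xF.simps [abs_def])
    have "bounded_linear_map (level U 0) (level V 0) (\<lambda>F. emb V (unemb A U F \<triangleright>\<^bsub>X\<^esub> x))"
      by (intro bounded_linear_map_compose [OF ns(1) A_ns u(1)]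
          bounded_linear_map_compose [OF A_ns X_ns L.orbit_linear(1) [OF x]] emb)
    then show "bounded_linear_map (iter_dual (self_module A) U (2 * 0)) (iter_dual X V (2 * 0)) (\<lambda>F. prod_Fx A X U V 0 F x)"
      by simp
  next
    fix a x z assume "a \<in> carrier A" "x \<in> carrier X" "z \<in> carrier (iter_dual (self_module (A \<bowtie> X)) W (2 * 0))"
    then show "emb U (fst (unemb (A \<bowtie> X) W ((a, x) \<triangleright>\<^bsub>iter_dual (self_module (A \<bowtie> X)) W (2 * 0)\<^esub> z)))
        = a \<triangleright>\<^bsub>iter_dual (self_module A) U (2 * 0)\<^esub> emb U (fst (unemb (A \<bowtie> X) W z))"
      and "emb U (fst (unemb (A \<bowtie> X) W (z \<triangleleft>\<^bsub>iter_dual (self_module (A \<bowtie> X)) W (2 * 0)\<^esub> (a, x))))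
        = emb U (fst (unemb (A \<bowtie> X) W z)) \<triangleleft>\<^bsub>iter_dual (self_module A) U (2 * 0)\<^esub> a"
      and "emb V (snd (unemb (A \<bowtie> X) W ((a, x) \<triangleright>\<^bsub>iter_dual (self_module (A \<bowtie> X)) W (2 * 0)\<^esub> z)))
        = prod_xF A X U V 0 x (emb U (fst (unemb (A \<bowtie> X) W z))) \<oplus>\<^bsub>iter_dual X V (2 * 0)\<^esub>
          (a \<triangleright>\<^bsub>iter_dual X V (2 * 0)\<^esub> emb V (snd (unemb (A \<bowtie> X) W z)) \<oplus>\<^bsub>iter_dual X V (2 * 0)\<^esub>
           x \<triangleright>\<^bsub>iter_dual (self_module X) V (2 * 0)\<^esub> emb V (snd (unemb (A \<bowtie> X) W z)))"
      and "emb V (snd (unemb (A \<bowtie> X) W (z \<triangleleft>\<^bsub>iter_dual (self_module (A \<bowtie> X)) W (2 * 0)\<^esub> (a, x))))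
        = prod_Fx A X U V 0 (emb U (fst (unemb (A \<bowtie> X) W z))) x \<oplus>\<^bsub>iter_dual X V (2 * 0)\<^esub>
          (emb V (snd (unemb (A \<bowtie> X) W z)) \<triangleleft>\<^bsub>iter_dual X V (2 * 0)\<^esub> a \<oplus>\<^bsub>iter_dual X V (2 * 0)\<^esub>
           emb V (snd (unemb (A \<bowtie> X) W z)) \<triangleleft>\<^bsub>iter_dual (self_module X) V (2 * 0)\<^esub> x)"
      by (simp_all add: act u v w cl wcl E.a_ac bounded_linear_mapD(2) [OF emb(2), symmetric])
  qed
next
  case (Suc k)
  then obtain P Q I J where IH: "amalgam_decomposition P Q I J
      (iter_dual (self_module A) U (2 * k)) (iter_dual X V (2 * k))
      (iter_dual (self_module (A \<bowtie> X)) W (2 * k)) A X (iter_dual (self_module X) V (2 * k))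
      (prod_xF A X U V k) (prod_Fx A X U V k)"
    by auto
  interpret algebraic_banach_module A X by fact
  interpret IH: amalgam_decomposition P Q I J
      "iter_dual (self_module A) U (2 * k)" "iter_dual X V (2 * k)"
      "iter_dual (self_module (A \<bowtie> X)) W (2 * k)" A X "iter_dual (self_module X) V (2 * k)"
      "prod_xF A X U V k" "prod_Fx A X U V k" by (rule IH)
  have m: "2 * k \<le> m" "Suc (2 * k) \<le> m" "2 * k < m" "Suc (2 * k) < m" using Suc.prems by auto
  interpret D: dual_biproduct U V W "2 * k" P Q I J
    using is_dual_towerD(2,3) [OF U] is_dual_towerD(2,3) [OF V] is_dual_towerD(2,3) [OF W] m IH.biproduct_axioms
    by (simp add: dual_biproduct_def dual_biproduct_axioms_def biproduct_def)
  interpret D2: dual_biproduct U V W "Suc (2 * k)" "dual_map U W (2 * k) I" "dual_map V W (2 * k) J"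
    "dual_map W U (2 * k) P" "dual_map W V (2 * k) Q"
    using is_dual_towerD(3) [OF U] is_dual_towerD(3) [OF V] is_dual_towerD(3) [OF W] m D.dual.biproduct_axioms
    by (intro dual_biproduct.intro dual_biproduct_axioms.intro) auto
  interpret MA: normed_bimodule A "iter_dual (self_module A) U (2 * k)"
    using U m B.banach_algebra_axioms
    by (intro normed_bimodule_iter_dual [where m = m] normed_bimodule_self_module_banach_algebra) simp_all
  interpret MX: normed_bimodule A "iter_dual X V (2 * k)"
    using V m banach_module_axioms
    by (intro normed_bimodule_iter_dual [where m = m] normed_bimodule_banach_module)
  interpret MXX: normed_bimodule X "iter_dual (self_module X) V (2 * k)"
    using V m X.banach_algebra_axioms
    by (intro normed_bimodule_iter_dual [where m = m] normed_bimodule_self_module_banach_algebra) simp_all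
  interpret MW: normed_bimodule "A \<bowtie> X" "iter_dual (self_module (A \<bowtie> X)) W (2 * k)"
    using W m X by (intro normed_bimodule_iter_dual [where m = m] normed_bimodule_amalgam) simp_all
  have lin: "bounded_linear_map (level U (2 * k)) (level V (2 * k)) (prod_xF A X U V k x)"
    "bounded_linear_map (level U (2 * k)) (level V (2 * k)) (\<lambda>F. prod_Fx A X U V k F x)"
    if "x \<in> carrier X" for x
    using IH.products_linear [OF that] by simp_all
  define P' Q' where "P' = dual_map U W (Suc (2 * k)) (dual_map W U (2 * k) P)"
    and "Q' = dual_map V W (Suc (2 * k)) (dual_map W V (2 * k) Q)"
  note tri = D.double_dual_triangular [OF D2.dual_biproduct_axioms, folded P'_def Q'_def]
  have eq: "2 * Suc k = Suc (Suc (2 * k))" by simp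
  have comp: "P' ((a, x) \<triangleright>\<^bsub>iter_dual (self_module (A \<bowtie> X)) W (2 * Suc k)\<^esub> z)
        = a \<triangleright>\<^bsub>iter_dual (self_module A) U (2 * Suc k)\<^esub> P' z"
      "Q' ((a, x) \<triangleright>\<^bsub>iter_dual (self_module (A \<bowtie> X)) W (2 * Suc k)\<^esub> z)
        = prod_xF A X U V (Suc k) x (P' z) \<oplus>\<^bsub>iter_dual X V (2 * Suc k)\<^esub>
          (a \<triangleright>\<^bsub>iter_dual X V (2 * Suc k)\<^esub> Q' z \<oplus>\<^bsub>iter_dual X V (2 * Suc k)\<^esub>
           x \<triangleright>\<^bsub>iter_dual (self_module X) V (2 * Suc k)\<^esub> Q' z)"
      "P' (z \<triangleleft>\<^bsub>iter_dual (self_module (A \<bowtie> X)) W (2 * Suc k)\<^esub> (a, x))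
        = P' z \<triangleleft>\<^bsub>iter_dual (self_module A) U (2 * Suc k)\<^esub> a"
      "Q' (z \<triangleleft>\<^bsub>iter_dual (self_module (A \<bowtie> X)) W (2 * Suc k)\<^esub> (a, x))
        = prod_Fx A X U V (Suc k) (P' z) x \<oplus>\<^bsub>iter_dual X V (2 * Suc k)\<^esub>
          (Q' z \<triangleleft>\<^bsub>iter_dual X V (2 * Suc k)\<^esub> a \<oplus>\<^bsub>iter_dual X V (2 * Suc k)\<^esub>
           Q' z \<triangleleft>\<^bsub>iter_dual (self_module X) V (2 * Suc k)\<^esub> x)"
    if a: "a \<in> carrier A" and x: "x \<in> carrier X"
      and z': "z \<in> carrier (iter_dual (self_module (A \<bowtie> X)) W (2 * Suc k))" for a x z
  proof -
    have ax: "(a, x) \<in> carrier (A \<bowtie> X)" using a x by simp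
    have z: "z \<in> carrier (level W (Suc (Suc (2 * k))))" using z' by simp
    then have Qz: "Q' z \<in> carrier (level V (Suc (Suc (2 * k))))" by (simp add: Q'_def D2.dual_closed)
    note l = MA.lact_linear [OF a] MX.lact_linear [OF a] MXX.lact_linear [OF x] MW.lact_linear [OF ax]
    note r = MA.ract_linear [OF a] MX.ract_linear [OF a] MXX.ract_linear [OF x] MW.ract_linear [OF ax]
    note l = l [unfolded bounded_linear_map_iter_dual] and r = r [unfolded bounded_linear_map_iter_dual]
    note VV = D.V.normed_space_axioms
    note IHc = IH.act_components [OF a x, simplified]
    \<comment> \<open>The entries for a left factor (a, x): the action of \<open>a\<close> on
      A^(2k), the sum of the actions of \<open>a\<close> and \<open>x\<close> on X^(2k), and the
      product with \<open>x\<close> off the diagonal. \<open>tr\<close> is the same for right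
      factors.\<close>
    note tl = tri [OF l(4) l(1) bounded_linear_map_add [OF VV VV l(2) l(3)] lin(1) [OF x] IHc(1,2) z]
    note tr = tri [OF r(4) r(1) bounded_linear_map_add [OF VV VV r(2) r(3)] lin(2) [OF x] IHc(3,4) z]
    note add = double_dual_map_add [OF D.VV.two_duals_axioms D2.VV.two_duals_axioms _ _ Qz]
    show "P' ((a, x) \<triangleright>\<^bsub>iter_dual (self_module (A \<bowtie> X)) W (2 * Suc k)\<^esub> z)
        = a \<triangleright>\<^bsub>iter_dual (self_module A) U (2 * Suc k)\<^esub> P' z"
      unfolding eq iter_dual_Suc_Suc by (rule tl(1))
    show "P' (z \<triangleleft>\<^bsub>iter_dual (self_module (A \<bowtie> X)) W (2 * Suc k)\<^esub> (a, x))
        = P' z \<triangleleft>\<^bsub>iter_dual (self_module A) U (2 * Suc k)\<^esub> a"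
      unfolding eq iter_dual_Suc_Suc by (rule tr(1))
    show "Q' ((a, x) \<triangleright>\<^bsub>iter_dual (self_module (A \<bowtie> X)) W (2 * Suc k)\<^esub> z)
        = prod_xF A X U V (Suc k) x (P' z) \<oplus>\<^bsub>iter_dual X V (2 * Suc k)\<^esub>
          (a \<triangleright>\<^bsub>iter_dual X V (2 * Suc k)\<^esub> Q' z \<oplus>\<^bsub>iter_dual X V (2 * Suc k)\<^esub>
           x \<triangleright>\<^bsub>iter_dual (self_module X) V (2 * Suc k)\<^esub> Q' z)"
      unfolding eq iter_dual_Suc_Suc iter_dual_simps prod_Suc add [OF l(2,3), symmetric] by (rule tl(2))
    show "Q' (z \<triangleleft>\<^bsub>iter_dual (self_module (A \<bowtie> X)) W (2 * Suc k)\<^esub> (a, x))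
        = prod_Fx A X U V (Suc k) (P' z) x \<oplus>\<^bsub>iter_dual X V (2 * Suc k)\<^esub>
          (Q' z \<triangleleft>\<^bsub>iter_dual X V (2 * Suc k)\<^esub> a \<oplus>\<^bsub>iter_dual X V (2 * Suc k)\<^esub>
           Q' z \<triangleleft>\<^bsub>iter_dual (self_module X) V (2 * Suc k)\<^esub> x)"
      unfolding eq iter_dual_Suc_Suc iter_dual_simps prod_Suc add [OF r(2,3), symmetric] by (rule tr(2))
  qed
  show ?case
  proof (intro exI amalgam_decomposition.intro amalgam_decomposition_axioms.intro; (rule comp; assumption)?)
    show "biproduct (iter_dual (self_module A) U (2 * Suc k)) (iter_dual X V (2 * Suc k))
      (iter_dual (self_module (A \<bowtie> X)) W (2 * Suc k)) P' Q'
      (dual_map W U (Suc (2 * k)) (dual_map U W (2 * k) I)) (dual_map W V (Suc (2 * k)) (dual_map V W (2 * k) J))"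
      using D2.dual.biproduct_axioms
      unfolding eq P'_def Q'_def biproduct_def biproduct_axioms_iter_dual
      by (simp add: normed_space_iter_dual del: iter_dual.simps)
    fix x assume x: "x \<in> carrier X"
    show "bounded_linear_map (iter_dual (self_module A) U (2 * Suc k)) (iter_dual X V (2 * Suc k))
        (prod_xF A X U V (Suc k) x)"
      "bounded_linear_map (iter_dual (self_module A) U (2 * Suc k)) (iter_dual X V (2 * Suc k))
        (\<lambda>F. prod_Fx A X U V (Suc k) F x)"
      unfolding eq bounded_linear_map_iter_dual prod_Suc [abs_def]
      by (rule D2.VU.bounded_linear_map_dual_map D.UV.bounded_linear_map_dual_map lin x)+
  qed
qed

section \<open>Derivations of the amalgam\<close>

lemma (in normed_space) minus_self: "x \<in> carrier V \<Longrightarrow> x \<ominus> x = \<zero>"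
  by (simp add: a_minus_def r_neg)

lemma (in normed_space) minus_eq_iff:
  assumes "x \<in> carrier V" "y \<in> carrier V" "z \<in> carrier V"
  shows "x \<ominus> y = z \<longleftrightarrow> x = y \<oplus> z"
proof -
  have "y \<oplus> (x \<ominus> y) = x"
    using assms by (simp add: a_minus_def a_lcomm [of y x] r_neg)
  moreover have "(y \<oplus> z) \<ominus> y = z"
    using assms by (simp add: a_minus_def a_comm [of y z] a_assoc r_neg)
  ultimately show ?thesis by auto
qed

context normed_bimodule
begin

lemma act_zero [simp]:
  "b \<in> carrier B \<Longrightarrow> b \<triangleright>\<^bsub>E\<^esub> \<zero>\<^bsub>E\<^esub> = \<zero>\<^bsub>E\<^esub>" "b \<in> carrier B \<Longrightarrow> \<zero>\<^bsub>E\<^esub> \<triangleleft>\<^bsub>E\<^esub> b = \<zero>\<^bsub>E\<^esub>"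
  "e \<in> carrier E \<Longrightarrow> \<zero> \<triangleright>\<^bsub>E\<^esub> e = \<zero>\<^bsub>E\<^esub>" "e \<in> carrier E \<Longrightarrow> e \<triangleleft>\<^bsub>E\<^esub> \<zero> = \<zero>\<^bsub>E\<^esub>"
  using bounded_linear_map_zero [OF E.normed_space_axioms E.normed_space_axioms lact_linear]
    bounded_linear_map_zero [OF E.normed_space_axioms E.normed_space_axioms ract_linear]
    bounded_linear_map_zero [OF B.normed_space_axioms E.normed_space_axioms orbit_linear(1)]
    bounded_linear_map_zero [OF B.normed_space_axioms E.normed_space_axioms orbit_linear(2)]
  by auto

lemma inner_derivation_add:
  assumes "b \<in> carrier B" "e \<in> carrier E" "f \<in> carrier E"
  shows "inner_derivation E (e \<oplus>\<^bsub>E\<^esub> f) b = inner_derivation E e b \<oplus>\<^bsub>E\<^esub> inner_derivation E f b"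
  using assms unfolding inner_derivation_def
  by (simp add: E.add_diff_add bounded_linear_mapD(2) [OF lact_linear] bounded_linear_mapD(2) [OF ract_linear])

lemma derivation_zero: "derivation B E (\<lambda>_. \<zero>\<^bsub>E\<^esub>)"
  by (simp add: derivation_def bounded_linear_map_const_zero B.normed_space_axioms E.normed_space_axioms)

text \<open>Implementing elements add, so an inner derivation subtracted earlier can be
  restored.\<close>

lemma is_inner_if_diff:
  assumes D: "bounded_linear_map B E D" and w: "w \<in> carrier E"
    and inner: "is_inner B E (\<lambda>b. D b \<ominus>\<^bsub>E\<^esub> inner_derivation E w b)"
  shows "is_inner B E D"
proof -
  obtain v where v: "v \<in> carrier E"
    and Dv: "\<And>b. b \<in> carrier B \<Longrightarrow> D b \<ominus>\<^bsub>E\<^esub> inner_derivation E w b = inner_derivation E v b"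
    using inner by (auto simp: is_inner_def)
  have "D b = inner_derivation E (w \<oplus>\<^bsub>E\<^esub> v) b" if "b \<in> carrier B" for b
    using Dv [OF that] that v w bounded_linear_mapD(1) [OF D that]
    by (simp add: inner_derivation_add E.minus_eq_iff inner_derivation_closed)
  then show ?thesis using v w by (auto simp: is_inner_def)
qed

end

text \<open>\<open>N'_eq\<close> gives both modules the same carrier and additive operations, so
  that terms from the two actions can be added in \<open>N\<close>.\<close>

locale amalgam_bimodule = amalgam_decomposition P Q I J M N Z A X N' xF Fx +
  algebraic_banach_module A X +
  ZM: normed_bimodule "A \<bowtie> X" Z + MM: normed_bimodule A M + NN: normed_bimodule A N +
  XN: normed_bimodule X N'
  for P Q I J and M :: "('k::real_normed_field, 'a, 'u) bimodule"
    and N :: "('k, 'a, 'v) bimodule" and Z :: "('k, 'a \<times> 'x, 'w) bimodule"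
    and A :: "('k, 'a) nspace" and X :: "('k, 'a, 'x) bimodule"
    and N' :: "('k, 'x, 'v) bimodule" and xF Fx +
  assumes N'_eq: "carrier N' = carrier N" "add N' = add N" "a_minus N' = a_minus N" "ring.zero N' = ring.zero N"
begin

definition \<delta> :: "'u \<Rightarrow> 'x \<Rightarrow> 'v" where
  "\<delta> F x = xF x F \<ominus>\<^bsub>N\<^esub> Fx F x"

section \<open>Arithmetic in the decomposed module\<close>

lemma X_act_closed [simp]:
  "\<lbrakk>x \<in> carrier X; v \<in> carrier N\<rbrakk> \<Longrightarrow> x \<triangleright>\<^bsub>N'\<^esub> v \<in> carrier N"
  "\<lbrakk>x \<in> carrier X; v \<in> carrier N\<rbrakk> \<Longrightarrow> v \<triangleleft>\<^bsub>N'\<^esub> x \<in> carrier N"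
  using XN.act_closed [of x v] by (simp_all add: N'_eq)

lemma X_act_zero [simp]:
  "x \<in> carrier X \<Longrightarrow> x \<triangleright>\<^bsub>N'\<^esub> \<zero>\<^bsub>N\<^esub> = \<zero>\<^bsub>N\<^esub>" "x \<in> carrier X \<Longrightarrow> \<zero>\<^bsub>N\<^esub> \<triangleleft>\<^bsub>N'\<^esub> x = \<zero>\<^bsub>N\<^esub>"
  "v \<in> carrier N \<Longrightarrow> \<zero>\<^bsub>X\<^esub> \<triangleright>\<^bsub>N'\<^esub> v = \<zero>\<^bsub>N\<^esub>" "v \<in> carrier N \<Longrightarrow> v \<triangleleft>\<^bsub>N'\<^esub> \<zero>\<^bsub>X\<^esub> = \<zero>\<^bsub>N\<^esub>"
  using XN.act_zero(1,2) [of x] XN.act_zero(3,4) [of v] by (simp_all add: N'_eq)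

lemma products_closed [simp]:
  "\<lbrakk>x \<in> carrier X; F \<in> carrier M\<rbrakk> \<Longrightarrow> xF x F \<in> carrier N"
  "\<lbrakk>x \<in> carrier X; F \<in> carrier M\<rbrakk> \<Longrightarrow> Fx F x \<in> carrier N"
  using products_linear [THEN bounded_linear_mapD(1)] by auto

lemma products_add:
  "\<lbrakk>x \<in> carrier X; F \<in> carrier M; G \<in> carrier M\<rbrakk> \<Longrightarrow> xF x (F \<oplus>\<^bsub>M\<^esub> G) = xF x F \<oplus>\<^bsub>N\<^esub> xF x G"
  "\<lbrakk>x \<in> carrier X; F \<in> carrier M; G \<in> carrier M\<rbrakk> \<Longrightarrow> Fx (F \<oplus>\<^bsub>M\<^esub> G) x = Fx F x \<oplus>\<^bsub>N\<^esub> Fx G x"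
  using products_linear [THEN bounded_linear_mapD(2)] by auto

lemma products_zero [simp]:
  "x \<in> carrier X \<Longrightarrow> xF x \<zero>\<^bsub>M\<^esub> = \<zero>\<^bsub>N\<^esub>" "x \<in> carrier X \<Longrightarrow> Fx \<zero>\<^bsub>M\<^esub> x = \<zero>\<^bsub>N\<^esub>"
  using bounded_linear_map_zero [OF U.normed_space_axioms V.normed_space_axioms products_linear(1)]
    bounded_linear_map_zero [OF U.normed_space_axioms V.normed_space_axioms products_linear(2)]
  by auto

text \<open>The products are only known to be linear in \<open>F\<close>, so that they vanish at \<open>x = 0\<close> is read off the
  action of \<open>(0, 0)\<close> on \<open>Z\<close>.\<close>

lemma products_zero' [simp]:
  assumes "F \<in> carrier M" shows "xF \<zero>\<^bsub>X\<^esub> F = \<zero>\<^bsub>N\<^esub>" "Fx F \<zero>\<^bsub>X\<^esub> = \<zero>\<^bsub>N\<^esub>"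
proof -
  have "I F \<in> carrier Z" "(\<zero>\<^bsub>A\<^esub>, \<zero>\<^bsub>X\<^esub>) \<triangleright>\<^bsub>Z\<^esub> I F = \<zero>\<^bsub>Z\<^esub>" "I F \<triangleleft>\<^bsub>Z\<^esub> (\<zero>\<^bsub>A\<^esub>, \<zero>\<^bsub>X\<^esub>) = \<zero>\<^bsub>Z\<^esub>"
    using assms ZM.act_zero(3,4) [of "I F"] by (simp_all add: I)
  then have "Q \<zero>\<^bsub>Z\<^esub> = xF \<zero>\<^bsub>X\<^esub> F" "Q \<zero>\<^bsub>Z\<^esub> = Fx F \<zero>\<^bsub>X\<^esub>"
    using act_components(2,4) [of "\<zero>\<^bsub>A\<^esub>" "\<zero>\<^bsub>X\<^esub>" "I F"] assms
    by (simp_all add: proj_inj)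
  moreover have "Q \<zero>\<^bsub>Z\<^esub> = \<zero>\<^bsub>N\<^esub>"
    by (rule bounded_linear_map_zero [OF W.normed_space_axioms V.normed_space_axioms bounded(2)])
  ultimately show "xF \<zero>\<^bsub>X\<^esub> F = \<zero>\<^bsub>N\<^esub>" "Fx F \<zero>\<^bsub>X\<^esub> = \<zero>\<^bsub>N\<^esub>" by simp_all
qed

lemma amalgam_ext:
  assumes "w \<in> carrier Z" "z \<in> carrier Z" "P w = P z" "Q w = Q z"
  shows "w = z"
  by (metis assms decompose)

text \<open>\<open>I u \<oplus> J v\<close> stands for the pair (u, v).\<close>

lemma P_join: "\<lbrakk>u \<in> carrier M; v \<in> carrier N\<rbrakk> \<Longrightarrow> P (I u \<oplus>\<^bsub>Z\<^esub> J v) = u"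
  and Q_join: "\<lbrakk>u \<in> carrier M; v \<in> carrier N\<rbrakk> \<Longrightarrow> Q (I u \<oplus>\<^bsub>Z\<^esub> J v) = v"
  by (simp_all add: P Q I J proj_inj)

lemma X_zero [simp]:
  "x \<in> carrier X \<Longrightarrow> x \<otimes>\<^bsub>X\<^esub> \<zero>\<^bsub>X\<^esub> = \<zero>\<^bsub>X\<^esub>" "x \<in> carrier X \<Longrightarrow> \<zero>\<^bsub>X\<^esub> \<otimes>\<^bsub>X\<^esub> x = \<zero>\<^bsub>X\<^esub>"
  "a \<in> carrier A \<Longrightarrow> a \<otimes>\<^bsub>A\<^esub> \<zero>\<^bsub>A\<^esub> = \<zero>\<^bsub>A\<^esub>" "a \<in> carrier A \<Longrightarrow> \<zero>\<^bsub>A\<^esub> \<otimes>\<^bsub>A\<^esub> a = \<zero>\<^bsub>A\<^esub>"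
  "a \<in> carrier A \<Longrightarrow> a \<triangleright>\<^bsub>X\<^esub> \<zero>\<^bsub>X\<^esub> = \<zero>\<^bsub>X\<^esub>" "a \<in> carrier A \<Longrightarrow> \<zero>\<^bsub>X\<^esub> \<triangleleft>\<^bsub>X\<^esub> a = \<zero>\<^bsub>X\<^esub>"
  "x \<in> carrier X \<Longrightarrow> \<zero>\<^bsub>A\<^esub> \<triangleright>\<^bsub>X\<^esub> x = \<zero>\<^bsub>X\<^esub>" "x \<in> carrier X \<Longrightarrow> x \<triangleleft>\<^bsub>X\<^esub> \<zero>\<^bsub>A\<^esub> = \<zero>\<^bsub>X\<^esub>"
  using normed_bimodule.act_zero(1,2) [OF normed_bimodule_self_module_banach_algebra, OF X.banach_algebra_axioms, of x]
    normed_bimodule.act_zero(1,2) [OF normed_bimodule_self_module_banach_algebra, OF B.banach_algebra_axioms, of a]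
    normed_bimodule.act_zero [OF normed_bimodule_banach_module, OF banach_module_axioms]
  by simp_all

lemma X_closed [simp]:
  "\<lbrakk>x \<in> carrier X; y \<in> carrier X\<rbrakk> \<Longrightarrow> x \<otimes>\<^bsub>X\<^esub> y \<in> carrier X"
  "\<lbrakk>a \<in> carrier A; b \<in> carrier A\<rbrakk> \<Longrightarrow> a \<otimes>\<^bsub>A\<^esub> b \<in> carrier A"
  "\<lbrakk>a \<in> carrier A; x \<in> carrier X\<rbrakk> \<Longrightarrow> a \<triangleright>\<^bsub>X\<^esub> x \<in> carrier X"
  "\<lbrakk>a \<in> carrier A; x \<in> carrier X\<rbrakk> \<Longrightarrow> x \<triangleleft>\<^bsub>X\<^esub> a \<in> carrier X"
  by (simp_all add: X.mult_closed B.mult_closed lact_closed ract_closed)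

text \<open>A relation rather than four functions: equations on the carriers leave the entries free
  elsewhere, so an entry found to vanish can be replaced by the constant zero function.\<close>

definition components :: "('a \<times> 'x \<Rightarrow> 'w) \<Rightarrow> ('a \<Rightarrow> 'u) \<Rightarrow> ('a \<Rightarrow> 'v) \<Rightarrow> ('x \<Rightarrow> 'v) \<Rightarrow> ('x \<Rightarrow> 'u) \<Rightarrow> bool"
  where
  "components D D\<^sub>A D\<^sub>X T\<^sub>X T\<^sub>A \<longleftrightarrow>
    (\<forall>a\<in>carrier A. P (D (a, \<zero>\<^bsub>X\<^esub>)) = D\<^sub>A a \<and> Q (D (a, \<zero>\<^bsub>X\<^esub>)) = D\<^sub>X a) \<and>
    (\<forall>x\<in>carrier X. P (D (\<zero>\<^bsub>A\<^esub>, x)) = T\<^sub>A x \<and> Q (D (\<zero>\<^bsub>A\<^esub>, x)) = T\<^sub>X x)"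

definition compatible :: "('a \<Rightarrow> 'u) \<Rightarrow> ('a \<Rightarrow> 'v) \<Rightarrow> ('x \<Rightarrow> 'v) \<Rightarrow> ('x \<Rightarrow> 'u) \<Rightarrow> bool" where
  "compatible D\<^sub>A D\<^sub>X T\<^sub>X T\<^sub>A \<longleftrightarrow>
    derivation A M D\<^sub>A \<and> derivation A N D\<^sub>X \<and> bounded_linear_map X N T\<^sub>X \<and>
    bounded_module_hom A X M T\<^sub>A \<and>
    (\<forall>a\<in>carrier A. \<forall>x\<in>carrier X. \<forall>y\<in>carrier X.
      T\<^sub>A (x \<otimes>\<^bsub>X\<^esub> y) = \<zero>\<^bsub>M\<^esub> \<and>
      T\<^sub>X (a \<triangleright>\<^bsub>X\<^esub> x) = Fx (D\<^sub>A a) x \<oplus>\<^bsub>N\<^esub> D\<^sub>X a \<triangleleft>\<^bsub>N'\<^esub> x \<oplus>\<^bsub>N\<^esub> a \<triangleright>\<^bsub>N\<^esub> T\<^sub>X x \<and>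
      T\<^sub>X (x \<triangleleft>\<^bsub>X\<^esub> a) = xF x (D\<^sub>A a) \<oplus>\<^bsub>N\<^esub> x \<triangleright>\<^bsub>N'\<^esub> D\<^sub>X a \<oplus>\<^bsub>N\<^esub> T\<^sub>X x \<triangleleft>\<^bsub>N\<^esub> a \<and>
      T\<^sub>X (x \<otimes>\<^bsub>X\<^esub> y) = x \<triangleright>\<^bsub>N'\<^esub> T\<^sub>X y \<oplus>\<^bsub>N\<^esub> T\<^sub>X x \<triangleleft>\<^bsub>N'\<^esub> y
                     \<oplus>\<^bsub>N\<^esub> Fx (T\<^sub>A x) y \<oplus>\<^bsub>N\<^esub> xF x (T\<^sub>A y))"

text \<open>The Leibniz rule is applied to products of elements (a, 0) and (0, x), in all four
  combinations, and split by \<open>P\<close> and \<open>Q\<close>. The \<open>P\<close> part for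
  (0, x)(0, y) = (0, xy) gives T_A(xy) = 0, since elements (0, x) act as zero in the first
  coordinate.\<close>

lemma compatible_components:
  assumes D: "derivation (A \<bowtie> X) Z D"
  shows "compatible (\<lambda>a. P (D (a, \<zero>\<^bsub>X\<^esub>))) (\<lambda>a. Q (D (a, \<zero>\<^bsub>X\<^esub>)))
    (\<lambda>x. Q (D (\<zero>\<^bsub>A\<^esub>, x))) (\<lambda>x. P (D (\<zero>\<^bsub>A\<^esub>, x)))"
proof -
  have lin: "bounded_linear_map (A \<bowtie> X) Z D" using D by (simp add: derivation_def)
  note Dc = bounded_linear_mapD(1) [OF lin]
  have leib: "D (p \<otimes>\<^bsub>A \<bowtie> X\<^esub> q) = D p \<triangleleft>\<^bsub>Z\<^esub> q \<oplus>\<^bsub>Z\<^esub> p \<triangleright>\<^bsub>Z\<^esub> D q"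
    if "p \<in> carrier (A \<bowtie> X)" "q \<in> carrier (A \<bowtie> X)" for p q
    using D that by (auto simp: derivation_def)
  note ns = B.normed_space_axioms E.normed_space_axioms
    normed_space_amalgam [OF B.normed_space_axioms E.normed_space_axioms] W.normed_space_axioms
  note inj = biproduct.bounded(3,4) [OF biproduct_amalgam [OF ns(1,2)]]
  have lins: "bounded_linear_map A M (\<lambda>a. P (D (a, \<zero>\<^bsub>X\<^esub>)))" "bounded_linear_map A N (\<lambda>a. Q (D (a, \<zero>\<^bsub>X\<^esub>)))"
    "bounded_linear_map X N (\<lambda>x. Q (D (\<zero>\<^bsub>A\<^esub>, x)))" "bounded_linear_map X M (\<lambda>x. P (D (\<zero>\<^bsub>A\<^esub>, x)))"
    by (intro bounded_linear_map_compose [OF ns(1,3) inj(1)]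
        bounded_linear_map_compose [OF ns(2,3) inj(2)]
        bounded_linear_map_compose [OF ns(3,4) lin] bounded)+
  have PQ: "P (D p \<triangleleft>\<^bsub>Z\<^esub> q \<oplus>\<^bsub>Z\<^esub> p \<triangleright>\<^bsub>Z\<^esub> D q) = P (D p) \<triangleleft>\<^bsub>M\<^esub> fst q \<oplus>\<^bsub>M\<^esub> fst p \<triangleright>\<^bsub>M\<^esub> P (D q)"
    "Q (D p \<triangleleft>\<^bsub>Z\<^esub> q \<oplus>\<^bsub>Z\<^esub> p \<triangleright>\<^bsub>Z\<^esub> D q)
      = (Fx (P (D p)) (snd q) \<oplus>\<^bsub>N\<^esub> (Q (D p) \<triangleleft>\<^bsub>N\<^esub> fst q \<oplus>\<^bsub>N\<^esub> Q (D p) \<triangleleft>\<^bsub>N'\<^esub> snd q)) \<oplus>\<^bsub>N\<^esub>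
        (xF (snd p) (P (D q)) \<oplus>\<^bsub>N\<^esub> (fst p \<triangleright>\<^bsub>N\<^esub> Q (D q) \<oplus>\<^bsub>N\<^esub> snd p \<triangleright>\<^bsub>N'\<^esub> Q (D q)))"
    if "p \<in> carrier (A \<bowtie> X)" "q \<in> carrier (A \<bowtie> X)" for p q
    using that act_components [of "fst q" "snd q" "D p"] act_components [of "fst p" "snd p" "D q"] Dc [of p] Dc [of q]
      ZM.act_closed [of q "D p"] ZM.act_closed [of p "D q"]
    by (auto simp: P Q)
  note leib' = leib [THEN arg_cong [where f = P]] leib [THEN arg_cong [where f = Q]]
  have PDc: "P (D (a, x)) \<in> carrier M" and QDc: "Q (D (a, x)) \<in> carrier N"
    if "a \<in> carrier A" "x \<in> carrier X" for a x
    using that Dc [of "(a, x)"] by (simp_all add: P Q)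
  have "derivation A M (\<lambda>a. P (D (a, \<zero>\<^bsub>X\<^esub>)))" "derivation A N (\<lambda>a. Q (D (a, \<zero>\<^bsub>X\<^esub>)))"
    unfolding derivation_def using lins leib' [of "(a, \<zero>\<^bsub>X\<^esub>)" "(b, \<zero>\<^bsub>X\<^esub>)" for a b]
    by (simp_all add: PQ PDc QDc)
  moreover have "bounded_module_hom A X M (\<lambda>x. P (D (\<zero>\<^bsub>A\<^esub>, x)))"
    unfolding bounded_module_hom_def using lins leib' [of "(a, \<zero>\<^bsub>X\<^esub>)" "(\<zero>\<^bsub>A\<^esub>, x)" for a x]
      leib' [of "(\<zero>\<^bsub>A\<^esub>, x)" "(a, \<zero>\<^bsub>X\<^esub>)" for a x]
    by (simp add: PQ PDc QDc)
  ultimately show ?thesis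
    unfolding compatible_def
    using lins leib' [of "(a, \<zero>\<^bsub>X\<^esub>)" "(\<zero>\<^bsub>A\<^esub>, x)" for a x] leib' [of "(\<zero>\<^bsub>A\<^esub>, x)" "(a, \<zero>\<^bsub>X\<^esub>)" for a x]
      leib' [of "(\<zero>\<^bsub>A\<^esub>, x)" "(\<zero>\<^bsub>A\<^esub>, y)" for x y]
    by (simp add: PQ PDc QDc V.a_ac)
qed


text \<open>The derivation is (a, x) \<mapsto> (D_A a + T_A x, D_X a + T_X x). It is the one to
  which amenability is applied when the four conditions are deduced.\<close>

lemma derivation_of_components:
  assumes c: "compatible D\<^sub>A D\<^sub>X T\<^sub>X T\<^sub>A"
  obtains D where "derivation (A \<bowtie> X) Z D" "components D D\<^sub>A D\<^sub>X T\<^sub>X T\<^sub>A"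
proof
  have der: "derivation A M D\<^sub>A" "derivation A N D\<^sub>X" "bounded_linear_map X N T\<^sub>X" "bounded_module_hom A X M T\<^sub>A"
    and T\<^sub>A: "\<And>x y. \<lbrakk>x \<in> carrier X; y \<in> carrier X\<rbrakk> \<Longrightarrow> T\<^sub>A (x \<otimes>\<^bsub>X\<^esub> y) = \<zero>\<^bsub>M\<^esub>"
    and T\<^sub>X: "\<And>a x. \<lbrakk>a \<in> carrier A; x \<in> carrier X\<rbrakk> \<Longrightarrow>
        T\<^sub>X (a \<triangleright>\<^bsub>X\<^esub> x) = Fx (D\<^sub>A a) x \<oplus>\<^bsub>N\<^esub> D\<^sub>X a \<triangleleft>\<^bsub>N'\<^esub> x \<oplus>\<^bsub>N\<^esub> a \<triangleright>\<^bsub>N\<^esub> T\<^sub>X x"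
      "\<And>a x. \<lbrakk>a \<in> carrier A; x \<in> carrier X\<rbrakk> \<Longrightarrow>
        T\<^sub>X (x \<triangleleft>\<^bsub>X\<^esub> a) = xF x (D\<^sub>A a) \<oplus>\<^bsub>N\<^esub> x \<triangleright>\<^bsub>N'\<^esub> D\<^sub>X a \<oplus>\<^bsub>N\<^esub> T\<^sub>X x \<triangleleft>\<^bsub>N\<^esub> a"
      "\<And>x y. \<lbrakk>x \<in> carrier X; y \<in> carrier X\<rbrakk> \<Longrightarrow>
        T\<^sub>X (x \<otimes>\<^bsub>X\<^esub> y) = x \<triangleright>\<^bsub>N'\<^esub> T\<^sub>X y \<oplus>\<^bsub>N\<^esub> T\<^sub>X x \<triangleleft>\<^bsub>N'\<^esub> y \<oplus>\<^bsub>N\<^esub> Fx (T\<^sub>A x) y \<oplus>\<^bsub>N\<^esub> xF x (T\<^sub>A y)"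
    \<comment> \<open>The identities are quantified jointly over \<open>a\<close>, \<open>x\<close>
      and \<open>y\<close>; zero fills the variables that an identity does not mention.\<close>
    using c B.zero_closed E.zero_closed unfolding compatible_def by blast+
  have lin: "bounded_linear_map A M D\<^sub>A" "bounded_linear_map A N D\<^sub>X" "bounded_linear_map X M T\<^sub>A"
    using der by (simp_all add: derivation_def bounded_module_hom_def)
  have D\<^sub>A: "D\<^sub>A (a \<otimes>\<^bsub>A\<^esub> b) = D\<^sub>A a \<triangleleft>\<^bsub>M\<^esub> b \<oplus>\<^bsub>M\<^esub> a \<triangleright>\<^bsub>M\<^esub> D\<^sub>A b"
    and D\<^sub>X: "D\<^sub>X (a \<otimes>\<^bsub>A\<^esub> b) = D\<^sub>X a \<triangleleft>\<^bsub>N\<^esub> b \<oplus>\<^bsub>N\<^esub> a \<triangleright>\<^bsub>N\<^esub> D\<^sub>X b" if "a \<in> carrier A" "b \<in> carrier A" for a b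
    using der that by (simp_all add: derivation_def)
  have hom: "T\<^sub>A (a \<triangleright>\<^bsub>X\<^esub> x) = a \<triangleright>\<^bsub>M\<^esub> T\<^sub>A x" "T\<^sub>A (x \<triangleleft>\<^bsub>X\<^esub> a) = T\<^sub>A x \<triangleleft>\<^bsub>M\<^esub> a"
    if "a \<in> carrier A" "x \<in> carrier X" for a x
    using der(4) that by (simp_all add: bounded_module_hom_def)
  note lins = lin(1,2) der(3) lin(3)
  note cl = lins [THEN bounded_linear_mapD(1)]
  note zero = bounded_linear_map_zero [OF B.normed_space_axioms U.normed_space_axioms lins(1)]
    bounded_linear_map_zero [OF B.normed_space_axioms V.normed_space_axioms lins(2)]
    bounded_linear_map_zero [OF E.normed_space_axioms V.normed_space_axioms lins(3)]
    bounded_linear_map_zero [OF E.normed_space_axioms U.normed_space_axioms lins(4)]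
  define D where "D p = I (D\<^sub>A (fst p) \<oplus>\<^bsub>M\<^esub> T\<^sub>A (snd p)) \<oplus>\<^bsub>Z\<^esub> J (D\<^sub>X (fst p) \<oplus>\<^bsub>N\<^esub> T\<^sub>X (snd p))" for p
  have PD: "P (D (a, x)) = D\<^sub>A a \<oplus>\<^bsub>M\<^esub> T\<^sub>A x" and QD: "Q (D (a, x)) = D\<^sub>X a \<oplus>\<^bsub>N\<^esub> T\<^sub>X x"
    if "a \<in> carrier A" "x \<in> carrier X" for a x
    using that by (simp_all add: D_def P_join Q_join cl)
  have Dc: "D (a, x) \<in> carrier Z" if "a \<in> carrier A" "x \<in> carrier X" for a x
    using that by (simp add: D_def cl I J)
  show "components D D\<^sub>A D\<^sub>X T\<^sub>X T\<^sub>A"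
    by (simp add: components_def PD QD zero cl)
  note ns = B.normed_space_axioms E.normed_space_axioms
    normed_space_amalgam [OF B.normed_space_axioms E.normed_space_axioms] W.normed_space_axioms
    U.normed_space_axioms V.normed_space_axioms
  note proj = biproduct.bounded(1,2) [OF biproduct_amalgam [OF ns(1,2)]]
  have Dlin: "bounded_linear_map (A \<bowtie> X) Z D"
    unfolding D_def [abs_def]
    by (intro bounded_linear_map_add [OF ns(3,4)] bounded_linear_map_compose [OF ns(3,5) _ bounded(3)]
        bounded_linear_map_compose [OF ns(3,6) _ bounded(4)] bounded_linear_map_add [OF ns(3,5)]
        bounded_linear_map_add [OF ns(3,6)] bounded_linear_map_compose [OF ns(3,1) proj(1)]
        bounded_linear_map_compose [OF ns(3,2) proj(2)] lins)
  show "derivation (A \<bowtie> X) Z D"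
    unfolding derivation_def
  proof (intro conjI ballI Dlin)
    fix p q assume "p \<in> carrier (A \<bowtie> X)" "q \<in> carrier (A \<bowtie> X)"
    then obtain a x b y where p: "p = (a, x)" and q: "q = (b, y)"
      and a: "a \<in> carrier A" and b: "b \<in> carrier A" and x: "x \<in> carrier X" and y: "y \<in> carrier X"
      by auto
    note in_carrier = a b x y
    have Zc: "D p \<triangleleft>\<^bsub>Z\<^esub> q \<in> carrier Z" "p \<triangleright>\<^bsub>Z\<^esub> D q \<in> carrier Z" "D (p \<otimes>\<^bsub>A \<bowtie> X\<^esub> q) \<in> carrier Z"
      by (simp_all add: p q in_carrier Dc)
    note act_add = bounded_linear_mapD(2) [OF MM.lact_linear] bounded_linear_mapD(2) [OF MM.ract_linear]
      bounded_linear_mapD(2) [OF NN.lact_linear] bounded_linear_mapD(2) [OF NN.ract_linear]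
    have X_add: "z \<triangleright>\<^bsub>N'\<^esub> (u \<oplus>\<^bsub>N\<^esub> v) = z \<triangleright>\<^bsub>N'\<^esub> u \<oplus>\<^bsub>N\<^esub> z \<triangleright>\<^bsub>N'\<^esub> v"
      "(u \<oplus>\<^bsub>N\<^esub> v) \<triangleleft>\<^bsub>N'\<^esub> z = u \<triangleleft>\<^bsub>N'\<^esub> z \<oplus>\<^bsub>N\<^esub> v \<triangleleft>\<^bsub>N'\<^esub> z"
      if "z \<in> carrier X" "u \<in> carrier N" "v \<in> carrier N" for z u v
      using that bounded_linear_mapD(2) [OF XN.lact_linear, of z u v]
        bounded_linear_mapD(2) [OF XN.ract_linear, of z u v] by (simp_all add: N'_eq)
    show "D (p \<otimes>\<^bsub>A \<bowtie> X\<^esub> q) = D p \<triangleleft>\<^bsub>Z\<^esub> q \<oplus>\<^bsub>Z\<^esub> p \<triangleright>\<^bsub>Z\<^esub> D q"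
    proof (rule amalgam_ext)
      show "P (D (p \<otimes>\<^bsub>A \<bowtie> X\<^esub> q)) = P (D p \<triangleleft>\<^bsub>Z\<^esub> q \<oplus>\<^bsub>Z\<^esub> p \<triangleright>\<^bsub>Z\<^esub> D q)"
        unfolding P(2) [OF Zc(1,2)]
        by (simp add: p q in_carrier act_components Dc PD D\<^sub>A T\<^sub>A hom cl act_add U.a_ac
            bounded_linear_mapD(2) [OF lin(3)])
      show "Q (D (p \<otimes>\<^bsub>A \<bowtie> X\<^esub> q)) = Q (D p \<triangleleft>\<^bsub>Z\<^esub> q \<oplus>\<^bsub>Z\<^esub> p \<triangleright>\<^bsub>Z\<^esub> D q)"
        unfolding Q(2) [OF Zc(1,2)]
        by (simp add: p q in_carrier act_components Dc PD QD D\<^sub>X T\<^sub>X cl act_add X_add products_add V.a_ac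
            bounded_linear_mapD(2) [OF der(3)])
    qed (simp_all add: Zc)
  qed
qed

text \<open>In the first coordinate (0, x) acts as zero, so the T_A entry of an inner derivation
  vanishes. In the second it acts by xF + xG from the left and by Fx + Gx from the right, whence
  \<delta>_F + d_G.\<close>

lemma components_inner_derivation:
  assumes "w \<in> carrier Z"
  shows "components (inner_derivation Z w) (inner_derivation M (P w)) (inner_derivation N (Q w))
    (\<lambda>x. \<delta> (P w) x \<oplus>\<^bsub>N\<^esub> inner_derivation N' (Q w) x) (\<lambda>_. \<zero>\<^bsub>M\<^esub>)"
proof -
  note minus = bounded_linear_map_minus [OF W.normed_space_axioms U.normed_space_axioms bounded(1)]
    bounded_linear_map_minus [OF W.normed_space_axioms V.normed_space_axioms bounded(2)]
  have "(a, \<zero>\<^bsub>X\<^esub>) \<triangleright>\<^bsub>Z\<^esub> w \<in> carrier Z" "w \<triangleleft>\<^bsub>Z\<^esub> (a, \<zero>\<^bsub>X\<^esub>) \<in> carrier Z" if "a \<in> carrier A" for a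
    using that assms by simp_all
  moreover have "(\<zero>\<^bsub>A\<^esub>, x) \<triangleright>\<^bsub>Z\<^esub> w \<in> carrier Z" "w \<triangleleft>\<^bsub>Z\<^esub> (\<zero>\<^bsub>A\<^esub>, x) \<in> carrier Z" if "x \<in> carrier X" for x
    using that assms by simp_all
  ultimately show ?thesis
    using assms unfolding components_def inner_derivation_def \<delta>_def
    by (simp add: minus act_components P Q N'_eq U.minus_self V.add_diff_add)
qed

lemma components_diff:
  assumes D: "bounded_linear_map (A \<bowtie> X) Z D" and D': "bounded_linear_map (A \<bowtie> X) Z D'"
    and "components D D\<^sub>A D\<^sub>X T\<^sub>X T\<^sub>A" and "components D' D\<^sub>A' D\<^sub>X' T\<^sub>X' T\<^sub>A'"
  shows "components (\<lambda>p. D p \<ominus>\<^bsub>Z\<^esub> D' p) (\<lambda>a. D\<^sub>A a \<ominus>\<^bsub>M\<^esub> D\<^sub>A' a) (\<lambda>a. D\<^sub>X a \<ominus>\<^bsub>N\<^esub> D\<^sub>X' a)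
    (\<lambda>x. T\<^sub>X x \<ominus>\<^bsub>N\<^esub> T\<^sub>X' x) (\<lambda>x. T\<^sub>A x \<ominus>\<^bsub>M\<^esub> T\<^sub>A' x)"
proof -
  note minus = bounded_linear_map_minus [OF W.normed_space_axioms U.normed_space_axioms bounded(1)]
    bounded_linear_map_minus [OF W.normed_space_axioms V.normed_space_axioms bounded(2)]
  show ?thesis
    using assms(3,4) unfolding components_def
    by (simp add: minus bounded_linear_mapD(1) [OF D] bounded_linear_mapD(1) [OF D'])
qed

text \<open>Every element is a sum (a, 0) + (0, x), and \<open>P\<close> and \<open>Q\<close>
  together separate the points of \<open>Z\<close>.\<close>

lemma components_unique:
  assumes D: "bounded_linear_map (A \<bowtie> X) Z D" and D': "bounded_linear_map (A \<bowtie> X) Z D'"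
    and "components D D\<^sub>A D\<^sub>X T\<^sub>X T\<^sub>A" and "components D' D\<^sub>A D\<^sub>X T\<^sub>X T\<^sub>A" and p: "p \<in> carrier (A \<bowtie> X)"
  shows "D p = D' p"
proof -
  obtain a x where ax: "p = (a, x)" "a \<in> carrier A" "x \<in> carrier X" using p by auto
  have c: "(a, \<zero>\<^bsub>X\<^esub>) \<in> carrier (A \<bowtie> X)" "(\<zero>\<^bsub>A\<^esub>, x) \<in> carrier (A \<bowtie> X)" using ax by simp_all
  have "D (a, \<zero>\<^bsub>X\<^esub>) = D' (a, \<zero>\<^bsub>X\<^esub>)" "D (\<zero>\<^bsub>A\<^esub>, x) = D' (\<zero>\<^bsub>A\<^esub>, x)"
    using assms(3,4) ax bounded_linear_mapD(1) [OF D] bounded_linear_mapD(1) [OF D'] c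
    by (auto intro!: amalgam_ext simp: components_def)
  moreover have "p = (a, \<zero>\<^bsub>X\<^esub>) \<oplus>\<^bsub>A \<bowtie> X\<^esub> (\<zero>\<^bsub>A\<^esub>, x)" using ax by simp
  ultimately show ?thesis
    using bounded_linear_mapD(2) [OF D c] bounded_linear_mapD(2) [OF D' c] by simp
qed

text \<open>\<open>compatible_components\<close> speaks of the literal components of
  \<open>D\<close>. This form accepts any representatives, in particular constant zero functions,
  since all clauses look at the carriers only.\<close>

lemma compatibleI:
  assumes D: "derivation (A \<bowtie> X) Z D" and "components D D\<^sub>A D\<^sub>X T\<^sub>X T\<^sub>A"
  shows "compatible D\<^sub>A D\<^sub>X T\<^sub>X T\<^sub>A"
proof -
  have eq: "\<And>a. a \<in> carrier A \<Longrightarrow> P (D (a, \<zero>\<^bsub>X\<^esub>)) = D\<^sub>A a" "\<And>a. a \<in> carrier A \<Longrightarrow> Q (D (a, \<zero>\<^bsub>X\<^esub>)) = D\<^sub>X a"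
    "\<And>x. x \<in> carrier X \<Longrightarrow> P (D (\<zero>\<^bsub>A\<^esub>, x)) = T\<^sub>A x" "\<And>x. x \<in> carrier X \<Longrightarrow> Q (D (\<zero>\<^bsub>A\<^esub>, x)) = T\<^sub>X x"
    using assms(2) by (auto simp: components_def)
  note c = compatible_components [OF D, unfolded compatible_def derivation_def bounded_module_hom_def]
  have "bounded_linear_map A M D\<^sub>A" "bounded_linear_map A N D\<^sub>X" "bounded_linear_map X M T\<^sub>A" "bounded_linear_map X N T\<^sub>X"
    using c by (auto intro: bounded_linear_map_cong [OF eq(1)] bounded_linear_map_cong [OF eq(2)]
        bounded_linear_map_cong [OF eq(3)] bounded_linear_map_cong [OF eq(4)]
        B.normed_space_axioms E.normed_space_axioms)
  then show ?thesis
    using c unfolding compatible_def derivation_def bounded_module_hom_def by (simp add: eq)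
qed

text \<open>An implementing element w has the coordinates F = P w and G = Q w, and
  \<open>components_inner_derivation\<close> expresses the entries by them.\<close>

lemma inner_components:
  assumes D: "derivation (A \<bowtie> X) Z D" and c: "components D D\<^sub>A D\<^sub>X T\<^sub>X T\<^sub>A"
    and inner: "is_inner (A \<bowtie> X) Z D"
  obtains F G where "F \<in> carrier M" "G \<in> carrier N"
    "\<And>a. a \<in> carrier A \<Longrightarrow> D\<^sub>A a = inner_derivation M F a"
    "\<And>a. a \<in> carrier A \<Longrightarrow> D\<^sub>X a = inner_derivation N G a"
    "\<And>x. x \<in> carrier X \<Longrightarrow> T\<^sub>X x = \<delta> F x \<oplus>\<^bsub>N\<^esub> inner_derivation N' G x"
    "\<And>x. x \<in> carrier X \<Longrightarrow> T\<^sub>A x = \<zero>\<^bsub>M\<^esub>"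
proof -
  obtain w where w: "w \<in> carrier Z"
    and Dw: "\<And>p. p \<in> carrier (A \<bowtie> X) \<Longrightarrow> D p = inner_derivation Z w p"
    using inner by (auto simp: is_inner_def)
  have "components D (inner_derivation M (P w)) (inner_derivation N (Q w))
    (\<lambda>x. \<delta> (P w) x \<oplus>\<^bsub>N\<^esub> inner_derivation N' (Q w) x) (\<lambda>_. \<zero>\<^bsub>M\<^esub>)"
    using components_inner_derivation [OF w] unfolding components_def by (simp add: Dw)
  with c show ?thesis
    by (intro that [of "P w" "Q w"]) (auto simp: components_def P Q w)
qed


text \<open>All four conditions are instances: the entries that a condition does not mention are
  taken to be zero functions, and the equations obtained contain its conclusion.\<close>

lemma weakly_amenable_necessary:
  assumes inner: "\<forall>D. derivation (A \<bowtie> X) Z D \<longrightarrow> is_inner (A \<bowtie> X) Z D"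
    and c: "compatible D\<^sub>A D\<^sub>X T\<^sub>X T\<^sub>A"
  obtains F G where "F \<in> carrier M" "G \<in> carrier N"
    "\<And>a. a \<in> carrier A \<Longrightarrow> D\<^sub>A a = inner_derivation M F a"
    "\<And>a. a \<in> carrier A \<Longrightarrow> D\<^sub>X a = inner_derivation N G a"
    "\<And>x. x \<in> carrier X \<Longrightarrow> T\<^sub>X x = \<delta> F x \<oplus>\<^bsub>N\<^esub> inner_derivation N' G x"
    "\<And>x. x \<in> carrier X \<Longrightarrow> T\<^sub>A x = \<zero>\<^bsub>M\<^esub>"
proof -
  obtain D where D: "derivation (A \<bowtie> X) Z D" "components D D\<^sub>A D\<^sub>X T\<^sub>X T\<^sub>A"
    using derivation_of_components [OF c] .
  show ?thesis using inner_components [OF D inner [rule_format, OF D(1)]] that by blast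
qed

text \<open>Explains the demand aF = Fa in conditions (2) and (3): there the D_A entry is zero, so
  d_F has to vanish.\<close>

lemma inner_derivation_eq_zero:
  assumes "a \<in> carrier A" "F \<in> carrier M"
  shows "inner_derivation M F a = \<zero>\<^bsub>M\<^esub> \<longleftrightarrow> a \<triangleright>\<^bsub>M\<^esub> F = F \<triangleleft>\<^bsub>M\<^esub> a"
  using assms by (simp add: inner_derivation_def U.minus_eq_iff)

text \<open>Stated for an abstract decomposition; the iterated duals are substituted
  afterwards.\<close>

theorem all_derivations_inner_iff:
  "(\<forall>D. derivation (A \<bowtie> X) Z D \<longrightarrow> is_inner (A \<bowtie> X) Z D) \<longleftrightarrow>
       (\<forall>D\<^sub>A. derivation A M D\<^sub>A \<and>
          (\<exists>D\<^sub>X T\<^sub>X T\<^sub>A. derivation A N D\<^sub>X \<and> bounded_linear_map X N T\<^sub>X \<and>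
             bounded_module_hom A X M T\<^sub>A \<and>
             (\<forall>a\<in>carrier A. \<forall>x\<in>carrier X. \<forall>y\<in>carrier X.
                T\<^sub>A (x \<otimes>\<^bsub>X\<^esub> y) = \<zero>\<^bsub>M\<^esub> \<and>
                T\<^sub>X (a \<triangleright>\<^bsub>X\<^esub> x) = Fx (D\<^sub>A a) x \<oplus>\<^bsub>N\<^esub> D\<^sub>X a \<triangleleft>\<^bsub>N'\<^esub> x \<oplus>\<^bsub>N\<^esub> a \<triangleright>\<^bsub>N\<^esub> T\<^sub>X x \<and>
                T\<^sub>X (x \<triangleleft>\<^bsub>X\<^esub> a) = xF x (D\<^sub>A a) \<oplus>\<^bsub>N\<^esub> x \<triangleright>\<^bsub>N'\<^esub> D\<^sub>X a \<oplus>\<^bsub>N\<^esub> T\<^sub>X x \<triangleleft>\<^bsub>N\<^esub> a \<and>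
                T\<^sub>X (x \<otimes>\<^bsub>X\<^esub> y) = x \<triangleright>\<^bsub>N'\<^esub> T\<^sub>X y \<oplus>\<^bsub>N\<^esub> T\<^sub>X x \<triangleleft>\<^bsub>N'\<^esub> y
                               \<oplus>\<^bsub>N\<^esub> Fx (T\<^sub>A x) y \<oplus>\<^bsub>N\<^esub> xF x (T\<^sub>A y)))
          \<longrightarrow> is_inner A M D\<^sub>A) \<and>
       (\<forall>T\<^sub>X. bounded_linear_map X N T\<^sub>X \<and>
          (\<exists>D\<^sub>X T\<^sub>A. derivation A N D\<^sub>X \<and> bounded_module_hom A X M T\<^sub>A \<and>
             (\<forall>a\<in>carrier A. \<forall>x\<in>carrier X. \<forall>y\<in>carrier X.
                T\<^sub>A (x \<otimes>\<^bsub>X\<^esub> y) = \<zero>\<^bsub>M\<^esub> \<and>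
                T\<^sub>X (a \<triangleright>\<^bsub>X\<^esub> x) = D\<^sub>X a \<triangleleft>\<^bsub>N'\<^esub> x \<oplus>\<^bsub>N\<^esub> a \<triangleright>\<^bsub>N\<^esub> T\<^sub>X x \<and>
                T\<^sub>X (x \<triangleleft>\<^bsub>X\<^esub> a) = x \<triangleright>\<^bsub>N'\<^esub> D\<^sub>X a \<oplus>\<^bsub>N\<^esub> T\<^sub>X x \<triangleleft>\<^bsub>N\<^esub> a \<and>
                T\<^sub>X (x \<otimes>\<^bsub>X\<^esub> y) = x \<triangleright>\<^bsub>N'\<^esub> T\<^sub>X y \<oplus>\<^bsub>N\<^esub> T\<^sub>X x \<triangleleft>\<^bsub>N'\<^esub> y
                               \<oplus>\<^bsub>N\<^esub> Fx (T\<^sub>A x) y \<oplus>\<^bsub>N\<^esub> xF x (T\<^sub>A y)))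
          \<longrightarrow> (\<exists>F\<in>carrier M. \<exists>G\<in>carrier N.
                (\<forall>x\<in>carrier X. T\<^sub>X x = \<delta> F x \<oplus>\<^bsub>N\<^esub> inner_derivation N' G x) \<and>
                (\<forall>a\<in>carrier A. a \<triangleright>\<^bsub>M\<^esub> F = F \<triangleleft>\<^bsub>M\<^esub> a))) \<and>
       (\<forall>D\<^sub>X. derivation A N D\<^sub>X \<and>
          (\<forall>a\<in>carrier A. \<forall>x\<in>carrier X.
             x \<triangleright>\<^bsub>N'\<^esub> D\<^sub>X a = \<zero>\<^bsub>N\<^esub> \<and> D\<^sub>X a \<triangleleft>\<^bsub>N'\<^esub> x = \<zero>\<^bsub>N\<^esub>)
          \<longrightarrow> (\<exists>G\<in>carrier N. \<exists>F\<in>carrier M.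
                (\<forall>a\<in>carrier A. D\<^sub>X a = inner_derivation N G a) \<and>
                (\<forall>x\<in>carrier X. inner_derivation N' G x \<oplus>\<^bsub>N\<^esub> \<delta> F x = \<zero>\<^bsub>N\<^esub>) \<and>
                (\<forall>a\<in>carrier A. a \<triangleright>\<^bsub>M\<^esub> F = F \<triangleleft>\<^bsub>M\<^esub> a))) \<and>
       (\<forall>T\<^sub>A. bounded_module_hom A X M T\<^sub>A \<and>
          (\<forall>x\<in>carrier X. \<forall>y\<in>carrier X. T\<^sub>A (x \<otimes>\<^bsub>X\<^esub> y) = \<zero>\<^bsub>M\<^esub>) \<and>
          (\<exists>T\<^sub>X. bounded_module_hom A X N T\<^sub>X \<and>
             (\<forall>x\<in>carrier X. \<forall>y\<in>carrier X.
                T\<^sub>X (x \<otimes>\<^bsub>X\<^esub> y) = x \<triangleright>\<^bsub>N'\<^esub> T\<^sub>X y \<oplus>\<^bsub>N\<^esub> T\<^sub>X x \<triangleleft>\<^bsub>N'\<^esub> y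
                               \<oplus>\<^bsub>N\<^esub> Fx (T\<^sub>A x) y \<oplus>\<^bsub>N\<^esub> xF x (T\<^sub>A y)))
          \<longrightarrow> (\<forall>x\<in>carrier X. T\<^sub>A x = \<zero>\<^bsub>M\<^esub>))"
  (is "?amenable \<longleftrightarrow> ?c1 \<and> ?c2 \<and> ?c3 \<and> ?c4")
proof (intro iffI)
  assume "?amenable"
  note necessary = weakly_amenable_necessary [OF this]
  have zero_D: "derivation A M (\<lambda>_. \<zero>\<^bsub>M\<^esub>)" "derivation A N (\<lambda>_. \<zero>\<^bsub>N\<^esub>)"
    by (rule MM.derivation_zero NN.derivation_zero)+
  have zero_T: "bounded_module_hom A X M (\<lambda>_. \<zero>\<^bsub>M\<^esub>)" "bounded_linear_map X N (\<lambda>_. \<zero>\<^bsub>N\<^esub>)"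
    by (simp_all add: bounded_module_hom_def bounded_linear_map_const_zero E.normed_space_axioms
        U.normed_space_axioms V.normed_space_axioms)
  have ?c1
  proof (intro allI impI, elim conjE exE)
    fix D\<^sub>A D\<^sub>X T\<^sub>X T\<^sub>A
    assume a: "derivation A M D\<^sub>A" "derivation A N D\<^sub>X" "bounded_linear_map X N T\<^sub>X" "bounded_module_hom A X M T\<^sub>A"
      and b: "\<forall>a\<in>carrier A. \<forall>x\<in>carrier X. \<forall>y\<in>carrier X.
                T\<^sub>A (x \<otimes>\<^bsub>X\<^esub> y) = \<zero>\<^bsub>M\<^esub> \<and>
                T\<^sub>X (a \<triangleright>\<^bsub>X\<^esub> x) = Fx (D\<^sub>A a) x \<oplus>\<^bsub>N\<^esub> D\<^sub>X a \<triangleleft>\<^bsub>N'\<^esub> x \<oplus>\<^bsub>N\<^esub> a \<triangleright>\<^bsub>N\<^esub> T\<^sub>X x \<and>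
                T\<^sub>X (x \<triangleleft>\<^bsub>X\<^esub> a) = xF x (D\<^sub>A a) \<oplus>\<^bsub>N\<^esub> x \<triangleright>\<^bsub>N'\<^esub> D\<^sub>X a \<oplus>\<^bsub>N\<^esub> T\<^sub>X x \<triangleleft>\<^bsub>N\<^esub> a \<and>
                T\<^sub>X (x \<otimes>\<^bsub>X\<^esub> y) = x \<triangleright>\<^bsub>N'\<^esub> T\<^sub>X y \<oplus>\<^bsub>N\<^esub> T\<^sub>X x \<triangleleft>\<^bsub>N'\<^esub> y
                               \<oplus>\<^bsub>N\<^esub> Fx (T\<^sub>A x) y \<oplus>\<^bsub>N\<^esub> xF x (T\<^sub>A y)"
    have "compatible D\<^sub>A D\<^sub>X T\<^sub>X T\<^sub>A" using a b by (simp only: compatible_def simp_thms)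
    from necessary [OF this] show "is_inner A M D\<^sub>A"
      unfolding is_inner_def by metis
  qed
  moreover have ?c2
  proof (intro allI impI, elim conjE exE)
    fix T\<^sub>X D\<^sub>X T\<^sub>A
    assume a: "bounded_linear_map X N T\<^sub>X" "derivation A N D\<^sub>X" "bounded_module_hom A X M T\<^sub>A"
      and b: "\<forall>a\<in>carrier A. \<forall>x\<in>carrier X. \<forall>y\<in>carrier X.
                T\<^sub>A (x \<otimes>\<^bsub>X\<^esub> y) = \<zero>\<^bsub>M\<^esub> \<and>
                T\<^sub>X (a \<triangleright>\<^bsub>X\<^esub> x) = D\<^sub>X a \<triangleleft>\<^bsub>N'\<^esub> x \<oplus>\<^bsub>N\<^esub> a \<triangleright>\<^bsub>N\<^esub> T\<^sub>X x \<and>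
                T\<^sub>X (x \<triangleleft>\<^bsub>X\<^esub> a) = x \<triangleright>\<^bsub>N'\<^esub> D\<^sub>X a \<oplus>\<^bsub>N\<^esub> T\<^sub>X x \<triangleleft>\<^bsub>N\<^esub> a \<and>
                T\<^sub>X (x \<otimes>\<^bsub>X\<^esub> y) = x \<triangleright>\<^bsub>N'\<^esub> T\<^sub>X y \<oplus>\<^bsub>N\<^esub> T\<^sub>X x \<triangleleft>\<^bsub>N'\<^esub> y
                               \<oplus>\<^bsub>N\<^esub> Fx (T\<^sub>A x) y \<oplus>\<^bsub>N\<^esub> xF x (T\<^sub>A y)"
    have "bounded_linear_map A N D\<^sub>X" using a by (simp add: derivation_def)
    note cl = bounded_linear_mapD(1) [OF a(1)] bounded_linear_mapD(1) [OF this]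
    have "compatible (\<lambda>_. \<zero>\<^bsub>M\<^esub>) D\<^sub>X T\<^sub>X T\<^sub>A"
      using a zero_D b by (simp add: compatible_def cl)
    from necessary [OF this] obtain F G where "F \<in> carrier M" "G \<in> carrier N"
      "\<And>a. a \<in> carrier A \<Longrightarrow> \<zero>\<^bsub>M\<^esub> = inner_derivation M F a"
      "\<And>x. x \<in> carrier X \<Longrightarrow> T\<^sub>X x = \<delta> F x \<oplus>\<^bsub>N\<^esub> inner_derivation N' G x"
      by metis
    then show "\<exists>F\<in>carrier M. \<exists>G\<in>carrier N.
                (\<forall>x\<in>carrier X. T\<^sub>X x = \<delta> F x \<oplus>\<^bsub>N\<^esub> inner_derivation N' G x) \<and>
                (\<forall>a\<in>carrier A. a \<triangleright>\<^bsub>M\<^esub> F = F \<triangleleft>\<^bsub>M\<^esub> a)"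
      by (metis inner_derivation_eq_zero)
  qed
  moreover have ?c3
  proof (intro allI impI, elim conjE)
    fix D\<^sub>X
    assume a: "derivation A N D\<^sub>X"
      and b: "\<forall>a\<in>carrier A. \<forall>x\<in>carrier X. x \<triangleright>\<^bsub>N'\<^esub> D\<^sub>X a = \<zero>\<^bsub>N\<^esub> \<and> D\<^sub>X a \<triangleleft>\<^bsub>N'\<^esub> x = \<zero>\<^bsub>N\<^esub>"
    \<comment> \<open>With D_A, T_X and T_A zero, the identities for T_X(ax) and T_X(xa) reduce to
      D_X(a)x = 0 and xD_X(a) = 0.\<close>
    have "compatible (\<lambda>_. \<zero>\<^bsub>M\<^esub>) D\<^sub>X (\<lambda>_. \<zero>\<^bsub>N\<^esub>) (\<lambda>_. \<zero>\<^bsub>M\<^esub>)"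
      using a b zero_D zero_T by (simp add: compatible_def)
    from necessary [OF this] obtain F G where FG: "F \<in> carrier M" "G \<in> carrier N"
      "\<And>a. a \<in> carrier A \<Longrightarrow> \<zero>\<^bsub>M\<^esub> = inner_derivation M F a"
      "\<And>a. a \<in> carrier A \<Longrightarrow> D\<^sub>X a = inner_derivation N G a"
      "\<And>x. x \<in> carrier X \<Longrightarrow> \<zero>\<^bsub>N\<^esub> = \<delta> F x \<oplus>\<^bsub>N\<^esub> inner_derivation N' G x"
      by metis
    have "inner_derivation N' G x \<oplus>\<^bsub>N\<^esub> \<delta> F x = \<zero>\<^bsub>N\<^esub>" if "x \<in> carrier X" for x
      using FG(5) [OF that] FG(1,2) that
      by (simp add: V.a_comm inner_derivation_def \<delta>_def N'_eq)
    with FG show "\<exists>G\<in>carrier N. \<exists>F\<in>carrier M.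
                (\<forall>a\<in>carrier A. D\<^sub>X a = inner_derivation N G a) \<and>
                (\<forall>x\<in>carrier X. inner_derivation N' G x \<oplus>\<^bsub>N\<^esub> \<delta> F x = \<zero>\<^bsub>N\<^esub>) \<and>
                (\<forall>a\<in>carrier A. a \<triangleright>\<^bsub>M\<^esub> F = F \<triangleleft>\<^bsub>M\<^esub> a)"
      by (metis inner_derivation_eq_zero)
  qed
  moreover have ?c4
  proof (intro allI impI, elim conjE exE)
    fix T\<^sub>A T\<^sub>X
    assume a: "bounded_module_hom A X M T\<^sub>A" "bounded_module_hom A X N T\<^sub>X"
      and b: "\<forall>x\<in>carrier X. \<forall>y\<in>carrier X. T\<^sub>A (x \<otimes>\<^bsub>X\<^esub> y) = \<zero>\<^bsub>M\<^esub>"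
        "\<forall>x\<in>carrier X. \<forall>y\<in>carrier X.
                T\<^sub>X (x \<otimes>\<^bsub>X\<^esub> y) = x \<triangleright>\<^bsub>N'\<^esub> T\<^sub>X y \<oplus>\<^bsub>N\<^esub> T\<^sub>X x \<triangleleft>\<^bsub>N'\<^esub> y
                               \<oplus>\<^bsub>N\<^esub> Fx (T\<^sub>A x) y \<oplus>\<^bsub>N\<^esub> xF x (T\<^sub>A y)"
    have T: "bounded_linear_map X N T\<^sub>X" using a by (simp add: bounded_module_hom_def)
    \<comment> \<open>With D_A and D_X zero, the identities for T_X(ax) and T_X(xa) say that T_X is
      a module homomorphism.\<close>
    have "compatible (\<lambda>_. \<zero>\<^bsub>M\<^esub>) (\<lambda>_. \<zero>\<^bsub>N\<^esub>) T\<^sub>X T\<^sub>A"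
      using a b zero_D T bounded_linear_mapD(1) [OF T]
      by (simp add: compatible_def bounded_module_hom_def)
    from necessary [OF this] show "\<forall>x\<in>carrier X. T\<^sub>A x = \<zero>\<^bsub>M\<^esub>" by metis
  qed
  ultimately show "?c1 \<and> ?c2 \<and> ?c3 \<and> ?c4" by blast
next
  assume c: "?c1 \<and> ?c2 \<and> ?c3 \<and> ?c4"
  have "is_inner (A \<bowtie> X) Z D" if D: "derivation (A \<bowtie> X) Z D" for D
  proof -
    note lin = derivation_def [THEN iffD1, THEN conjunct1]
    let ?diff = "\<lambda>D w p. D p \<ominus>\<^bsub>Z\<^esub> inner_derivation Z w p"
    have join: "I F \<oplus>\<^bsub>Z\<^esub> J G \<in> carrier Z" if "F \<in> carrier M" "G \<in> carrier N" for F G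
      using that by (simp add: I J)
    \<comment> \<open>One step of the reduction, for the element (F, G). The last entry changes by
      zero only, so T_A is carried through all subtractions.\<close>
    have diff: "derivation (A \<bowtie> X) Z (?diff D (I F \<oplus>\<^bsub>Z\<^esub> J G))"
      "components (?diff D (I F \<oplus>\<^bsub>Z\<^esub> J G)) (\<lambda>a. D\<^sub>A a \<ominus>\<^bsub>M\<^esub> inner_derivation M F a)
        (\<lambda>a. D\<^sub>X a \<ominus>\<^bsub>N\<^esub> inner_derivation N G a)
        (\<lambda>x. T\<^sub>X x \<ominus>\<^bsub>N\<^esub> (\<delta> F x \<oplus>\<^bsub>N\<^esub> inner_derivation N' G x)) (\<lambda>x. T\<^sub>A x \<ominus>\<^bsub>M\<^esub> \<zero>\<^bsub>M\<^esub>)"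
      if "derivation (A \<bowtie> X) Z D" "components D D\<^sub>A D\<^sub>X T\<^sub>X T\<^sub>A" "F \<in> carrier M" "G \<in> carrier N"
      for D D\<^sub>A D\<^sub>X T\<^sub>X T\<^sub>A F G
      using components_diff [OF lin [OF that(1)] ZM.bounded_linear_map_inner_derivation [OF join [OF that(3,4)]]
          that(2) components_inner_derivation [OF join [OF that(3,4)]]]
        ZM.derivation_diff [OF that(1) ZM.derivation_inner_derivation [OF join [OF that(3,4)]]] that(3,4)
      by (simp_all add: P_join Q_join)
    have inner_cl: "inner_derivation N' G x \<in> carrier N" "\<delta> F x \<in> carrier N"
      if "x \<in> carrier X" "G \<in> carrier N" "F \<in> carrier M" for x F G
      using that by (simp_all add: inner_derivation_def \<delta>_def N'_eq)

    define D\<^sub>A D\<^sub>X T\<^sub>X T\<^sub>A where "D\<^sub>A = (\<lambda>a. P (D (a, \<zero>\<^bsub>X\<^esub>)))" and "D\<^sub>X = (\<lambda>a. Q (D (a, \<zero>\<^bsub>X\<^esub>)))"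
      and "T\<^sub>X = (\<lambda>x. Q (D (\<zero>\<^bsub>A\<^esub>, x)))" and "T\<^sub>A = (\<lambda>x. P (D (\<zero>\<^bsub>A\<^esub>, x)))"
    have comp: "components D D\<^sub>A D\<^sub>X T\<^sub>X T\<^sub>A"
      by (simp add: components_def D\<^sub>A_def D\<^sub>X_def T\<^sub>X_def T\<^sub>A_def)
    have "is_inner A M D\<^sub>A"
      using c compatibleI [OF D comp] unfolding compatible_def by blast
    then obtain F where F: "F \<in> carrier M" "\<And>a. a \<in> carrier A \<Longrightarrow> D\<^sub>A a = inner_derivation M F a"
      by (auto simp: is_inner_def)

    \<comment> \<open>Only D_A is to be removed, so the second coordinate of the implementing
      element is zero. T_X changes by \<delta>_F; the remaining entries are read off anew from
      \<open>D1\<close>.\<close>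
    define D1 where "D1 = ?diff D (I F \<oplus>\<^bsub>Z\<^esub> J \<zero>\<^bsub>N\<^esub>)"
    define D1\<^sub>X T1\<^sub>X T1\<^sub>A where "D1\<^sub>X = (\<lambda>a. Q (D1 (a, \<zero>\<^bsub>X\<^esub>)))"
      and "T1\<^sub>X = (\<lambda>x. Q (D1 (\<zero>\<^bsub>A\<^esub>, x)))" and "T1\<^sub>A = (\<lambda>x. P (D1 (\<zero>\<^bsub>A\<^esub>, x)))"
    note d1 = diff [OF D comp F(1) V.zero_closed, folded D1_def]
    have comp1: "components D1 (\<lambda>_. \<zero>\<^bsub>M\<^esub>) D1\<^sub>X T1\<^sub>X T1\<^sub>A"
      using d1(2) F by (simp add: components_def D1\<^sub>X_def T1\<^sub>X_def T1\<^sub>A_def U.minus_self MM.inner_derivation_closed)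
    have compat1: "compatible (\<lambda>_. \<zero>\<^bsub>M\<^esub>) D1\<^sub>X T1\<^sub>X T1\<^sub>A" by (rule compatibleI [OF d1(1) comp1])
    then have der1: "derivation A N D1\<^sub>X" "bounded_linear_map X N T1\<^sub>X" "bounded_module_hom A X M T1\<^sub>A"
      by (simp_all add: compatible_def)
    note cl1 = bounded_linear_mapD(1) [OF lin [OF der1(1)]] bounded_linear_mapD(1) [OF der1(2)]
    have "\<exists>F\<in>carrier M. \<exists>G\<in>carrier N.
        (\<forall>x\<in>carrier X. T1\<^sub>X x = \<delta> F x \<oplus>\<^bsub>N\<^esub> inner_derivation N' G x) \<and>
        (\<forall>a\<in>carrier A. a \<triangleright>\<^bsub>M\<^esub> F = F \<triangleleft>\<^bsub>M\<^esub> a)"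
      by (rule c [THEN conjunct2, THEN conjunct1, rule_format], intro conjI exI [of _ D1\<^sub>X] exI [of _ T1\<^sub>A] der1)
        (use compat1 in \<open>simp add: compatible_def cl1\<close>)
    then obtain F1 G1 where F1: "F1 \<in> carrier M" "\<And>a. a \<in> carrier A \<Longrightarrow> a \<triangleright>\<^bsub>M\<^esub> F1 = F1 \<triangleleft>\<^bsub>M\<^esub> a"
      and G1: "G1 \<in> carrier N"
      and T1: "\<And>x. x \<in> carrier X \<Longrightarrow> T1\<^sub>X x = \<delta> F1 x \<oplus>\<^bsub>N\<^esub> inner_derivation N' G1 x"
      by blast

    define D2 where "D2 = ?diff D1 (I F1 \<oplus>\<^bsub>Z\<^esub> J G1)"
    define D2\<^sub>X T2\<^sub>A where "D2\<^sub>X = (\<lambda>a. Q (D2 (a, \<zero>\<^bsub>X\<^esub>)))" and "T2\<^sub>A = (\<lambda>x. P (D2 (\<zero>\<^bsub>A\<^esub>, x)))"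
    note d2 = diff [OF d1(1) comp1 F1(1) G1, folded D2_def]
    \<comment> \<open>\<open>F1\<close> commutes with \<open>A\<close>, so the D_A entry remains
      zero, while T_X is cancelled by the choice of \<open>F1\<close> and \<open>G1\<close>.\<close>
    have "inner_derivation M F1 a = \<zero>\<^bsub>M\<^esub>" if "a \<in> carrier A" for a
      using F1 that by (simp add: inner_derivation_eq_zero)
    then have comp2: "components D2 (\<lambda>_. \<zero>\<^bsub>M\<^esub>) D2\<^sub>X (\<lambda>_. \<zero>\<^bsub>N\<^esub>) T2\<^sub>A"
      using d2(2) F1 G1
      by (simp add: components_def D2\<^sub>X_def T2\<^sub>A_def U.minus_self V.minus_self T1 inner_cl)
    have compat2: "compatible (\<lambda>_. \<zero>\<^bsub>M\<^esub>) D2\<^sub>X (\<lambda>_. \<zero>\<^bsub>N\<^esub>) T2\<^sub>A" by (rule compatibleI [OF d2(1) comp2])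
    then have der2: "derivation A N D2\<^sub>X" by (simp add: compatible_def)
    note cl2 = bounded_linear_mapD(1) [OF lin [OF der2]]
    \<comment> \<open>The hypothesis of (3): with D_A and T_X zero, the identities for T_X(ax) and
      T_X(xa) leave D_X(a)x and xD_X(a) alone on the right.\<close>
    have annihilates: "D2\<^sub>X a \<triangleleft>\<^bsub>N'\<^esub> x = \<zero>\<^bsub>N\<^esub>" "x \<triangleright>\<^bsub>N'\<^esub> D2\<^sub>X a = \<zero>\<^bsub>N\<^esub>"
      if a: "a \<in> carrier A" and x: "x \<in> carrier X" for a x
    proof -
      have "\<zero>\<^bsub>N\<^esub> = Fx \<zero>\<^bsub>M\<^esub> x \<oplus>\<^bsub>N\<^esub> D2\<^sub>X a \<triangleleft>\<^bsub>N'\<^esub> x \<oplus>\<^bsub>N\<^esub> a \<triangleright>\<^bsub>N\<^esub> \<zero>\<^bsub>N\<^esub>"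
        using compat2 a x unfolding compatible_def by blast
      then show "D2\<^sub>X a \<triangleleft>\<^bsub>N'\<^esub> x = \<zero>\<^bsub>N\<^esub>" using a x by (simp add: cl2)
      have "\<zero>\<^bsub>N\<^esub> = xF x \<zero>\<^bsub>M\<^esub> \<oplus>\<^bsub>N\<^esub> x \<triangleright>\<^bsub>N'\<^esub> D2\<^sub>X a \<oplus>\<^bsub>N\<^esub> \<zero>\<^bsub>N\<^esub> \<triangleleft>\<^bsub>N\<^esub> a"
        using compat2 a x unfolding compatible_def by blast
      then show "x \<triangleright>\<^bsub>N'\<^esub> D2\<^sub>X a = \<zero>\<^bsub>N\<^esub>" using a x by (simp add: cl2)
    qed
    have "\<exists>G\<in>carrier N. \<exists>F\<in>carrier M.
        (\<forall>a\<in>carrier A. D2\<^sub>X a = inner_derivation N G a) \<and>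
        (\<forall>x\<in>carrier X. inner_derivation N' G x \<oplus>\<^bsub>N\<^esub> \<delta> F x = \<zero>\<^bsub>N\<^esub>) \<and>
        (\<forall>a\<in>carrier A. a \<triangleright>\<^bsub>M\<^esub> F = F \<triangleleft>\<^bsub>M\<^esub> a)"
      by (rule c [THEN conjunct2, THEN conjunct2, THEN conjunct1, rule_format], intro conjI der2)
        (simp_all add: annihilates)
    then obtain F2 G2 where F2: "F2 \<in> carrier M" "\<And>a. a \<in> carrier A \<Longrightarrow> a \<triangleright>\<^bsub>M\<^esub> F2 = F2 \<triangleleft>\<^bsub>M\<^esub> a"
      and G2: "G2 \<in> carrier N" "\<And>a. a \<in> carrier A \<Longrightarrow> D2\<^sub>X a = inner_derivation N G2 a"
      and T2: "\<And>x. x \<in> carrier X \<Longrightarrow> inner_derivation N' G2 x \<oplus>\<^bsub>N\<^esub> \<delta> F2 x = \<zero>\<^bsub>N\<^esub>"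
      by blast

    define D3 where "D3 = ?diff D2 (I F2 \<oplus>\<^bsub>Z\<^esub> J G2)"
    define T3\<^sub>A where "T3\<^sub>A = (\<lambda>x. P (D3 (\<zero>\<^bsub>A\<^esub>, x)))"
    note d3 = diff [OF d2(1) comp2 F2(1) G2(1), folded D3_def]
    \<comment> \<open>By this clause of (3), subtracting the inner derivation at (F2, G2) does not
      disturb T_X = 0.\<close>
    have T2': "\<delta> F2 x \<oplus>\<^bsub>N\<^esub> inner_derivation N' G2 x = \<zero>\<^bsub>N\<^esub>" if "x \<in> carrier X" for x
      using T2 [OF that] that F2 G2 by (simp add: V.a_comm inner_cl)
    have "inner_derivation M F2 a = \<zero>\<^bsub>M\<^esub>" if "a \<in> carrier A" for a
      using F2 that by (simp add: inner_derivation_eq_zero)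
    then have comp3: "components D3 (\<lambda>_. \<zero>\<^bsub>M\<^esub>) (\<lambda>_. \<zero>\<^bsub>N\<^esub>) (\<lambda>_. \<zero>\<^bsub>N\<^esub>) T3\<^sub>A"
      using d3(2) F2 G2
      by (simp add: components_def T3\<^sub>A_def U.minus_self V.minus_self T2' NN.inner_derivation_closed)
    have compat3: "compatible (\<lambda>_. \<zero>\<^bsub>M\<^esub>) (\<lambda>_. \<zero>\<^bsub>N\<^esub>) (\<lambda>_. \<zero>\<^bsub>N\<^esub>) T3\<^sub>A"
      by (rule compatibleI [OF d3(1) comp3])
    have "\<forall>x\<in>carrier X. T3\<^sub>A x = \<zero>\<^bsub>M\<^esub>"
    \<comment> \<open>The zero map is the module homomorphism T_X that (4) asks for; its product
      identity is the one left over in \<open>compat3\<close>.\<close>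
    proof (rule c [THEN conjunct2, THEN conjunct2, THEN conjunct2, THEN spec, THEN mp], intro conjI exI [of _ "\<lambda>_. \<zero>\<^bsub>N\<^esub>"])
      show "bounded_module_hom A X N (\<lambda>_. \<zero>\<^bsub>N\<^esub>)"
        using compat3 by (simp add: bounded_module_hom_def compatible_def)
    qed (use compat3 B.zero_closed in \<open>auto simp: compatible_def\<close>)
    with comp3 have zero3: "components D3 (\<lambda>_. \<zero>\<^bsub>M\<^esub>) (\<lambda>_. \<zero>\<^bsub>N\<^esub>) (\<lambda>_. \<zero>\<^bsub>N\<^esub>) (\<lambda>_. \<zero>\<^bsub>M\<^esub>)"
      by (simp add: components_def)
    have "P \<zero>\<^bsub>Z\<^esub> = \<zero>\<^bsub>M\<^esub>" "Q \<zero>\<^bsub>Z\<^esub> = \<zero>\<^bsub>N\<^esub>"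
      using bounded_linear_map_zero [OF W.normed_space_axioms U.normed_space_axioms bounded(1)]
        bounded_linear_map_zero [OF W.normed_space_axioms V.normed_space_axioms bounded(2)] by simp_all
    then have "components (\<lambda>_. \<zero>\<^bsub>Z\<^esub>) (\<lambda>_. \<zero>\<^bsub>M\<^esub>) (\<lambda>_. \<zero>\<^bsub>N\<^esub>) (\<lambda>_. \<zero>\<^bsub>N\<^esub>) (\<lambda>_. \<zero>\<^bsub>M\<^esub>)"
      by (simp add: components_def)
    from components_unique [OF lin [OF d3(1)] lin [OF ZM.derivation_zero] zero3 this]
    have "D3 p = inner_derivation Z \<zero>\<^bsub>Z\<^esub> p" if "p \<in> carrier (A \<bowtie> X)" for p
      using that by (simp add: inner_derivation_def W.minus_self del: amalgam_simps)
    then have "is_inner (A \<bowtie> X) Z D3" by (auto simp: is_inner_def)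
    \<comment> \<open>The subtracted inner derivations are restored in reverse order.\<close>
    then have "is_inner (A \<bowtie> X) Z D2"
      unfolding D3_def by (rule ZM.is_inner_if_diff [OF lin [OF d2(1)] join [OF F2(1) G2(1)]])
    then have "is_inner (A \<bowtie> X) Z D1"
      unfolding D2_def by (rule ZM.is_inner_if_diff [OF lin [OF d1(1)] join [OF F1(1) G1]])
    then show ?thesis
      unfolding D1_def by (rule ZM.is_inner_if_diff [OF lin [OF D] join [OF F(1) V.zero_closed]])
  qed
  then show ?amenable by blast
qed

end

section \<open>The theorem for the iterated duals\<close>

theorem theorem3p2:
  fixes A :: "('k::real_normed_field, 'a) nspace"
    and X :: "('k, 'a, 'x) bimodule"
    and U :: "('k, 'a, 'u) dual_tower"
    and V :: "('k, 'x, 'v) dual_tower"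
    and W :: "('k, 'a \<times> 'x, 'w) dual_tower"
    and n :: nat
  assumes "banach_algebra A"
    and "banach_algebra X"
    and "algebraic_banach_module A X"
    and "n \<ge> 1"
    and "is_dual_tower A U (2 * n)"
    and "is_dual_tower X V (2 * n)"
    and "is_dual_tower (A \<bowtie> X) W (2 * n)"
  shows
    "let A2n = iter_dual (self_module A) U (2 * n);   \<comment> \<open>the \<open>A\<close>-module \<open>A\<^sup>(\<^sup>2\<^sup>n\<^sup>)\<close>\<close>
         X2n = iter_dual X V (2 * n);                 \<comment> \<open>the \<open>A\<close>-module \<open>X\<^sup>(\<^sup>2\<^sup>n\<^sup>)\<close>\<close>
         XX2n = iter_dual (self_module X) V (2 * n);  \<comment> \<open>the \<open>X\<close>-module \<open>X\<^sup>(\<^sup>2\<^sup>n\<^sup>)\<close>\<close>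
         xF = prod_xF A X U V n;
         Fx = prod_Fx A X U V n;
         \<delta> = (\<lambda>F x. xF x F \<ominus>\<^bsub>X2n\<^esub> Fx F x)
     in
     weakly_amenable (2 * n) (A \<bowtie> X) W \<longleftrightarrow>
       (\<forall>D\<^sub>A. derivation A A2n D\<^sub>A \<and>
          (\<exists>D\<^sub>X T\<^sub>X T\<^sub>A. derivation A X2n D\<^sub>X \<and> bounded_linear_map X X2n T\<^sub>X \<and>
             bounded_module_hom A X A2n T\<^sub>A \<and>
             (\<forall>a\<in>carrier A. \<forall>x\<in>carrier X. \<forall>y\<in>carrier X.
                T\<^sub>A (x \<otimes>\<^bsub>X\<^esub> y) = \<zero>\<^bsub>A2n\<^esub> \<and>
                T\<^sub>X (a \<triangleright>\<^bsub>X\<^esub> x) = Fx (D\<^sub>A a) x \<oplus>\<^bsub>X2n\<^esub> D\<^sub>X a \<triangleleft>\<^bsub>XX2n\<^esub> x \<oplus>\<^bsub>X2n\<^esub> a \<triangleright>\<^bsub>X2n\<^esub> T\<^sub>X x \<and>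
                T\<^sub>X (x \<triangleleft>\<^bsub>X\<^esub> a) = xF x (D\<^sub>A a) \<oplus>\<^bsub>X2n\<^esub> x \<triangleright>\<^bsub>XX2n\<^esub> D\<^sub>X a \<oplus>\<^bsub>X2n\<^esub> T\<^sub>X x \<triangleleft>\<^bsub>X2n\<^esub> a \<and>
                T\<^sub>X (x \<otimes>\<^bsub>X\<^esub> y) = x \<triangleright>\<^bsub>XX2n\<^esub> T\<^sub>X y \<oplus>\<^bsub>X2n\<^esub> T\<^sub>X x \<triangleleft>\<^bsub>XX2n\<^esub> y
                               \<oplus>\<^bsub>X2n\<^esub> Fx (T\<^sub>A x) y \<oplus>\<^bsub>X2n\<^esub> xF x (T\<^sub>A y)))
          \<longrightarrow> is_inner A A2n D\<^sub>A) \<and>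
       (\<forall>T\<^sub>X. bounded_linear_map X X2n T\<^sub>X \<and>
          (\<exists>D\<^sub>X T\<^sub>A. derivation A X2n D\<^sub>X \<and> bounded_module_hom A X A2n T\<^sub>A \<and>
             (\<forall>a\<in>carrier A. \<forall>x\<in>carrier X. \<forall>y\<in>carrier X.
                T\<^sub>A (x \<otimes>\<^bsub>X\<^esub> y) = \<zero>\<^bsub>A2n\<^esub> \<and>
                T\<^sub>X (a \<triangleright>\<^bsub>X\<^esub> x) = D\<^sub>X a \<triangleleft>\<^bsub>XX2n\<^esub> x \<oplus>\<^bsub>X2n\<^esub> a \<triangleright>\<^bsub>X2n\<^esub> T\<^sub>X x \<and>
                T\<^sub>X (x \<triangleleft>\<^bsub>X\<^esub> a) = x \<triangleright>\<^bsub>XX2n\<^esub> D\<^sub>X a \<oplus>\<^bsub>X2n\<^esub> T\<^sub>X x \<triangleleft>\<^bsub>X2n\<^esub> a \<and>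
                T\<^sub>X (x \<otimes>\<^bsub>X\<^esub> y) = x \<triangleright>\<^bsub>XX2n\<^esub> T\<^sub>X y \<oplus>\<^bsub>X2n\<^esub> T\<^sub>X x \<triangleleft>\<^bsub>XX2n\<^esub> y
                               \<oplus>\<^bsub>X2n\<^esub> Fx (T\<^sub>A x) y \<oplus>\<^bsub>X2n\<^esub> xF x (T\<^sub>A y)))
          \<longrightarrow> (\<exists>F\<in>carrier A2n. \<exists>G\<in>carrier X2n.
                (\<forall>x\<in>carrier X. T\<^sub>X x = \<delta> F x \<oplus>\<^bsub>X2n\<^esub> inner_derivation XX2n G x) \<and>
                (\<forall>a\<in>carrier A. a \<triangleright>\<^bsub>A2n\<^esub> F = F \<triangleleft>\<^bsub>A2n\<^esub> a))) \<and>
       (\<forall>D\<^sub>X. derivation A X2n D\<^sub>X \<and>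
          (\<forall>a\<in>carrier A. \<forall>x\<in>carrier X.
             x \<triangleright>\<^bsub>XX2n\<^esub> D\<^sub>X a = \<zero>\<^bsub>X2n\<^esub> \<and> D\<^sub>X a \<triangleleft>\<^bsub>XX2n\<^esub> x = \<zero>\<^bsub>X2n\<^esub>)
          \<longrightarrow> (\<exists>G\<in>carrier X2n. \<exists>F\<in>carrier A2n.
                (\<forall>a\<in>carrier A. D\<^sub>X a = inner_derivation X2n G a) \<and>
                (\<forall>x\<in>carrier X. inner_derivation XX2n G x \<oplus>\<^bsub>X2n\<^esub> \<delta> F x = \<zero>\<^bsub>X2n\<^esub>) \<and>
                (\<forall>a\<in>carrier A. a \<triangleright>\<^bsub>A2n\<^esub> F = F \<triangleleft>\<^bsub>A2n\<^esub> a))) \<and>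
       (\<forall>T\<^sub>A. bounded_module_hom A X A2n T\<^sub>A \<and>
          (\<forall>x\<in>carrier X. \<forall>y\<in>carrier X. T\<^sub>A (x \<otimes>\<^bsub>X\<^esub> y) = \<zero>\<^bsub>A2n\<^esub>) \<and>
          (\<exists>T\<^sub>X. bounded_module_hom A X X2n T\<^sub>X \<and>
             (\<forall>x\<in>carrier X. \<forall>y\<in>carrier X.
                T\<^sub>X (x \<otimes>\<^bsub>X\<^esub> y) = x \<triangleright>\<^bsub>XX2n\<^esub> T\<^sub>X y \<oplus>\<^bsub>X2n\<^esub> T\<^sub>X x \<triangleleft>\<^bsub>XX2n\<^esub> y
                               \<oplus>\<^bsub>X2n\<^esub> Fx (T\<^sub>A x) y \<oplus>\<^bsub>X2n\<^esub> xF x (T\<^sub>A y)))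
          \<longrightarrow> (\<forall>x\<in>carrier X. T\<^sub>A x = \<zero>\<^bsub>A2n\<^esub>))"
proof -
  interpret algebraic_banach_module A X by fact
  obtain P Q I J where "amalgam_decomposition P Q I J (iter_dual (self_module A) U (2 * n))
      (iter_dual X V (2 * n)) (iter_dual (self_module (A \<bowtie> X)) W (2 * n)) A X
      (iter_dual (self_module X) V (2 * n)) (prod_xF A X U V n) (prod_Fx A X U V n)"
    using ex_amalgam_decomposition [OF assms(3,5-7) order_refl] by blast
  \<comment> \<open>The decomposition supplies the formulas in coordinates; the module laws on the
    four duals come from \<open>normed_bimodule_iter_dual\<close>.\<close>
  then interpret amalgam_bimodule P Q I J "iter_dual (self_module A) U (2 * n)"
      "iter_dual X V (2 * n)" "iter_dual (self_module (A \<bowtie> X)) W (2 * n)" A X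
      "iter_dual (self_module X) V (2 * n)" "prod_xF A X U V n" "prod_Fx A X U V n"
    using assms
    by (intro amalgam_bimodule.intro amalgam_bimodule_axioms.intro
        normed_bimodule_iter_dual [where m = "2 * n"])
      (simp_all add: normed_bimodule_self_module_banach_algebra normed_bimodule_amalgam
        normed_bimodule_banach_module banach_module_axioms)
  show ?thesis
    unfolding Let_def weakly_amenable_def
    using all_derivations_inner_iff unfolding \<delta>_def .
qed

end
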